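(* Let $\Omega=(0,1)\times(0,1)$, let $h:[0,1]\to\mathbb{R}$ be a bounded function with $h(0)=0$, $h(x_1)>0$ for $x_1\in(0,1]$, $h\in C^1(0,1]$, satisfying, for some constants $C>0$ and $\theta\in(0,1)$, $$\sup_{x\in\Omega,\ 0<r\le d}\frac{\int_{B(x,r)\cap\Omega}h(x_1)^{-1}\,dx}{|B(x,r)\cap\Omega|^{\theta}}\le C$$ ($d$ the diameter of $\Omega$). Let $S=\{V\in L^\infty(\Omega)\mid m\le V(x)\le M \text{ a.e.}\}$ with $m,M$ given nonnegative constants, and for $V\in S$ let $\Gamma(V)=\lambda_2(V)-\lambda_1(V)$. Then there exists $V^*\in S$ with $\Gamma(V^* )=\inf_{V\in S}\Gamma(V)$.
   Context: $\mathcal{H}_h^1(\Omega)=\{u\in L^2(\Omega)\mid \partial_{x_1}u\in L^2(\Omega),\ \sqrt{h(x_1)}\,\partial_{x_2}u\in L^2(\Omega)\}$; $\mathcal{H}_{h,0}^1(\Omega)$ is the closure of $C_0^\infty(\Omega)$ in $\mathcal{H}_h^1(\Omega)$. For $V\in S$, $\lambda_1(V)\le\lambda_2(V)\le\cdots$ are the eigenvalues (counted with multiplicity) of the Dirichlet problem $-(\partial_{x_1x_1}u+h(x_1)\partial_{x_2x_2}u)+Vu=\lambda u$ in $\Omega$, $u=0$ on $\partial\Omega$, understood weakly: $u\in\mathcal{H}_{h,0}^1(\Omega)\setminus\{0\}$ and $\int_\Omega \partial_{x_1}u\,\partial_{x_1}v+h(x_1)\partial_{x_2}u\,\partial_{x_2}v+Vuv\,dx=\lambda\int_\Omega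 uv\,dx$ for all $v\in\mathcal{H}_{h,0}^1(\Omega)$. *)

theory Defs
  imports "HOL-Analysis.Analysis"
begin

type_synonym R2 = "real \<times> real"

definition Omega :: "R2 set" where
  "Omega = {0<..<1} \<times> {0<..<1}"

definition pd :: "bool \<Rightarrow> (R2 \<Rightarrow> real) \<Rightarrow> R2 \<Rightarrow> real" where
  "pd j f x = (if j then deriv (\<lambda>t. f (fst x, t)) (snd x) else deriv (\<lambda>t. f (t, snd x)) (fst x))"

fun pd_iter :: "bool list \<Rightarrow> (R2 \<Rightarrow> real) \<Rightarrow> R2 \<Rightarrow> real" where
  "pd_iter [] f = f"
| "pd_iter (j # js) f = pd j (pd_iter js f)"

definition smooth2 :: "(R2 \<Rightarrow> real) \<Rightarrow> bool" where
  "smooth2 f \<longleftrightarrow> (\<forall>js. continuous_on UNIV (pd_iter js f) \<and>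
      (\<forall>x. (\<lambda>t. pd_iter js f (t, snd x)) differentiable (at (fst x)) \<and>
           (\<lambda>t. pd_iter js f (fst x, t)) differentiable (at (snd x))))"

definition test_fun :: "(R2 \<Rightarrow> real) \<Rightarrow> bool" where
  "test_fun \<phi> \<longleftrightarrow> smooth2 \<phi> \<and> compact (closure {x. \<phi> x \<noteq> 0}) \<and> closure {x. \<phi> x \<noteq> 0} \<subseteq> Omega"

abbreviation LOm :: "R2 measure" where
  "LOm \<equiv> lebesgue_on Omega"

definition L2 :: "(R2 \<Rightarrow> real) \<Rightarrow> bool" where
  "L2 u \<longleftrightarrow> u \<in> borel_measurable LOm \<and> integrable LOm (\<lambda>x. (u x)\<^sup>2)"

definition weak_pd :: "bool \<Rightarrow> (R2 \<Rightarrow> real) \<Rightarrow> (R2 \<Rightarrow> real) \<Rightarrow> bool" where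
  "weak_pd j u g \<longleftrightarrow> u \<in> borel_measurable LOm \<and> g \<in> borel_measurable LOm \<and>
     (\<forall>K. compact K \<and> K \<subseteq> Omega \<longrightarrow> integrable (lebesgue_on K) u \<and> integrable (lebesgue_on K) g) \<and>
     (\<forall>\<phi>. test_fun \<phi> \<longrightarrow>
        (\<integral>x. u x * pd j \<phi> x \<partial>LOm) = - (\<integral>x. g x * \<phi> x \<partial>LOm))"

definition Hh :: "(real \<Rightarrow> real) \<Rightarrow> (R2 \<Rightarrow> real) \<Rightarrow> (R2 \<Rightarrow> real) \<Rightarrow> (R2 \<Rightarrow> real) \<Rightarrow> bool" where
  "Hh h u g1 g2 \<longleftrightarrow> L2 u \<and> weak_pd False u g1 \<and> weak_pd True u g2 \<and> L2 g1 \<and>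
      L2 (\<lambda>x. sqrt (h (fst x)) * g2 x)"

definition Hh_dist2 :: "(real \<Rightarrow> real) \<Rightarrow> (R2 \<Rightarrow> real) \<Rightarrow> (R2 \<Rightarrow> real) \<Rightarrow> (R2 \<Rightarrow> real)
     \<Rightarrow> (R2 \<Rightarrow> real) \<Rightarrow> (R2 \<Rightarrow> real) \<Rightarrow> (R2 \<Rightarrow> real) \<Rightarrow> real" where
  "Hh_dist2 h u g1 g2 v w1 w2 =
     (\<integral>x. (u x - v x)\<^sup>2 \<partial>LOm) + (\<integral>x. (g1 x - w1 x)\<^sup>2 \<partial>LOm)
     + (\<integral>x. h (fst x) * (g2 x - w2 x)\<^sup>2 \<partial>LOm)"

definition Hh0 :: "(real \<Rightarrow> real) \<Rightarrow> (R2 \<Rightarrow> real) \<Rightarrow> (R2 \<Rightarrow> real) \<Rightarrow> (R2 \<Rightarrow> real) \<Rightarrow> bool" where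
  "Hh0 h u g1 g2 \<longleftrightarrow> Hh h u g1 g2 \<and>
     (\<exists>\<phi> :: nat \<Rightarrow> R2 \<Rightarrow> real. (\<forall>n. test_fun (\<phi> n)) \<and>
        (\<lambda>n. Hh_dist2 h u g1 g2 (\<phi> n) (pd False (\<phi> n)) (pd True (\<phi> n))) \<longlonglongrightarrow> 0)"

definition eigenpair :: "(real \<Rightarrow> real) \<Rightarrow> (R2 \<Rightarrow> real) \<Rightarrow> real \<Rightarrow> (R2 \<Rightarrow> real) \<Rightarrow> bool" where
  "eigenpair h V lam u \<longleftrightarrow>
     (\<exists>g1 g2. Hh0 h u g1 g2 \<and> \<not> (AE x in LOm. u x = 0) \<and>
       (\<forall>v w1 w2. Hh0 h v w1 w2 \<longrightarrow>
          (\<integral>x. g1 x * w1 x + h (fst x) * g2 x * w2 x + V x * u x * v x \<partial>LOm)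
            = lam * (\<integral>x. u x * v x \<partial>LOm)))"

definition lin_indep_ae :: "nat \<Rightarrow> (nat \<Rightarrow> R2 \<Rightarrow> real) \<Rightarrow> bool" where
  "lin_indep_ae k u \<longleftrightarrow>
     (\<forall>c :: nat \<Rightarrow> real. (AE x in LOm. (\<Sum>i<k. c i * u i x) = 0) \<longrightarrow> (\<forall>i<k. c i = 0))"

text \<open>k-th eigenvalue (k >= 1) counted with multiplicity: the least mu such that there are
  k linearly independent eigenfunctions with eigenvalues \<le> mu.\<close>
definition eig :: "(real \<Rightarrow> real) \<Rightarrow> (R2 \<Rightarrow> real) \<Rightarrow> nat \<Rightarrow> real" where
  "eig h V k = Inf {mu. \<exists>(u :: nat \<Rightarrow> R2 \<Rightarrow> real) (l :: nat \<Rightarrow> real).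
       (\<forall>i<k. l i \<le> mu \<and> eigenpair h V (l i) (u i)) \<and> lin_indep_ae k u}"

definition Gap :: "(real \<Rightarrow> real) \<Rightarrow> (R2 \<Rightarrow> real) \<Rightarrow> real" where
  "Gap h V = eig h V 2 - eig h V 1"

definition Sadm :: "real \<Rightarrow> real \<Rightarrow> (R2 \<Rightarrow> real) set" where
  "Sadm m M = {V. V \<in> borel_measurable LOm \<and> (AE x in LOm. m \<le> V x \<and> V x \<le> M)}"

end

theory Submission
  imports Defs "HOL-Complex_Analysis.Great_Picard"
begin

text \<open>
  The form domain is the closure of the triples \<open>(\<phi>, \<partial>\<^sub>1\<phi>, \<surd>h \<partial>\<^sub>2\<phi>)\<close> of test functions in three copies
  of \<open>L\<^sup>2\<close>. Its embedding into \<open>L\<^sup>2\<close> is compact: near the degenerate edge \<open>x\<^sub>1 = 0\<close> the Dirichlet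
  condition gives \<open>u\<^sup>2 \<le> x\<^sub>1 \<integral> (\<partial>\<^sub>1u)\<^sup>2\<close>, and away from it \<open>h\<close> is bounded below, so that averages over small
  squares approximate \<open>u\<close>. Compactness yields the two lowest eigenvalues by minimising the Rayleigh
  quotient. A minimising sequence of potentials has a subsequence converging weakly in \<open>L\<^sup>2\<close>, the
  limit is admissible because \<open>S\<close> is closed and convex, and on functions of bounded energy
  weakly convergent potentials converge uniformly as quadratic forms. Hence both eigenvalues, and with
  them the gap, converge along the subsequence.
\<close>

subsection \<open>Hilbert spaces\<close>

text \<open>The gap is a difference, so semicontinuity of each eigenvalue would not suffice: both
  must converge. Weak convergence of potentials controls integrals of \<open>V\<close> only against
  fixed functions, whereas the eigenfunctions that compete in the Rayleigh quotients move with
  \<open>n\<close>. Replacing a function by its cell averages reconciles the two: the error is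
  uniformly small at bounded energy, and what remains is a finite matrix of numbers. As the same
  averages carry the compactness, weak limits are needed only against countably many functions. The
  weight is absorbed as a factor \<open>sqh\<close> into the third component, which turns the
  weighted norm into a plain product norm. Finally \<open>eig\<close> speaks of arbitrary
  independent eigenfunctions and not of minimisation, so the variational values have to be
  identified with it.\<close>

lemma nested_closed_convex_nonempty_Inter:
  fixes C :: "nat \<Rightarrow> 'a::{real_inner,complete_space} set"
  assumes "\<And>n. closed (C n)" "\<And>n. convex (C n)" "decseq C"
    and sel: "\<And>n. v n \<in> C n" and bdd: "\<And>n. norm (v n) \<le> B"
  shows "\<exists>p. \<forall>n. p \<in> C n"
proof -
  define d where "d n = infdist 0 (C n)" for n
  have dec: "C m \<subseteq> C n" if "n \<le> m" for n m
    using \<open>decseq C\<close> that by (auto simp: decseq_def)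
  have ne: "C n \<noteq> {}" for n using sel by blast
  have d_le: "d n \<le> norm x" if "x \<in> C n" for n x
    using infdist_le[OF that, of 0] by (simp add: d_def)
  have d_mono: "d n \<le> d m" if "n \<le> m" for n m
    unfolding d_def by (intro infdist_mono dec that ne)
  have d_nn: "0 \<le> d n" for n by (simp add: d_def infdist_nonneg)
  have dB: "d n \<le> B" for n using d_le[OF sel] bdd order_trans by blast
  have "incseq d" using d_mono by (auto simp: incseq_def)
  then obtain L where L: "d \<longlonglongrightarrow> L" and dL: "\<And>n. d n \<le> L"
    using incseq_convergent[of d B] dB by auto
  have ex: "\<exists>x\<in>C n. norm x < d n + 1 / Suc n" for n
  proof (rule ccontr)
    assume "\<not> ?thesis"
    then have "\<And>x. x \<in> C n \<Longrightarrow> d n + 1 / Suc n \<le> dist 0 x" by (force simp: not_less)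
    then have "d n + 1 / Suc n \<le> infdist 0 (C n)"
      unfolding infdist_notempty[OF ne] by (intro cINF_greatest ne) auto
    then show False by (simp add: d_def)
  qed
  then obtain p where pC: "\<And>n. p n \<in> C n" and p: "\<And>n. norm (p n) < d n + 1 / Suc n" by metis
  \<comment> \<open>For \<open>n \<le> m\<close> both points lie in the convex set
    \<open>C n\<close>, hence so does their midpoint, and its norm is at least \<open>d n\<close>.
    The parallelogram identity turns this into closeness; the right side tends to 0 because
    \<open>d\<close> increases to \<open>L\<close>.\<close>
  have est: "(norm (p n - p m))\<^sup>2 \<le> 4 * ((L + 1 / Suc n)\<^sup>2 - (d n)\<^sup>2)" if "n \<le> m" for n m
  proof -
    have "(1/2) *\<^sub>R p n + (1/2) *\<^sub>R p m \<in> C n"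
      using assms(2)[of n] pC[of n] dec[OF that] pC[of m] by (intro convexD) auto
    from d_le[OF this] have "d n \<le> norm (p n + p m) / 2"
      by (simp flip: scaleR_add_right)
    then have "4 * (d n)\<^sup>2 \<le> (norm (p n + p m))\<^sup>2"
      using power_mono[of "2 * d n" "norm (p n + p m)" 2] d_nn[of n] by (simp add: power_mult_distrib)
    moreover have "(norm (p n + p m))\<^sup>2 + (norm (p n - p m))\<^sup>2 = 2 * (norm (p n))\<^sup>2 + 2 * (norm (p m))\<^sup>2"
      by (simp add: power2_norm_eq_inner inner_simps inner_commute)
    moreover have "norm (p n) \<le> L + 1 / Suc n" using p[of n] dL[of n] by linarith
    then have "(norm (p n))\<^sup>2 \<le> (L + 1 / Suc n)\<^sup>2" by (intro power_mono) auto
    moreover have "1 / real (Suc m) \<le> 1 / Suc n" using that by (intro divide_left_mono) auto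
    then have "norm (p m) \<le> L + 1 / Suc n" using p[of m] dL[of m] by linarith
    then have "(norm (p m))\<^sup>2 \<le> (L + 1 / Suc n)\<^sup>2" by (intro power_mono) auto
    moreover define A where "A = (L + 1 / Suc n)\<^sup>2"
    ultimately show ?thesis unfolding A_def[symmetric] by argo
  qed
  have "(\<lambda>n. 4 * ((L + 1 / Suc n)\<^sup>2 - (d n)\<^sup>2)) \<longlonglongrightarrow> 4 * ((L + 0)\<^sup>2 - L\<^sup>2)"
    by (intro tendsto_intros L LIMSEQ_Suc[OF lim_1_over_n])
  then have lim: "(\<lambda>n. 4 * ((L + 1 / Suc n)\<^sup>2 - (d n)\<^sup>2)) \<longlonglongrightarrow> 0" by simp
  have "Cauchy p"
  proof (rule metric_CauchyI)
    fix e :: real assume e: "0 < e"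
    then have "eventually (\<lambda>n. 4 * ((L + 1 / Suc n)\<^sup>2 - (d n)\<^sup>2) < (e/2)\<^sup>2) sequentially"
      using order_tendstoD(2)[OF lim, of "(e/2)\<^sup>2"] by simp
    then obtain N where N: "4 * ((L + 1 / Suc N)\<^sup>2 - (d N)\<^sup>2) < (e/2)\<^sup>2"
      by (auto simp: eventually_sequentially)
    have *: "dist (p N) (p m) < e/2" if "N \<le> m" for m
    proof -
      have "(norm (p N - p m))\<^sup>2 < (e/2)\<^sup>2" using est[OF that] N by linarith
      then show ?thesis using e power_less_imp_less_base[of "norm (p N - p m)" 2 "e/2"] by (simp add: dist_norm)
    qed
    show "\<exists>M. \<forall>m\<ge>M. \<forall>n\<ge>M. dist (p m) (p n) < e"
      using * by (meson dist_commute dist_triangle_half_r)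
  qed
  then obtain q where q: "p \<longlonglongrightarrow> q" using Cauchy_convergent convergent_def by blast
  have "q \<in> C n" for n
  proof (rule Lim_in_closed_set[OF assms(1) _ _ q])
    show "\<forall>\<^sub>F x in sequentially. p x \<in> C n"
      using pC dec by (auto simp: eventually_sequentially intro!: exI[of _ n])
  qed auto
  then show ?thesis by blast
qed

text \<open>A diagonal argument makes the inner products with all members of \<open>D\<close>
  converge. The limit vector is a common point of the closed convex hulls of the tails; as these
  hulls lie in \<open>K\<close>, the membership \<open>w \<in> K\<close> comes for free.\<close>

lemma weakly_convergent_subsequence:
  fixes v :: "nat \<Rightarrow> 'a::{real_inner,complete_space}"
  assumes K: "closed K" "convex K" "\<And>n. v n \<in> K" and bdd: "\<And>n. norm (v n) \<le> B"
    and D: "countable D"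
  obtains r w where "strict_mono (r :: nat \<Rightarrow> nat)" "w \<in> K"
    "\<And>y. y \<in> D \<Longrightarrow> (\<lambda>n. inner (v (r n)) y) \<longlonglongrightarrow> inner w y"
proof -
  have B0: "0 \<le> B" using bdd[of 0] norm_ge_zero order_trans by blast
  \<comment> \<open>The diagonal argument needs one bound for all \<open>y\<close>, hence the
    normalisation by \<open>sgn\<close>; the factor \<open>norm y\<close> is restored
    afterwards.\<close>
  have "norm (inner (v n) (sgn y)) \<le> B" for n y
  proof -
    have "norm (inner (v n) (sgn y)) \<le> norm (v n) * norm (sgn y)"
      by (simp add: Cauchy_Schwarz_ineq2)
    also have "\<dots> \<le> B * 1" by (intro mult_mono bdd B0) (auto simp: norm_sgn)
    finally show ?thesis by simp
  qed
  from function_convergent_subsequence[of D "\<lambda>n y. inner (v n) (sgn y)" B, OF D this]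
  obtain r :: "nat \<Rightarrow> nat" where r: "strict_mono r"
    and "\<And>y. y \<in> D \<Longrightarrow> \<exists>l. (\<lambda>n. inner (v (r n)) (sgn y)) \<longlonglongrightarrow> l" by metis
  then obtain l where l: "\<And>y. y \<in> D \<Longrightarrow> (\<lambda>n. inner (v (r n)) (sgn y)) \<longlonglongrightarrow> l y" by metis
  have lim: "(\<lambda>n. inner (v (r n)) y) \<longlonglongrightarrow> norm y * l y" if "y \<in> D" for y
  proof -
    have "inner (v (r n)) y = norm y * inner (v (r n)) (sgn y)" for n
      by (cases "y = 0") (simp_all add: sgn_div_norm)
    then show ?thesis using tendsto_mult_left[OF l[OF that], of "norm y"] by simp
  qed
  define C where "C n = closure (convex hull ((\<lambda>k. v (r k)) ` {n..}))" for n
  have "\<exists>p. \<forall>n. p \<in> C n"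
  proof (rule nested_closed_convex_nonempty_Inter)
    show "v (r n) \<in> C n" for n
      unfolding C_def by (intro closure_subset[THEN subsetD] hull_inc) auto
    show "decseq C" unfolding C_def decseq_def
      by (intro allI impI closure_mono hull_mono image_mono) auto
  qed (use bdd in \<open>auto simp: C_def convex_convex_hull convex_closure\<close>)
  then obtain w where w: "\<And>n. w \<in> C n" by blast
  have CK: "C n \<subseteq> S" if "closed S" "convex S" "\<And>k. k \<ge> n \<Longrightarrow> v (r k) \<in> S" for n S
    unfolding C_def using that by (intro closure_minimal hull_minimal) auto
  have "w \<in> K" using CK[of K 0] K w by blast
  moreover have "(\<lambda>n. inner (v (r n)) y) \<longlonglongrightarrow> inner w y" if "y \<in> D" for y
  proof -
    have "\<bar>inner w y - norm y * l y\<bar> \<le> e" if e: "0 < e" for e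
    proof -
      let ?l = "norm y * l y"
      obtain N where N: "\<And>n. n \<ge> N \<Longrightarrow> \<bar>inner (v (r n)) y - ?l\<bar> < e"
        using LIMSEQ_D[OF lim[OF \<open>y \<in> D\<close>] e] by (auto simp: real_norm_def)
      \<comment> \<open>A closed convex slab containing the tail from \<open>N\<close> on; it
        therefore contains the closed hull \<open>C N\<close> and with it \<open>w\<close>.\<close>
      let ?S = "{x. inner y x \<le> ?l + e} \<inter> {x. inner y x \<ge> ?l - e}"
      have "C N \<subseteq> ?S"
      proof (rule CK)
        show "closed ?S" by (intro closed_Int closed_halfspace_le closed_halfspace_ge)
        show "convex ?S" by (intro convex_Int convex_halfspace_le convex_halfspace_ge)
        show "v (r k) \<in> ?S" if "k \<ge> N" for k
          using N[OF that] by (auto simp: inner_commute abs_less_iff)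
      qed
      then show ?thesis using w[of N] by (auto simp: inner_commute abs_le_iff)
    qed
    then have "\<bar>inner w y - norm y * l y\<bar> \<le> 0" by (meson field_le_epsilon add_0 order_trans le_add_same_cancel2 dense_ge)
    then show ?thesis using lim[OF that] by simp
  qed
  ultimately show ?thesis using r that by blast
qed

subsection \<open>The two lowest eigenvalues of a form with compact domain\<close>

text \<open>An element of the form domain is a pair of a function and its (weighted) gradient.\<close>

definition energy :: "('a::real_inner \<Rightarrow> 'a \<Rightarrow> real) \<Rightarrow> 'a \<times> 'b::real_inner \<Rightarrow> 'a \<times> 'b \<Rightarrow> real" where
  "energy q U W = inner (snd U) (snd W) + q (fst U) (fst W)"

text \<open>Abstracts multiplication by a function with values in \<open>[0, M]\<close>.
  Nonnegativity lets the energy dominate the gradient part, and one \<open>M\<close> shared by a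
  whole family makes estimates uniform over it.\<close>

definition potential :: "real \<Rightarrow> ('a::real_inner \<Rightarrow> 'a \<Rightarrow> real) \<Rightarrow> bool" where
  "potential M q \<longleftrightarrow> bounded_bilinear q \<and> (\<forall>u v. q u v = q v u) \<and>
     (\<forall>u. 0 \<le> q u u) \<and> (\<forall>u v. \<bar>q u v\<bar> \<le> M * (norm u * norm v))"

text \<open>The equations make \<open>l1\<close> and \<open>l2\<close> eigenvalues, the two
  inequalities make them the lowest ones. The equation for \<open>E2\<close> is tested against all
  of \<open>H\<close>, not merely against the complement of \<open>E1\<close>.\<close>

definition eigensystem ::
  "('a::real_inner \<times> 'b::real_inner) set \<Rightarrow> ('a \<Rightarrow> 'a \<Rightarrow> real) \<Rightarrow> 'a \<times> 'b \<Rightarrow> real \<Rightarrow> 'a \<times> 'b \<Rightarrow> real \<Rightarrow> bool"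
  where "eigensystem H q E1 l1 E2 l2 \<longleftrightarrow>
    E1 \<in> H \<and> E2 \<in> H \<and> norm (fst E1) = 1 \<and> norm (fst E2) = 1 \<and> inner (fst E1) (fst E2) = 0 \<and>
    (\<forall>W\<in>H. energy q E1 W = l1 * inner (fst E1) (fst W)) \<and>
    (\<forall>W\<in>H. energy q E2 W = l2 * inner (fst E2) (fst W)) \<and>
    (\<forall>U\<in>H. l1 * (norm (fst U))\<^sup>2 \<le> energy q U U) \<and>
    (\<forall>U\<in>H. inner (fst E1) (fst U) = 0 \<longrightarrow> l2 * (norm (fst U))\<^sup>2 \<le> energy q U U)"

lemma norm_prod_sq: "(norm U)\<^sup>2 = (norm (fst U))\<^sup>2 + (norm (snd U))\<^sup>2"
  by (simp add: norm_prod_def)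

lemma energy_commute: "potential M q \<Longrightarrow> energy q U W = energy q W U"
  by (simp add: energy_def potential_def inner_commute)

lemma energy_lin:
  assumes "potential M q"
  shows "energy q (U + U') W = energy q U W + energy q U' W"
    "energy q (U - U') W = energy q U W - energy q U' W"
    "energy q (c *\<^sub>R U) W = c * energy q U W"
    "energy q W (U + U') = energy q W U + energy q W U'"
    "energy q W (U - U') = energy q W U - energy q W U'"
    "energy q W (c *\<^sub>R U) = c * energy q W U"
proof -
  interpret bounded_bilinear q using assms by (simp add: potential_def)
  show "energy q (U + U') W = energy q U W + energy q U' W"
    "energy q (U - U') W = energy q U W - energy q U' W"
    "energy q (c *\<^sub>R U) W = c * energy q U W"
    "energy q W (U + U') = energy q W U + energy q W U'"
    "energy q W (U - U') = energy q W U - energy q W U'"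
    "energy q W (c *\<^sub>R U) = c * energy q W U"
    by (simp_all add: energy_def inner_simps add_left add_right diff_left diff_right
        scaleR_left scaleR_right algebra_simps)
qed

lemma energy_ge_snd: "potential M q \<Longrightarrow> (norm (snd U))\<^sup>2 \<le> energy q U U"
  by (simp add: energy_def potential_def power2_norm_eq_inner)

lemma energy_ge_0: "potential M q \<Longrightarrow> 0 \<le> energy q U U"
  using energy_ge_snd[of M q U] zero_le_power2[of "norm (snd U)"] by linarith

lemma tendsto_energy:
  assumes "potential M q" "(f \<longlongrightarrow> U) F" "(g \<longlongrightarrow> W) F"
  shows "((\<lambda>n. energy q (f n) (g n)) \<longlongrightarrow> energy q U W) F"
proof -
  interpret bounded_bilinear q using assms by (simp add: potential_def)
  show ?thesis unfolding energy_def using assms(2,3) by (intro tendsto_intros tendsto)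
qed

text \<open>Compactness of the embedding \<^term>\<open>fst\<close> is expressed through uniform approximation by the
  finite rank operators that a countable family \<open>\<W>\<close> generates; the same operators later
  reduce the convergence of potentials to that of countably many matrix elements.\<close>

locale compact_form_domain =
  fixes H :: "('a::{real_inner,complete_space} \<times> 'b::{real_inner,complete_space}) set" and \<W> :: "'a set"
  assumes subspace_H: "subspace H" and closed_H: "closed H" and countable_\<W>: "countable \<W>"
    and finite_rank_approx: "\<And>\<epsilon>. 0 < \<epsilon> \<Longrightarrow> \<exists>W\<subseteq>\<W>. finite W \<and>
      (\<forall>U\<in>H. norm (fst U - (\<Sum>w\<in>W. inner (fst U) w *\<^sub>R w)) \<le> \<epsilon> * norm U)"
begin

text \<open>On a bounded sequence the first components are uniformly close to finite sums whose
  coefficients are inner products with members of \<open>\<W>\<close>. One subsequence makes all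
  these coefficients converge, so the sums, and by a three-term estimate the first components, are
  Cauchy.\<close>

lemma compact_fst:
  assumes U: "\<And>n. U n \<in> H" and "bounded (range U)"
  shows "\<exists>r :: nat \<Rightarrow> nat. strict_mono r \<and> convergent (\<lambda>n. fst (U (r n)))"
proof -
  obtain B where B: "B > 0" "\<And>n. norm (U n) \<le> B" using assms(2) by (auto simp: bounded_pos)
  have "norm (fst (U n)) \<le> B" for n
    using B(2)[of n] norm_fst_le[of "fst (U n)" "snd (U n)"] by simp
  then obtain r :: "nat \<Rightarrow> nat" and x where r: "strict_mono r"
    and x: "\<And>y. y \<in> \<W> \<Longrightarrow> (\<lambda>n. inner (fst (U (r n))) y) \<longlonglongrightarrow> inner x y"
    using weakly_convergent_subsequence[of UNIV "\<lambda>n. fst (U n)" B \<W>, OF _ _ _ _ countable_\<W>] by auto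
  have "Cauchy (\<lambda>n. fst (U (r n)))"
  proof (rule metric_CauchyI)
    fix e :: real assume e: "0 < e"
    obtain W where W: "W \<subseteq> \<W>" "finite W"
      "\<And>U. U \<in> H \<Longrightarrow> norm (fst U - (\<Sum>w\<in>W. inner (fst U) w *\<^sub>R w)) \<le> e / (3 * B) * norm U"
      using finite_rank_approx[of "e / (3 * B)"] e B by auto
    define P where "P n = (\<Sum>w\<in>W. inner (fst (U (r n))) w *\<^sub>R w)" for n
    have "P \<longlonglongrightarrow> (\<Sum>w\<in>W. inner x w *\<^sub>R w)"
      unfolding P_def using W(1) x by (intro tendsto_sum tendsto_scaleR tendsto_const) auto
    then have "Cauchy P" using convergent_Cauchy convergent_def by blast
    then obtain N where N: "\<And>m n. m \<ge> N \<Longrightarrow> n \<ge> N \<Longrightarrow> dist (P m) (P n) < e / 3"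
      using e unfolding Cauchy_def by (meson divide_pos_pos zero_less_numeral)
    have *: "dist (fst (U (r n))) (P n) \<le> e / 3" for n
    proof -
      have "dist (fst (U (r n))) (P n) \<le> e / (3 * B) * norm (U (r n))"
        using W(3)[OF U] by (simp add: P_def dist_norm)
      also have "\<dots> \<le> e / (3 * B) * B" using e B by (intro mult_left_mono) auto
      finally show ?thesis using B by simp
    qed
    have "dist (fst (U (r m))) (fst (U (r n))) < e" if "m \<ge> N" "n \<ge> N" for m n
    proof -
      have "dist (fst (U (r m))) (fst (U (r n)))
        \<le> dist (fst (U (r m))) (P m) + dist (P m) (P n) + dist (fst (U (r n))) (P n)"
        by metric
      then show ?thesis using *[of m] *[of n] N[OF that] by linarith
    qed
    then show "\<exists>M. \<forall>m\<ge>M. \<forall>n\<ge>M. dist (fst (U (r m))) (fst (U (r n))) < e" by blast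
  qed
  then show ?thesis using r Cauchy_convergent by blast
qed

text \<open>By the parallelogram identity a minimising sequence whose first components converge is
  itself Cauchy, so no weak convergence is needed.\<close>

lemma rayleigh_minimizer_exists:
  assumes q: "potential M q" and G: "subspace G" "closed G" "G \<subseteq> H" and U0: "U0 \<in> G" "fst U0 \<noteq> 0"
  obtains E where "E \<in> G" "norm (fst E) = 1"
    "\<And>U. U \<in> G \<Longrightarrow> energy q E E * (norm (fst U))\<^sup>2 \<le> energy q U U"
proof -
  define S where "S = {energy q U U |U. U \<in> G \<and> norm (fst U) = 1}"
  define l where "l = Inf S"
  have norm1: "norm (fst ((1 / norm (fst U)) *\<^sub>R U)) = 1" if "fst U \<noteq> 0" for U :: "'a \<times> 'b"
    using that by simp
  have "energy q ((1 / norm (fst U0)) *\<^sub>R U0) ((1 / norm (fst U0)) *\<^sub>R U0) \<in> S"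
    unfolding S_def using G U0 norm1 by (blast intro: subspace_scale)
  then have Sne: "S \<noteq> {}" by blast
  have Sbdd: "bdd_below S" unfolding S_def by (rule bdd_belowI[of _ 0]) (auto simp: energy_ge_0[OF q])
  have l0: "0 \<le> l" unfolding l_def by (rule cInf_greatest[OF Sne]) (auto simp: S_def energy_ge_0[OF q])
  have lU: "l * (norm (fst U))\<^sup>2 \<le> energy q U U" if U: "U \<in> G" for U
  proof (cases "fst U = 0")
    case True then show ?thesis by (simp add: energy_ge_0[OF q])
  next
    case False
    let ?c = "1 / norm (fst U)"
    have "energy q (?c *\<^sub>R U) (?c *\<^sub>R U) \<in> S"
      unfolding S_def using G(1) U norm1[OF False] by (blast intro: subspace_scale)
    then have "l \<le> energy q (?c *\<^sub>R U) (?c *\<^sub>R U)" unfolding l_def by (rule cInf_lower[OF _ Sbdd])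
    also have "\<dots> = energy q U U / (norm (fst U))\<^sup>2"
      by (simp add: energy_lin[OF q] power2_eq_square)
    finally show ?thesis using False by (simp add: field_simps)
  qed
  have "\<exists>U. U \<in> G \<and> norm (fst U) = 1 \<and> energy q U U < l + 1 / Suc n" for n
  proof -
    have "\<exists>x\<in>S. x < l + 1 / Suc n"
      using cInf_less_iff[OF Sne Sbdd, of "l + 1 / Suc n"] by (simp add: l_def)
    then show ?thesis unfolding S_def by blast
  qed
  then obtain X where X: "\<And>n. X n \<in> G" "\<And>n. norm (fst (X n)) = 1"
    "\<And>n. energy q (X n) (X n) < l + 1 / Suc n" by metis
  have "(norm (X n))\<^sup>2 \<le> (l + 2)\<^sup>2" for n
  proof -
    have "(norm (X n))\<^sup>2 \<le> 1 + (l + 1 / Suc n)"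
      using energy_ge_snd[OF q, of "X n"] X(2,3)[of n] by (simp add: norm_prod_sq)
    also have "\<dots> \<le> l + 2" by simp
    also have "\<dots> \<le> (l + 2)\<^sup>2" using l0 by (simp add: power2_eq_square)
    finally show ?thesis .
  qed
  then have "norm (X n) \<le> l + 2" for n
    by (rule power2_le_imp_le) (use l0 in simp)
  then have "bounded (range X)" by (auto intro!: boundedI)
  then obtain r where r: "strict_mono r" and conv: "convergent (\<lambda>n. fst (X (r n)))"
    using compact_fst[of X] X(1) G(3) by blast
  define Y where "Y n = X (r n)" for n
  have Y: "Y n \<in> G" "norm (fst (Y n)) = 1" "energy q (Y n) (Y n) < l + 1 / Suc n" for n
  proof -
    have "1 / real (Suc (r n)) \<le> 1 / Suc n"
      using seq_suble[OF r, of n] by (intro divide_left_mono) auto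
    then show "energy q (Y n) (Y n) < l + 1 / Suc n" using X(3)[of "r n"] by (simp add: Y_def)
  qed (simp_all add: X Y_def)
  \<comment> \<open>The energy of \<open>Y n + Y m\<close> is bounded below by \<open>lU\<close>, so
    the parallelogram identity leaves for the difference only \<open>l\<close> times the squared
    distance of the first components and the two excesses over \<open>l\<close>.\<close>
  have est: "(norm (Y n - Y m))\<^sup>2 \<le> (1 + l) * (norm (fst (Y n) - fst (Y m)))\<^sup>2 + 2 / Suc n + 2 / Suc m" for n m
  proof -
    have par: "(norm (fst (Y n) + fst (Y m)))\<^sup>2 = 4 - (norm (fst (Y n) - fst (Y m)))\<^sup>2"
    proof -
      have "inner (fst (Y k)) (fst (Y k)) = 1" for k using Y(2)[of k] by (simp flip: power2_norm_eq_inner)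
      then show ?thesis by (simp add: power2_norm_eq_inner inner_simps inner_commute)
    qed
    have "(norm (snd (Y n - Y m)))\<^sup>2 \<le> energy q (Y n - Y m) (Y n - Y m)" by (rule energy_ge_snd[OF q])
    also have "\<dots> = 2 * energy q (Y n) (Y n) + 2 * energy q (Y m) (Y m) - energy q (Y n + Y m) (Y n + Y m)"
      using energy_commute[OF q, of "Y n" "Y m"] by (simp add: energy_lin[OF q])
    also have "\<dots> \<le> 2 * (l + 1 / Suc n) + 2 * (l + 1 / Suc m) - l * (4 - (norm (fst (Y n) - fst (Y m)))\<^sup>2)"
      using Y(3)[of n] Y(3)[of m] lU[of "Y n + Y m"] Y(1) G(1) par by (simp add: subspace_add)
    finally show ?thesis by (simp add: norm_prod_sq algebra_simps)
  qed
  have "Cauchy Y"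
  proof (rule metric_CauchyI)
    fix e :: real assume e: "0 < e"
    have "Cauchy (\<lambda>n. fst (Y n))" using conv by (simp add: Y_def convergent_Cauchy)
    \<comment> \<open>With this choice the first term of \<open>est\<close> is at most a quarter of
      \<open>e\<^sup>2\<close>; \<open>N2\<close> makes each of the two excess terms smaller than
      another quarter.\<close>
    moreover define e' where "e' = e / (2 * (1 + l))"
    have e': "e' > 0" using e l0 by (simp add: e'_def)
    ultimately obtain N1 where N1: "\<And>m n. m \<ge> N1 \<Longrightarrow> n \<ge> N1 \<Longrightarrow> norm (fst (Y m) - fst (Y n)) < e'"
      unfolding Cauchy_def dist_norm by meson
    obtain N2 :: nat where N2: "8 / e\<^sup>2 < real N2" using reals_Archimedean2 by blast
    have small: "2 / real (Suc n) < e\<^sup>2 / 4" if "n \<ge> N2" for n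
    proof -
      have "8 / e\<^sup>2 < real (Suc n)" using N2 that by simp
      then show ?thesis using e by (simp add: field_simps)
    qed
    show "\<exists>M. \<forall>m\<ge>M. \<forall>n\<ge>M. dist (Y m) (Y n) < e"
    proof (intro exI allI impI)
      fix m n assume mn: "m \<ge> max N1 N2" "n \<ge> max N1 N2"
      have "(norm (fst (Y m) - fst (Y n)))\<^sup>2 \<le> e'\<^sup>2" using N1[of m n] mn by (intro power_mono) auto
      then have "(1 + l) * (norm (fst (Y m) - fst (Y n)))\<^sup>2 \<le> (1 + l) * e'\<^sup>2" using l0 by (intro mult_left_mono) auto
      also have "\<dots> = e\<^sup>2 / (4 * (1 + l))"
      proof -
        have "k * (e / (2 * k))\<^sup>2 = e\<^sup>2 / (4 * k)" if "k > 0" for k :: real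
          using that by (simp add: power2_eq_square)
        from this[of "1 + l"] show ?thesis using l0 by (simp add: e'_def)
      qed
      also have "\<dots> \<le> e\<^sup>2 / 4" using l0 by (intro divide_left_mono) auto
      finally have "(norm (Y m - Y n))\<^sup>2 < e\<^sup>2"
        using est[of m n] small[of m] small[of n] mn zero_less_power[OF e, of 2] by linarith
      then show "dist (Y m) (Y n) < e" using e by (simp add: dist_norm power_less_imp_less_base)
    qed
  qed
  then obtain E where E: "Y \<longlonglongrightarrow> E" using Cauchy_convergent convergent_def by blast
  have "E \<in> G" using closed_sequentially[OF G(2)] E Y(1) by blast
  moreover have "(\<lambda>n. norm (fst (Y n))) \<longlonglongrightarrow> norm (fst E)" by (intro tendsto_intros E)
  then have "norm (fst E) = 1" using Y(2) by (simp add: LIMSEQ_const_iff)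
  moreover have "energy q E E \<le> l"
  proof (rule LIMSEQ_le)
    show "(\<lambda>n. energy q (Y n) (Y n)) \<longlonglongrightarrow> energy q E E" by (rule tendsto_energy[OF q E E])
    show "(\<lambda>n. l + 1 / Suc n) \<longlonglongrightarrow> l"
      using tendsto_add[OF tendsto_const LIMSEQ_Suc[OF lim_1_over_n], of l] by simp
  qed (use Y(3) less_imp_le in blast)
  then have "energy q E E * (norm (fst U))\<^sup>2 \<le> energy q U U" if "U \<in> G" for U
    using lU[OF that] mult_right_mono[of "energy q E E" l "(norm (fst U))\<^sup>2"] by simp
  ultimately show ?thesis using that by blast
qed

text \<open>Along the line \<open>E + t *\<^sub>R W\<close> the energy minus
  \<open>energy q E E\<close> times the squared norm of the first component is the nonnegative
  quadratic \<open>2 * t * b + t\<^sup>2 * c\<close>, which forces the linear coefficient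
  \<open>b\<close> to vanish.\<close>

lemma rayleigh_minimizer_euler_lagrange:
  assumes q: "potential M q" and G: "subspace G" and E: "E \<in> G" "norm (fst E) = 1"
    and min: "\<And>U. U \<in> G \<Longrightarrow> energy q E E * (norm (fst U))\<^sup>2 \<le> energy q U U" and W: "W \<in> G"
  shows "energy q E W = energy q E E * inner (fst E) (fst W)"
proof -
  define l where "l = energy q E E"
  define b where "b = energy q E W - l * inner (fst E) (fst W)"
  define c where "c = energy q W W - l * (norm (fst W))\<^sup>2"
  have c: "0 \<le> c" using min[OF W] by (simp add: c_def l_def)
  have E1: "inner (fst E) (fst E) = 1" using E(2) by (simp flip: power2_norm_eq_inner)
  have quad: "0 \<le> 2 * t * b + t\<^sup>2 * c" for t
  proof -
    have "l * (norm (fst (E + t *\<^sub>R W)))\<^sup>2 \<le> energy q (E + t *\<^sub>R W) (E + t *\<^sub>R W)"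
      unfolding l_def by (intro min subspace_add subspace_scale G E W)
    moreover have "energy q (E + t *\<^sub>R W) (E + t *\<^sub>R W) = l + 2 * t * energy q E W + t\<^sup>2 * energy q W W"
      using energy_commute[OF q, of E W] by (simp add: energy_lin[OF q] l_def power2_eq_square algebra_simps)
    moreover have "(norm (fst (E + t *\<^sub>R W)))\<^sup>2 = 1 + 2 * t * inner (fst E) (fst W) + t\<^sup>2 * (norm (fst W))\<^sup>2"
      unfolding power2_norm_eq_inner
      using E1 by (simp add: inner_simps inner_commute power2_eq_square algebra_simps)
    ultimately show ?thesis by (simp add: b_def c_def algebra_simps)
  qed
  have "b = 0"
  proof (rule ccontr)
    assume b: "b \<noteq> 0"
    \<comment> \<open>The vertex \<open>- b / c\<close> is avoided because \<open>c\<close> may be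
      0; the shifted denominator still gives a negative value.\<close>
    have "2 * (- b / (c + 1)) * b + (- b / (c + 1))\<^sup>2 * c = - (b\<^sup>2 * (c + 2)) / (c + 1)\<^sup>2"
      using c by (simp add: power2_eq_square divide_simps) (simp add: algebra_simps)
    also have "\<dots> < 0" using b c by (simp add: divide_neg_pos)
    finally show False using quad[of "- b / (c + 1)"] by linarith
  qed
  then show ?thesis by (simp add: b_def l_def)
qed

text \<open>A linear functional on a plane has a nonzero kernel vector. This supplies competitors
  orthogonal to the first eigenvector, both for the existence of the second one and for the min-max
  bound.\<close>

lemma orthogonal_combination:
  fixes x y e :: 'a
  assumes "\<And>a b. a *\<^sub>R x + b *\<^sub>R y = 0 \<Longrightarrow> a = 0 \<and> b = 0"
  obtains a b where "a *\<^sub>R x + b *\<^sub>R y \<noteq> 0" "inner e (a *\<^sub>R x + b *\<^sub>R y) = 0"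
proof (cases "inner e x = 0")
  case True
  with that[of 1 0] assms[of 1 0] show ?thesis by auto
next
  case False
  with that[of "- inner e y" "inner e x"] assms[of "- inner e y" "inner e x"] show ?thesis
    by (auto simp: inner_simps)
qed

text \<open>The second minimisation runs over the part \<open>G\<close> of \<open>H\<close>
  orthogonal to the first minimiser. \<open>U\<close> and \<open>W\<close> only guarantee that
  \<open>G\<close> contains an element with nonzero first component.\<close>

lemma eigensystem_exists:
  assumes q: "potential M q" and UW: "U \<in> H" "W \<in> H"
    and indep: "\<And>a b. a *\<^sub>R fst U + b *\<^sub>R fst W = 0 \<Longrightarrow> a = 0 \<and> b = 0"
  obtains E1 l1 E2 l2 where "eigensystem H q E1 l1 E2 l2"
proof -
  have "fst U \<noteq> 0" using indep[of 1 0] by auto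
  then obtain E1 where E1: "E1 \<in> H" "norm (fst E1) = 1"
    "\<And>U. U \<in> H \<Longrightarrow> energy q E1 E1 * (norm (fst U))\<^sup>2 \<le> energy q U U"
    using rayleigh_minimizer_exists[OF q subspace_H closed_H subset_refl UW(1)] by blast
  note EL1 = rayleigh_minimizer_euler_lagrange[OF q subspace_H E1(1,2)]
  define G where "G = H \<inter> {U. inner (fst E1) (fst U) = 0}"
  have "subspace {U :: 'a \<times> 'b. inner (fst E1) (fst U) = 0}"
    by (auto simp: subspace_def inner_simps)
  then have Gs: "subspace G" unfolding G_def using subspace_H by (rule subspace_inter[rotated])
  have "closed {U :: 'a \<times> 'b. inner (fst E1) (fst U) = 0}"
    by (intro closed_Collect_eq continuous_intros)
  then have Gc: "closed G" unfolding G_def using closed_H by auto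
  obtain a b where ab: "a *\<^sub>R fst U + b *\<^sub>R fst W \<noteq> 0" "inner (fst E1) (a *\<^sub>R fst U + b *\<^sub>R fst W) = 0"
    using orthogonal_combination[OF indep] by metis
  have "a *\<^sub>R U + b *\<^sub>R W \<in> G" "fst (a *\<^sub>R U + b *\<^sub>R W) \<noteq> 0"
    using ab UW subspace_H by (auto simp: G_def subspace_add subspace_scale)
  then obtain E2 where E2: "E2 \<in> G" "norm (fst E2) = 1"
    "\<And>U. U \<in> G \<Longrightarrow> energy q E2 E2 * (norm (fst U))\<^sup>2 \<le> energy q U U"
    using rayleigh_minimizer_exists[OF q Gs Gc] by (metis G_def inf_le1)
  note EL2 = rayleigh_minimizer_euler_lagrange[OF q Gs E2(1,2)]
  have orth: "inner (fst E1) (fst E2) = 0" "E2 \<in> H" using E2(1) by (auto simp: G_def)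
  \<comment> \<open>Minimality in \<open>G\<close> tests \<open>E2\<close> only against elements
    orthogonal to \<open>E1\<close>. A general \<open>W\<close> differs from such an element by a
    multiple of \<open>E1\<close>, and that contributes nothing since \<open>E1\<close> solves its
    own equation and is orthogonal to \<open>E2\<close>.\<close>
  have EL2': "energy q E2 W = energy q E2 E2 * inner (fst E2) (fst W)" if W: "W \<in> H" for W
  proof -
    define c where "c = inner (fst E1) (fst W)"
    have "inner (fst E1) (fst E1) = 1" using E1(2) by (simp flip: power2_norm_eq_inner)
    then have "W - c *\<^sub>R E1 \<in> G"
      using W E1(1) subspace_H by (auto simp: G_def subspace_diff subspace_scale inner_simps c_def)
    from EL2[OF E2(3) this] have "energy q E2 W - c * energy q E2 E1
        = energy q E2 E2 * (inner (fst E2) (fst W) - c * inner (fst E2) (fst E1))"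
      by (simp add: energy_lin[OF q] inner_simps)
    moreover have "energy q E2 E1 = 0" using EL1[OF E1(3) orth(2)] orth energy_commute[OF q, of E1 E2] by simp
    ultimately show ?thesis using orth(1) by (simp add: inner_commute)
  qed
  have "eigensystem H q E1 (energy q E1 E1) E2 (energy q E2 E2)"
    unfolding eigensystem_def
    by (intro conjI ballI impI E1 E2(2) orth EL1[OF E1(3)] EL2' E2(3)) (auto simp: G_def)
  then show ?thesis using that by blast
qed

end

text \<open>On the plane spanned by \<open>E1\<close> and \<open>E2\<close> energy and norm are
  simultaneously diagonal, so the plane can serve as a trial space for another potential.\<close>

lemma eigensystem_span:
  assumes q: "potential M q" and es: "eigensystem H q E1 l1 E2 l2" and H: "subspace H"
  shows "a *\<^sub>R E1 + b *\<^sub>R E2 \<in> H"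
    and "energy q (a *\<^sub>R E1 + b *\<^sub>R E2) (a *\<^sub>R E1 + b *\<^sub>R E2) = l1 * a\<^sup>2 + l2 * b\<^sup>2"
    and "(norm (fst (a *\<^sub>R E1 + b *\<^sub>R E2)))\<^sup>2 = a\<^sup>2 + b\<^sup>2"
    and "a *\<^sub>R fst E1 + b *\<^sub>R fst E2 = 0 \<Longrightarrow> a = 0 \<and> b = 0"
    and "l1 \<le> l2"
proof -
  have E: "E1 \<in> H" "E2 \<in> H" "inner (fst E1) (fst E1) = 1" "inner (fst E2) (fst E2) = 1"
    "inner (fst E1) (fst E2) = 0"
    using es by (auto simp: eigensystem_def simp flip: power2_norm_eq_inner)
  show "a *\<^sub>R E1 + b *\<^sub>R E2 \<in> H" using H E by (intro subspace_add subspace_scale)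
  have en: "energy q E1 E1 = l1" "energy q E2 E2 = l2" "energy q E1 E2 = 0" "energy q E2 E1 = 0"
    using es E by (auto simp: eigensystem_def inner_commute)
  then show "energy q (a *\<^sub>R E1 + b *\<^sub>R E2) (a *\<^sub>R E1 + b *\<^sub>R E2) = l1 * a\<^sup>2 + l2 * b\<^sup>2"
    by (simp add: energy_lin[OF q] power2_eq_square algebra_simps)
  show nrm: "(norm (fst (a *\<^sub>R E1 + b *\<^sub>R E2)))\<^sup>2 = a\<^sup>2 + b\<^sup>2" for a b
    unfolding power2_norm_eq_inner
    using E by (simp add: inner_simps inner_commute power2_eq_square)
  show "a *\<^sub>R fst E1 + b *\<^sub>R fst E2 = 0 \<Longrightarrow> a = 0 \<and> b = 0"
    using nrm[of a b] by (simp add: sum_power2_eq_zero_iff)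
  have "l1 * (norm (fst E2))\<^sup>2 \<le> energy q E2 E2" using es by (auto simp: eigensystem_def)
  then show "l1 \<le> l2" using E en by (simp add: power2_norm_eq_inner)
qed

section \<open>Min-max comparison and continuity of the two eigenvalues\<close>

context compact_form_domain
begin

text \<open>The upper half of the min-max principle: every plane contains a nonzero vector
  orthogonal to \<open>E1\<close>, where the Rayleigh quotient is at least
  \<open>l2\<close>.\<close>

lemma second_eigenvalue_le:
  assumes es: "eigensystem H q E1 l1 E2 l2" and UW: "U \<in> H" "W \<in> H"
    and indep: "\<And>a b. a *\<^sub>R fst U + b *\<^sub>R fst W = 0 \<Longrightarrow> a = 0 \<and> b = 0"
    and le: "\<And>a b. energy q (a *\<^sub>R U + b *\<^sub>R W) (a *\<^sub>R U + b *\<^sub>R W)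
      \<le> \<mu> * (norm (fst (a *\<^sub>R U + b *\<^sub>R W)))\<^sup>2"
  shows "l2 \<le> \<mu>"
proof -
  obtain a b where ab: "a *\<^sub>R fst U + b *\<^sub>R fst W \<noteq> 0" "inner (fst E1) (a *\<^sub>R fst U + b *\<^sub>R fst W) = 0"
    using orthogonal_combination[OF indep] by metis
  let ?w = "a *\<^sub>R U + b *\<^sub>R W"
  have "?w \<in> H" using UW subspace_H by (intro subspace_add subspace_scale)
  then have "l2 * (norm (fst ?w))\<^sup>2 \<le> energy q ?w ?w" using es ab by (auto simp: eigensystem_def)
  then have "l2 * (norm (fst ?w))\<^sup>2 \<le> \<mu> * (norm (fst ?w))\<^sup>2" using le[of a b] by linarith
  moreover have "0 < (norm (fst ?w))\<^sup>2" using ab by simp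
  ultimately show ?thesis by (simp add: mult_le_cancel_right)
qed

text \<open>The eigenvectors of \<open>q'\<close> serve as trial vectors for \<open>q\<close>. Their
  energy quotient is at most \<open>l2'\<close>, hence at most \<open>\<Lambda>\<close>, which is
  why closeness of the two forms is required only at that energy level.\<close>

lemma eigenvalues_perturbation_le:
  assumes q: "potential M q" and q': "potential M q'"
    and es: "eigensystem H q E1 l1 E2 l2" and es': "eigensystem H q' E1' l1' E2' l2'" and "l2' \<le> \<Lambda>"
    and close: "\<And>U. U \<in> H \<Longrightarrow> (norm (snd U))\<^sup>2 \<le> \<Lambda> * (norm (fst U))\<^sup>2 \<Longrightarrow>
        q (fst U) (fst U) \<le> q' (fst U) (fst U) + \<delta> * (norm (fst U))\<^sup>2"
  shows "l1 \<le> l1' + \<delta>" "l2 \<le> l2' + \<delta>"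
proof -
  note sp = eigensystem_span[OF q' es' subspace_H]
  have le: "energy q U U \<le> (\<mu> + \<delta>) * (norm (fst U))\<^sup>2"
    if "U \<in> H" "energy q' U U \<le> \<mu> * (norm (fst U))\<^sup>2" "\<mu> \<le> \<Lambda>" for U \<mu>
  proof -
    have "(norm (snd U))\<^sup>2 \<le> \<Lambda> * (norm (fst U))\<^sup>2"
      using energy_ge_snd[OF q', of U] that mult_right_mono[of \<mu> \<Lambda> "(norm (fst U))\<^sup>2"] by simp
    from close[OF that(1) this] show ?thesis using that(2) by (simp add: energy_def algebra_simps)
  qed
  show "l1 \<le> l1' + \<delta>"
  proof -
    have E1': "E1' \<in> H" "norm (fst E1') = 1" using es' by (simp_all add: eigensystem_def)
    moreover have "energy q' E1' E1' = l1'" using sp(2)[of 1 0] by simp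
    moreover have "l1 * (norm (fst E1'))\<^sup>2 \<le> energy q E1' E1'"
      using es E1'(1) unfolding eigensystem_def by blast
    moreover have "l1' \<le> \<Lambda>" using sp(5) \<open>l2' \<le> \<Lambda>\<close> by simp
    ultimately show ?thesis using le[of E1' l1'] by simp
  qed
  show "l2 \<le> l2' + \<delta>"
  proof (rule second_eigenvalue_le[OF es])
    show "E1' \<in> H" "E2' \<in> H" using es' by (auto simp: eigensystem_def)
    fix a b
    show "energy q (a *\<^sub>R E1' + b *\<^sub>R E2') (a *\<^sub>R E1' + b *\<^sub>R E2')
      \<le> (l2' + \<delta>) * (norm (fst (a *\<^sub>R E1' + b *\<^sub>R E2')))\<^sup>2"
    proof (rule le[OF sp(1) _ \<open>l2' \<le> \<Lambda>\<close>])
      show "energy q' (a *\<^sub>R E1' + b *\<^sub>R E2') (a *\<^sub>R E1' + b *\<^sub>R E2')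
        \<le> l2' * (norm (fst (a *\<^sub>R E1' + b *\<^sub>R E2')))\<^sup>2"
        unfolding sp(2) sp(3) using mult_right_mono[OF sp(5), of "a\<^sup>2"] by (simp add: distrib_left)
    qed
  qed (use sp(4) in blast)
qed

text \<open>On functions of bounded energy, convergence of the matrix elements between members of
  \<open>\<W>\<close> is already uniform.\<close>

lemma potentials_converge_uniformly:
  assumes q: "potential M q" and qn: "\<And>n. potential M (qn n)"
    and lim: "\<And>w w'. w \<in> \<W> \<Longrightarrow> w' \<in> \<W> \<Longrightarrow> (\<lambda>n. qn n w w') \<longlonglongrightarrow> q w w'" and \<delta>: "0 < \<delta>"
  shows "\<forall>\<^sub>F n in sequentially. \<forall>U\<in>H. (norm (snd U))\<^sup>2 \<le> \<Lambda> * (norm (fst U))\<^sup>2 \<longrightarrow>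
      \<bar>qn n (fst U) (fst U) - q (fst U) (fst U)\<bar> \<le> \<delta> * (norm (fst U))\<^sup>2"
proof -
  define k where "k = sqrt (1 + \<bar>\<Lambda>\<bar>)"
  \<comment> \<open>\<open>k\<close> converts \<open>norm U\<close> into
    \<open>norm (fst U)\<close>. The minimum with 1 keeps \<open>norm (P u)\<close> below
    \<open>2 * norm u\<close>; then replacing \<open>u\<close> by \<open>P u\<close> costs at most
    \<open>3 * \<bar>M\<bar> * \<epsilon> * k\<close> times the squared norm, that is a quarter of
    \<open>\<delta>\<close> for each of the two forms. The remaining half is left to
    \<open>s n\<close>.\<close>
  define \<epsilon> where "\<epsilon> = min 1 (\<delta> / (12 * (\<bar>M\<bar> + 1))) / k"
  have k: "k > 0" by (simp add: k_def)
  have \<epsilon>: "\<epsilon> > 0" using \<delta> k by (simp add: \<epsilon>_def)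
  have \<epsilon>k: "\<epsilon> * k \<le> 1" "\<epsilon> * k \<le> \<delta> / (12 * (\<bar>M\<bar> + 1))" using k by (auto simp: \<epsilon>_def)
  obtain W where W: "W \<subseteq> \<W>" "finite W"
      "\<And>U. U \<in> H \<Longrightarrow> norm (fst U - (\<Sum>w\<in>W. inner (fst U) w *\<^sub>R w)) \<le> \<epsilon> * norm U"
    using finite_rank_approx[OF \<epsilon>] by blast
  define P where "P u = (\<Sum>w\<in>W. inner u w *\<^sub>R w)" for u
  define s where "s n = (\<Sum>w\<in>W. \<Sum>w'\<in>W. norm w * norm w' * \<bar>qn n w w' - q w w'\<bar>)" for n
  have "s \<longlonglongrightarrow> (\<Sum>w\<in>W. \<Sum>w'\<in>W. norm w * norm w' * \<bar>q w w' - q w w'\<bar>)"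
    unfolding s_def using W(1) by (intro tendsto_intros lim) auto
  then have "s \<longlonglongrightarrow> 0" by simp
  then have "\<forall>\<^sub>F n in sequentially. s n < \<delta> / 2" using \<delta> by (intro order_tendstoD(2)) auto
  then show ?thesis
  proof eventually_elim
    case (elim n)
    show ?case
    proof (intro ballI impI)
      fix U assume U: "U \<in> H" and le: "(norm (snd U))\<^sup>2 \<le> \<Lambda> * (norm (fst U))\<^sup>2"
      define u where "u = fst U"
      have "\<Lambda> * (norm u)\<^sup>2 \<le> \<bar>\<Lambda>\<bar> * (norm u)\<^sup>2" by (intro mult_right_mono) auto
      then have "(norm U)\<^sup>2 \<le> (k * norm u)\<^sup>2"
        using le by (simp add: norm_prod_sq k_def power_mult_distrib u_def algebra_simps)
      then have "norm U \<le> k * norm u" by (rule power2_le_imp_le) (use k in auto)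
      then have "\<epsilon> * norm U \<le> \<epsilon> * (k * norm u)" using \<epsilon> by (intro mult_left_mono) auto
      then have uP: "norm (u - P u) \<le> \<epsilon> * k * norm u"
        using W(3)[OF U] by (simp add: u_def P_def mult.assoc)
      have "\<epsilon> * k * norm u \<le> norm u" using \<epsilon>k(1) by (simp add: mult_left_le_one_le \<epsilon> k less_imp_le)
      then have Pu: "norm (P u) \<le> 2 * norm u"
        using uP norm_triangle_ineq4[of u "u - P u"] by simp
      have near: "\<bar>f u u - f (P u) (P u)\<bar> \<le> \<delta> / 4 * (norm u)\<^sup>2" if f: "potential M f" for f
      proof -
        interpret f: bounded_bilinear f using f by (simp add: potential_def)
        have M: "\<bar>f x y\<bar> \<le> \<bar>M\<bar> * (norm x * norm y)" for x y
        proof -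
          have "\<bar>f x y\<bar> \<le> M * (norm x * norm y)" using f unfolding potential_def by blast
          also have "\<dots> \<le> \<bar>M\<bar> * (norm x * norm y)" by (intro mult_right_mono) auto
          finally show ?thesis .
        qed
        have "f u u - f (P u) (P u) = f (u - P u) u + f (P u) (u - P u)"
          by (simp add: f.diff_left f.diff_right)
        then have "\<bar>f u u - f (P u) (P u)\<bar> \<le> \<bar>M\<bar> * (norm (u - P u) * norm u) + \<bar>M\<bar> * (norm (P u) * norm (u - P u))"
          using M[of "u - P u" u] M[of "P u" "u - P u"] by linarith
        also have "\<dots> \<le> \<bar>M\<bar> * (\<epsilon> * k * norm u * norm u) + \<bar>M\<bar> * (2 * norm u * (\<epsilon> * k * norm u))"
          using uP Pu \<epsilon> k by (intro add_mono mult_left_mono mult_mono) auto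
        also have "\<dots> = 3 * \<bar>M\<bar> * (\<epsilon> * k) * (norm u)\<^sup>2" by (simp add: power2_eq_square)
        also have "\<dots> \<le> \<delta> / 4 * (norm u)\<^sup>2"
        proof (rule mult_right_mono)
          have "3 * \<bar>M\<bar> * (\<epsilon> * k) \<le> 3 * (\<bar>M\<bar> + 1) * (\<delta> / (12 * (\<bar>M\<bar> + 1)))"
            using \<epsilon>k(2) \<epsilon> k by (intro mult_mono) auto
          also have "\<dots> = \<delta> / 4"
          proof -
            have "\<bar>M\<bar> + 1 \<noteq> 0" by linarith
            then show ?thesis by (simp add: divide_simps)
          qed
          finally show "3 * \<bar>M\<bar> * (\<epsilon> * k) \<le> \<delta> / 4" .
        qed simp
        finally show ?thesis .
      qed
      have expand: "f (P u) (P u) = (\<Sum>w\<in>W. \<Sum>w'\<in>W. inner u w * inner u w' * f w w')"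
        if "potential M f" for f
      proof -
        interpret f: bounded_bilinear f using that by (simp add: potential_def)
        show ?thesis unfolding P_def
          by (simp add: f.sum_left f.sum_right f.scaleR_left f.scaleR_right sum_distrib_left mult.assoc)
             (subst sum.swap, rule sum.cong, simp, rule sum.cong, auto)
      qed
      have "\<bar>qn n (P u) (P u) - q (P u) (P u)\<bar>
        = \<bar>\<Sum>w\<in>W. \<Sum>w'\<in>W. inner u w * inner u w' * (qn n w w' - q w w')\<bar>"
        by (simp add: expand[OF q] expand[OF qn] sum_subtractf right_diff_distrib)
      also have "\<dots> \<le> (\<Sum>w\<in>W. \<Sum>w'\<in>W. \<bar>inner u w * inner u w' * (qn n w w' - q w w')\<bar>)"
        by (rule order_trans[OF sum_abs]) (intro sum_mono sum_abs)
      also have "\<dots> \<le> (\<Sum>w\<in>W. \<Sum>w'\<in>W. (norm u * norm w) * (norm u * norm w') * \<bar>qn n w w' - q w w'\<bar>)"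
        unfolding abs_mult by (intro sum_mono mult_mono Cauchy_Schwarz_ineq2) auto
      also have "\<dots> = (norm u)\<^sup>2 * s n"
        by (simp add: s_def sum_distrib_left power2_eq_square mult_ac)
      also have "\<dots> \<le> (norm u)\<^sup>2 * (\<delta> / 2)" using elim by (intro mult_left_mono) auto
      finally show "\<bar>qn n (fst U) (fst U) - q (fst U) (fst U)\<bar> \<le> \<delta> * (norm (fst U))\<^sup>2"
        using near[OF q] near[OF qn[of n]] unfolding u_def[symmetric] abs_le_iff by (simp add: algebra_simps)
    qed
  qed
qed

text \<open>Two rounds of perturbation. The crude difference \<open>2 * M\<close> between any two
  potentials bounds all \<open>l2n\<close> and so fixes an energy level \<open>\<Lambda>\<close>
  independent of \<open>n\<close>; at this level the forms converge uniformly, and the comparison is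
  applied in both directions.\<close>

lemma eigenvalues_converge:
  assumes q: "potential M q" and qn: "\<And>n. potential M (qn n)"
    and lim: "\<And>w w'. w \<in> \<W> \<Longrightarrow> w' \<in> \<W> \<Longrightarrow> (\<lambda>n. qn n w w') \<longlonglongrightarrow> q w w'"
    and es: "eigensystem H q E1 l1 E2 l2"
    and esn: "\<And>n. eigensystem H (qn n) (E1n n) (l1n n) (E2n n) (l2n n)"
  shows "l1n \<longlonglongrightarrow> l1" "l2n \<longlonglongrightarrow> l2"
proof -
  have diff_le: "f u u \<le> g u u + 2 * M * (norm u)\<^sup>2" if "potential M f" "potential M g" for f g and u :: 'a
  proof -
    have "\<bar>f u u\<bar> \<le> M * (norm u * norm u)" "\<bar>g u u\<bar> \<le> M * (norm u * norm u)"
      using that unfolding potential_def by blast+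
    then show ?thesis by (simp add: power2_eq_square abs_le_iff)
  qed
  define \<Lambda> where "\<Lambda> = max l2 (l2 + 2 * M)"
  have l2n: "l2n n \<le> \<Lambda>" for n
    using eigenvalues_perturbation_le(2)[OF qn q esn es order_refl diff_le[OF qn q]] by (auto simp: \<Lambda>_def le_max_iff_disj)
  have l2: "l2 \<le> \<Lambda>" by (simp add: \<Lambda>_def)
  have ev: "\<forall>\<^sub>F n in sequentially. \<bar>l1n n - l1\<bar> \<le> \<delta> \<and> \<bar>l2n n - l2\<bar> \<le> \<delta>" if "0 < \<delta>" for \<delta>
  proof -
    have "\<forall>\<^sub>F n in sequentially. \<forall>U\<in>H. (norm (snd U))\<^sup>2 \<le> \<Lambda> * (norm (fst U))\<^sup>2 \<longrightarrow>
      \<bar>qn n (fst U) (fst U) - q (fst U) (fst U)\<bar> \<le> \<delta> * (norm (fst U))\<^sup>2"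
      by (rule potentials_converge_uniformly[OF q qn lim that])
    then show ?thesis
    proof eventually_elim
      case (elim n)
      have 1: "qn n (fst U) (fst U) \<le> q (fst U) (fst U) + \<delta> * (norm (fst U))\<^sup>2"
        and 2: "q (fst U) (fst U) \<le> qn n (fst U) (fst U) + \<delta> * (norm (fst U))\<^sup>2"
        if "U \<in> H" "(norm (snd U))\<^sup>2 \<le> \<Lambda> * (norm (fst U))\<^sup>2" for U
        using elim that by (auto simp: abs_le_iff algebra_simps)
      show ?case
        using eigenvalues_perturbation_le[OF qn q esn es l2 1] eigenvalues_perturbation_le[OF q qn es esn l2n 2]
        by (auto simp: abs_le_iff algebra_simps)
    qed
  qed
  have "\<forall>\<^sub>F n in sequentially. \<bar>l1n n - l1\<bar> < e \<and> \<bar>l2n n - l2\<bar> < e" if "0 < e" for e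
    using ev[of "e/2"] that by (auto elim!: eventually_mono)
  then show "l1n \<longlonglongrightarrow> l1" "l2n \<longlonglongrightarrow> l2"
    by (auto simp: tendsto_iff dist_real_def eventually_conj_iff)
qed

end

subsection \<open>The Hilbert space of square integrable functions on the unit square\<close>

lemma L2_measurable: "L2 f \<Longrightarrow> f \<in> borel_measurable LOm" by (simp add: L2_def)

lemma L2_integrable_mult:
  assumes "L2 f" "L2 g" shows "integrable LOm (\<lambda>x. f x * g x)"
proof (rule Bochner_Integration.integrable_bound)
  show "integrable LOm (\<lambda>x. (f x)\<^sup>2 + (g x)\<^sup>2)" using assms by (auto simp: L2_def)
  show "(\<lambda>x. f x * g x) \<in> borel_measurable LOm" using assms by (auto simp: L2_def)
  have "\<bar>a * b\<bar> \<le> a\<^sup>2 + b\<^sup>2" for a b :: real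
    using sum_squares_bound[of "\<bar>a\<bar>" "\<bar>b\<bar>"] abs_ge_zero[of "a * b"]
    unfolding abs_mult power2_abs by linarith
  then show "AE x in LOm. norm (f x * g x) \<le> norm ((f x)\<^sup>2 + (g x)\<^sup>2)" by simp
qed

lemma L2_add: "L2 f \<Longrightarrow> L2 g \<Longrightarrow> L2 (\<lambda>x. f x + g x)"
  using L2_integrable_mult[of f g] by (auto simp: L2_def power2_sum mult.assoc)

lemma L2_scale: "L2 f \<Longrightarrow> L2 (\<lambda>x. c * f x)"
  by (auto simp: L2_def power_mult_distrib)

lemma L2_minus: "L2 f \<Longrightarrow> L2 (\<lambda>x. - f x)"
  by (auto simp: L2_def)

lemma L2_diff: "L2 f \<Longrightarrow> L2 g \<Longrightarrow> L2 (\<lambda>x. f x - g x)"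
  using L2_add[of f "\<lambda>x. - g x"] L2_minus[of g] by simp

lemma L2_zero: "L2 (\<lambda>x. 0)"
  by (simp add: L2_def)

\<comment> \<open>The abstract theory lives on types of class \<open>complete_space\<close>, so
  functions equal almost everywhere are identified. The relation is partial because functions that
  are not square integrable belong to no class.\<close>
quotient_type l2 = "R2 \<Rightarrow> real" / partial: "\<lambda>f g. L2 f \<and> L2 g \<and> (AE x in LOm. f x = g x)"
proof (rule part_equivpI)
  show "\<exists>f. L2 f \<and> L2 f \<and> (AE x in LOm. f x = f x)" using L2_zero by auto
qed (auto intro!: sympI transpI elim: AE_mp)

lemma L2_AE_mult_cong:
  assumes "AE x in M. f x = f' x" "AE x in M. g x = g' x"
  shows "AE x in M. f x * g x = f' x * g' x"
  using assms by eventually_elim simp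

instantiation l2 :: real_vector
begin

lift_definition zero_l2 :: l2 is "\<lambda>x. 0" by (auto simp: L2_zero)
lift_definition plus_l2 :: "l2 \<Rightarrow> l2 \<Rightarrow> l2" is "\<lambda>f g x. f x + g x"
  by (auto simp: L2_add elim: AE_mp)
lift_definition minus_l2 :: "l2 \<Rightarrow> l2 \<Rightarrow> l2" is "\<lambda>f g x. f x - g x"
  by (auto simp: L2_diff elim: AE_mp)
lift_definition uminus_l2 :: "l2 \<Rightarrow> l2" is "\<lambda>f x. - f x"
  by (auto simp: L2_minus elim: AE_mp)
lift_definition scaleR_l2 :: "real \<Rightarrow> l2 \<Rightarrow> l2" is "\<lambda>c f x. c * f x"
  by (auto simp: L2_scale elim: AE_mp)

instance
proof
  fix a b c :: l2 and r s :: real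
  show "a + b + c = a + (b + c)" by transfer (auto simp: add.assoc L2_add)
  show "a + b = b + a" by transfer (auto simp: add.commute L2_add)
  show "0 + a = a" by transfer auto
  show "- a + a = 0" by transfer (auto simp: L2_zero L2_add L2_minus)
  show "a - b = a + - b" by transfer (auto simp: L2_add L2_minus L2_diff)
  show "r *\<^sub>R (a + b) = r *\<^sub>R a + r *\<^sub>R b" by transfer (auto simp: L2_add L2_scale distrib_left)
  show "(r + s) *\<^sub>R a = r *\<^sub>R a + s *\<^sub>R a" by transfer (auto simp: L2_add L2_scale distrib_right)
  show "r *\<^sub>R s *\<^sub>R a = (r * s) *\<^sub>R a" by transfer (auto simp: L2_scale mult.assoc)
  show "1 *\<^sub>R a = a" by transfer auto
qed

end

instantiation l2 :: real_inner
begin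

lift_definition inner_l2 :: "l2 \<Rightarrow> l2 \<Rightarrow> real" is "\<lambda>f g. \<integral>x. f x * g x \<partial>LOm"
  by (intro integral_cong_AE L2_AE_mult_cong borel_measurable_times) (auto intro: L2_measurable)
definition "norm_l2 x = sqrt (inner x x)" for x :: l2
definition "dist_l2 x y = norm (x - y)" for x y :: l2
definition "sgn_l2 x = x /\<^sub>R norm x" for x :: l2
definition uniformity_l2 :: "(l2 \<times> l2) filter" where
  "uniformity_l2 = (INF e\<in>{0 <..}. principal {(x, y). dist x y < e})"
definition open_l2 :: "l2 set \<Rightarrow> bool" where
  "open_l2 U = (\<forall>x\<in>U. \<forall>\<^sub>F (x', y) in uniformity. x' = x \<longrightarrow> y \<in> U)"

instance
proof
  fix a b c :: l2 and r s :: real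
  show "inner a b = inner b a" by transfer (simp add: mult.commute)
  show "inner (a + b) c = inner a c + inner b c"
    by transfer (auto simp: distrib_right L2_integrable_mult)
  show "inner (r *\<^sub>R a) b = r * inner a b"
    by transfer (auto simp: mult.assoc)
  show "0 \<le> inner a a" by transfer auto
  show "inner a a = 0 \<longleftrightarrow> a = 0"
  proof transfer
    fix f assume f: "L2 f \<and> L2 f \<and> (AE x in LOm. f x = f x)"
    have "(\<integral>x. f x * f x \<partial>LOm) = 0 \<longleftrightarrow> (AE x in LOm. f x * f x = 0)"
      using f by (intro integral_nonneg_eq_0_iff_AE L2_integrable_mult) auto
    then show "((\<integral>x. f x * f x \<partial>LOm) = 0) \<longleftrightarrow>
      (L2 f \<and> L2 (\<lambda>x. 0) \<and> (AE x in LOm. f x = 0))" using f by (simp add: L2_zero)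
  qed
  show "norm a = sqrt (inner a a)" by (rule norm_l2_def)
  show "dist a b = norm (a - b)" by (rule dist_l2_def)
  show "sgn a = a /\<^sub>R norm a" by (rule sgn_l2_def)
  show "uniformity = (INF e\<in>{0 <..}. principal {(x, y :: l2). dist x y < e})" by (rule uniformity_l2_def)
  show "open U = (\<forall>x\<in>U. \<forall>\<^sub>F (x', y) in uniformity. x' = x \<longrightarrow> y \<in> U)" for U :: "l2 set" by (rule open_l2_def)
qed

end

lemma abs_l2_eq_iff: "L2 f \<Longrightarrow> L2 g \<Longrightarrow> abs_l2 f = abs_l2 g \<longleftrightarrow> (AE x in LOm. f x = g x)"
  using Quotient_l2[THEN Quotient_rel_abs] Quotient_l2[THEN Quotient_rel] Quotient_l2
  by (metis (mono_tags, lifting) AE_I2)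

lemma l2_cases: obtains f where "L2 f" "x = abs_l2 f"
proof -
  have "L2 (rep_l2 x)" using Quotient_rep_reflp[OF Quotient_l2, of x] by auto
  then show ?thesis using that Quotient_abs_rep[OF Quotient_l2, of x] by metis
qed

lemma L2_rep: "L2 (rep_l2 x)" and abs_rep_l2: "abs_l2 (rep_l2 x) = x"
  using Quotient_rep_reflp[OF Quotient_l2, of x] Quotient_abs_rep[OF Quotient_l2, of x] by auto

lemma rep_abs_l2: "L2 f \<Longrightarrow> AE x in LOm. rep_l2 (abs_l2 f) x = f x"
  using abs_l2_eq_iff[OF L2_rep, of f "abs_l2 f"] by (simp add: abs_rep_l2)

lemma abs_l2_add: "L2 f \<Longrightarrow> L2 g \<Longrightarrow> abs_l2 f + abs_l2 g = abs_l2 (\<lambda>x. f x + g x)"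
  and abs_l2_diff: "L2 f \<Longrightarrow> L2 g \<Longrightarrow> abs_l2 f - abs_l2 g = abs_l2 (\<lambda>x. f x - g x)"
  and abs_l2_scale: "L2 f \<Longrightarrow> c *\<^sub>R abs_l2 f = abs_l2 (\<lambda>x. c * f x)"
  and abs_l2_inner: "L2 f \<Longrightarrow> L2 g \<Longrightarrow> inner (abs_l2 f) (abs_l2 g) = (\<integral>x. f x * g x \<partial>LOm)"
  by (simp_all add: plus_l2.abs_eq minus_l2.abs_eq scaleR_l2.abs_eq inner_l2.abs_eq)

lemma zero_l2_abs: "0 = abs_l2 (\<lambda>x. 0)" by (simp add: zero_l2_def)

lemma abs_l2_norm_sq: "L2 f \<Longrightarrow> (norm (abs_l2 f))\<^sup>2 = (\<integral>x. (f x)\<^sup>2 \<partial>LOm)"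
  unfolding power2_norm_eq_inner by (simp add: abs_l2_inner power2_eq_square)

lemma abs_l2_dist_sq: "L2 f \<Longrightarrow> L2 g \<Longrightarrow> (dist (abs_l2 f) (abs_l2 g))\<^sup>2 = (\<integral>x. (f x - g x)\<^sup>2 \<partial>LOm)"
  by (simp add: dist_norm abs_l2_diff abs_l2_norm_sq L2_diff)

section \<open>Finite measure of the square and completeness of the space\<close>

lemma Omega_box: "Omega = box (0, 0) (1, 1)"
  by (auto simp: Omega_def box_prod)

lemma Omega_sets: "Omega \<in> sets borel" "Omega \<in> sets lebesgue" "open Omega" "Omega \<in> lmeasurable"
proof -
  show o: "open Omega" by (simp add: Omega_def open_Times)
  then show b: "Omega \<in> sets borel" by simp
  then show "Omega \<in> sets lebesgue" by simp
  have "bounded Omega" by (simp add: Omega_box bounded_box)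
  then show "Omega \<in> lmeasurable" by (rule lmeasurable_open) (rule o)
qed

lemma finite_measure_LOm: "finite_measure LOm"
  using Omega_sets(4) by (rule finite_measure_lebesgue_on)

lemma measure_LOm: "measure LOm (space LOm) = 1"
proof -
  have "measure lebesgue Omega = measure lborel (box (0,0) (1,1) :: R2 set)"
    by (simp add: Omega_box measure_completion)
  also have "\<dots> = 1" by (subst measure_lborel_box_eq) (simp add: Basis_prod_def)
  finally show ?thesis using Omega_sets by (simp add: measure_restrict_space)
qed

lemma L2_integrable: assumes "L2 f" shows "integrable LOm f"
proof -
  interpret finite_measure LOm by (rule finite_measure_LOm)
  have "L2 (\<lambda>x. 1)" by (simp add: L2_def)
  from L2_integrable_mult[OF assms this] show ?thesis by simp
qed

text \<open>Cauchy-Schwarz against the constant 1, whose norm is 1 because the square has unit area.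
  It turns small increments in norm into small integrals of increments.\<close>

lemma L2_integral_abs_le:
  assumes "L2 f" shows "(\<integral>x. \<bar>f x\<bar> \<partial>LOm) \<le> norm (abs_l2 f)"
proof -
  interpret finite_measure LOm by (rule finite_measure_LOm)
  have 1: "L2 (\<lambda>x. 1)" by (simp add: L2_def)
  have a: "L2 (\<lambda>x. \<bar>f x\<bar>)" using assms by (auto simp: L2_def)
  have "(\<integral>x. \<bar>f x\<bar> \<partial>LOm) = inner (abs_l2 (\<lambda>x. \<bar>f x\<bar>)) (abs_l2 (\<lambda>x. 1))"
    using abs_l2_inner[OF a 1] by simp
  also have "\<dots> \<le> norm (abs_l2 (\<lambda>x. \<bar>f x\<bar>)) * norm (abs_l2 (\<lambda>x. 1))"
    using norm_cauchy_schwarz by blast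
  also have "norm (abs_l2 (\<lambda>x. 1)) = 1"
  proof -
    have "(norm (abs_l2 (\<lambda>x. 1)))\<^sup>2 = 1\<^sup>2" using abs_l2_norm_sq[OF 1] measure_LOm by simp
    then show ?thesis by (rule power2_eq_imp_eq) auto
  qed
  also have "norm (abs_l2 (\<lambda>x. \<bar>f x\<bar>)) = norm (abs_l2 f)"
  proof (rule power2_eq_imp_eq)
    show "(norm (abs_l2 (\<lambda>x. \<bar>f x\<bar>)))\<^sup>2 = (norm (abs_l2 f))\<^sup>2"
      using abs_l2_norm_sq[OF a] abs_l2_norm_sq[OF assms] by simp
  qed auto
  finally show ?thesis by simp
qed

text \<open>The sum of the absolute increments has finite integral, hence is finite almost
  everywhere, and there the telescoping series converges absolutely.\<close>

lemma fast_Cauchy_AE_convergent: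
  fixes f :: "nat \<Rightarrow> 'a \<Rightarrow> real"
  assumes int: "\<And>n. integrable M (f n)"
    and fast: "\<And>n. (\<integral>x. \<bar>f (Suc n) x - f n x\<bar> \<partial>M) \<le> (1/2) ^ n"
  shows "AE x in M. convergent (\<lambda>n. f n x)"
proof -
  let ?g = "\<lambda>n x. ennreal \<bar>f (Suc n) x - f n x\<bar>"
  have m[measurable]: "f n \<in> borel_measurable M" for n using int by auto
  have "(\<integral>\<^sup>+x. (\<Sum>n. ?g n x) \<partial>M) = (\<Sum>n. \<integral>\<^sup>+x. ?g n x \<partial>M)"
    by (rule nn_integral_suminf) measurable
  also have "\<dots> \<le> (\<Sum>n. ennreal ((1/2) ^ n))"
  proof (rule suminf_le)
    show "(\<integral>\<^sup>+x. ?g n x \<partial>M) \<le> ennreal ((1/2) ^ n)" for n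
      using fast[of n] int by (subst nn_integral_eq_integral) (auto intro!: ennreal_leI)
  qed auto
  also have "\<dots> = ennreal (\<Sum>n. (1/2) ^ n)"
    by (rule suminf_ennreal2) (auto intro: summable_geometric)
  also have "\<dots> < \<infinity>" by simp
  finally have "(\<integral>\<^sup>+x. (\<Sum>n. ?g n x) \<partial>M) \<noteq> \<infinity>" by simp
  then have "AE x in M. (\<Sum>n. ?g n x) \<noteq> \<infinity>" by (intro nn_integral_noteq_infinite) auto
  then show ?thesis
  proof eventually_elim
    case (elim x)
    then have "summable (\<lambda>n. \<bar>f (Suc n) x - f n x\<bar>)"
      by (intro summable_suminf_not_top) auto
    then have "summable (\<lambda>n. f (Suc n) x - f n x)" by (rule summable_rabs_cancel)
    then have "convergent (\<lambda>n. f n x - f 0 x)"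
      by (simp add: summable_iff_convergent sum_lessThan_telescope[of "\<lambda>n. f n x"])
    then show ?case using convergent_add[OF _ convergent_const[of "f 0 x"]] by fastforce
  qed
qed

lemma norm_le_iff_nn_integral:
  assumes "L2 f" "0 \<le> e"
  shows "norm (abs_l2 f) \<le> e \<longleftrightarrow> (\<integral>\<^sup>+x. ennreal ((f x)\<^sup>2) \<partial>LOm) \<le> ennreal (e\<^sup>2)"
proof -
  have "(\<integral>\<^sup>+x. ennreal ((f x)\<^sup>2) \<partial>LOm) = ennreal ((norm (abs_l2 f))\<^sup>2)"
    using assms(1) by (subst nn_integral_eq_integral) (auto simp: L2_def abs_l2_norm_sq)
  then show ?thesis using assms(2) by (simp add: abs_le_square_iff[symmetric] flip: power2_le_iff_abs_le)
qed

text \<open>A subsequence with geometrically decreasing increments converges almost everywhere;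
  Fatou's lemma turns the pointwise limit into a limit in norm.\<close>

instance l2 :: complete_space
proof
  fix X :: "nat \<Rightarrow> l2" assume X: "Cauchy X"
  define f where "f n = rep_l2 (X n)" for n
  have f: "L2 (f n)" "X n = abs_l2 (f n)" for n by (simp_all add: f_def L2_rep abs_rep_l2)
  have "\<forall>k. \<exists>N. \<forall>m\<ge>N. \<forall>n\<ge>N. dist (X m) (X n) < (1/2) ^ k"
    using X by (simp add: Cauchy_def)
  then obtain N where N: "\<And>k m n. m \<ge> N k \<Longrightarrow> n \<ge> N k \<Longrightarrow> dist (X m) (X n) < (1/2) ^ k" by metis
  \<comment> \<open>The sum of the \<open>N i\<close> makes \<open>r\<close> nondecreasing and at
    least \<open>N k\<close>; the summand \<open>k\<close> makes it tend to infinity.\<close>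
  define r where "r k = k + (\<Sum>i\<le>k. N i)" for k
  have rN: "N k \<le> r k" for k
    unfolding r_def using member_le_sum[of k "{..k}" N] by (simp add: trans_le_add2)
  have rS: "r k \<le> r (Suc k)" for k by (simp add: r_def)
  have rk: "k \<le> r k" for k by (simp add: r_def)
  have ae: "AE x in LOm. convergent (\<lambda>k. f (r k) x)"
  proof (rule fast_Cauchy_AE_convergent)
    fix k
    show "integrable LOm (f (r k))" by (intro L2_integrable f)
    have "(\<integral>x. \<bar>f (r (Suc k)) x - f (r k) x\<bar> \<partial>LOm) \<le> norm (abs_l2 (\<lambda>x. f (r (Suc k)) x - f (r k) x))"
      by (intro L2_integral_abs_le L2_diff f)
    also have "\<dots> = dist (X (r (Suc k))) (X (r k))" by (simp add: f dist_norm abs_l2_diff)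
    also have "\<dots> \<le> (1/2) ^ k" by (intro less_imp_le N rN order_trans[OF rN rS])
    finally show "(\<integral>x. \<bar>f (r (Suc k)) x - f (r k) x\<bar> \<partial>LOm) \<le> (1/2) ^ k" .
  qed
  define g where "g x = lim (\<lambda>k. f (r k) x)" for x
  have [measurable]: "f k \<in> borel_measurable LOm" for k using f by (simp add: L2_measurable)
  have [measurable]: "g \<in> borel_measurable LOm" unfolding g_def by measurable
  have fatou: "(\<integral>\<^sup>+x. ennreal ((f m x - g x)\<^sup>2) \<partial>LOm) \<le> ennreal (e\<^sup>2)"
    if e: "0 \<le> e" and le: "\<forall>\<^sub>F k in sequentially. dist (X m) (X (r k)) \<le> e" for m e
  proof -
    have "(\<integral>\<^sup>+x. ennreal ((f m x - g x)\<^sup>2) \<partial>LOm) = (\<integral>\<^sup>+x. liminf (\<lambda>k. ennreal ((f m x - f (r k) x)\<^sup>2)) \<partial>LOm)"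
      using ae
    proof (intro nn_integral_cong_AE, eventually_elim)
      case (elim x)
      then have "(\<lambda>k. f (r k) x) \<longlonglongrightarrow> g x" unfolding g_def by (simp add: convergent_LIMSEQ_iff)
      then have "(\<lambda>k. ennreal ((f m x - f (r k) x)\<^sup>2)) \<longlonglongrightarrow> ennreal ((f m x - g x)\<^sup>2)"
        by (intro tendsto_intros)
      then show ?case by (metis lim_imp_Liminf sequentially_bot)
    qed
    also have "\<dots> \<le> liminf (\<lambda>k. \<integral>\<^sup>+x. ennreal ((f m x - f (r k) x)\<^sup>2) \<partial>LOm)"
      by (rule nn_integral_liminf) measurable
    also have "\<dots> \<le> ennreal (e\<^sup>2)"
    proof (rule Liminf_le)
      show "\<forall>\<^sub>F k in sequentially. (\<integral>\<^sup>+x. ennreal ((f m x - f (r k) x)\<^sup>2) \<partial>LOm) \<le> ennreal (e\<^sup>2)"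
        using le
      proof eventually_elim
        case (elim k)
        then show ?case using norm_le_iff_nn_integral[OF L2_diff[OF f(1) f(1)] e, of m "r k"]
          by (simp add: f dist_norm abs_l2_diff)
      qed
    qed simp
    finally show ?thesis .
  qed
  \<comment> \<open>Square integrability of the pointwise limit comes from the same Fatou estimate:
    from \<open>N 0\<close> on all distances are below \<open>(1/2) ^ 0 = 1\<close>.\<close>
  have L2fg: "L2 (\<lambda>x. f (r 0) x - g x)"
  proof -
    have "\<forall>\<^sub>F k in sequentially. dist (X (r 0)) (X (r k)) \<le> 1"
    proof (rule always_eventually, rule allI)
      show "dist (X (r 0)) (X (r k)) \<le> 1" for k
        using N[of 0 "r 0" "r k"] rN[of 0] lift_Suc_mono_le[of r 0 k, OF rS] by (simp add: less_imp_le)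
    qed
    from fatou[OF _ this] have "(\<integral>\<^sup>+x. ennreal ((f (r 0) x - g x)\<^sup>2) \<partial>LOm) \<le> ennreal (1\<^sup>2)" by simp
    also have "\<dots> < \<infinity>" by simp
    finally have "integrable LOm (\<lambda>x. (f (r 0) x - g x)\<^sup>2)"
      by (intro integrableI_nonneg) auto
    then show ?thesis by (simp add: L2_def)
  qed
  have L2g: "L2 g" using L2_diff[OF f(1)[of "r 0"] L2fg] by simp
  have "X \<longlonglongrightarrow> abs_l2 g"
  proof (rule metric_LIMSEQ_I)
    fix e :: real assume e: "0 < e"
    then obtain K where K: "\<And>m n. m \<ge> K \<Longrightarrow> n \<ge> K \<Longrightarrow> dist (X m) (X n) < e / 2"
      using X unfolding Cauchy_def by (meson half_gt_zero)
    have "dist (X m) (abs_l2 g) < e" if "m \<ge> K" for m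
    proof -
      have "\<forall>\<^sub>F k in sequentially. dist (X m) (X (r k)) \<le> e / 2"
        unfolding eventually_sequentially
        by (intro exI[of _ K] allI impI K[THEN less_imp_le] that) (rule order_trans[OF _ rk])
      from fatou[OF _ this] e have "norm (abs_l2 (\<lambda>x. f m x - g x)) \<le> e / 2"
        by (subst norm_le_iff_nn_integral) (auto intro: L2_diff f L2g)
      then show ?thesis using e by (simp add: f dist_norm abs_l2_diff L2g)
    qed
    then show "\<exists>no. \<forall>n\<ge>no. dist (X n) (abs_l2 g) < e" by blast
  qed
  then show "convergent X" by (rule convergentI)
qed


lemma L2_bounded:
  assumes "f \<in> borel_measurable LOm" "\<And>x. x \<in> Omega \<Longrightarrow> \<bar>f x\<bar> \<le> B"
  shows "L2 f"
proof -
  interpret finite_measure LOm by (rule finite_measure_LOm)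
  have "integrable LOm (\<lambda>x. (f x)\<^sup>2)"
  proof (rule integrable_const_bound[of _ "B\<^sup>2"])
    show "AE x in LOm. norm ((f x)\<^sup>2) \<le> B\<^sup>2"
    proof (intro AE_I2)
      fix x assume "x \<in> space LOm"
      then have "\<bar>f x\<bar> \<le> \<bar>B\<bar>" using assms(2)[of x] by (auto simp: space_restrict_space)
      then show "norm ((f x)\<^sup>2) \<le> B\<^sup>2" by (simp add: abs_le_square_iff)
    qed
  qed (use assms in auto)
  then show ?thesis using assms(1) by (simp add: L2_def)
qed

lemma L2_mult_AE_bounded:
  assumes "L2 f" "g \<in> borel_measurable LOm" "AE x in LOm. \<bar>g x\<bar> \<le> B"
  shows "L2 (\<lambda>x. g x * f x)" "(\<integral>x. (g x * f x)\<^sup>2 \<partial>LOm) \<le> B\<^sup>2 * (\<integral>x. (f x)\<^sup>2 \<partial>LOm)"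
proof -
  have le: "AE x in LOm. (g x * f x)\<^sup>2 \<le> B\<^sup>2 * (f x)\<^sup>2"
    using assms(3)
  proof eventually_elim
    case (elim x)
    then have "(g x)\<^sup>2 \<le> B\<^sup>2" by (metis abs_ge_zero power2_abs power_mono)
    then show ?case by (simp add: power_mult_distrib mult_right_mono)
  qed
  have int: "integrable LOm (\<lambda>x. B\<^sup>2 * (f x)\<^sup>2)" using assms by (auto simp: L2_def)
  have int': "integrable LOm (\<lambda>x. (g x * f x)\<^sup>2)"
    by (rule Bochner_Integration.integrable_bound[OF int]) (use le assms in \<open>auto simp: L2_def\<close>)
  then show "L2 (\<lambda>x. g x * f x)" using assms by (auto simp: L2_def)
  show "(\<integral>x. (g x * f x)\<^sup>2 \<partial>LOm) \<le> B\<^sup>2 * (\<integral>x. (f x)\<^sup>2 \<partial>LOm)"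
    using integral_mono_AE[OF int' int le] by simp
qed

lemma L2_mult_bounded:
  assumes "L2 f" "g \<in> borel_measurable LOm" "\<And>x. x \<in> Omega \<Longrightarrow> \<bar>g x\<bar> \<le> B"
  shows "L2 (\<lambda>x. g x * f x)"
  using assms by (intro L2_mult_AE_bounded(1)[of f g B] AE_I2) (auto simp: space_restrict_space)

subsection \<open>Test functions\<close>

lemma continuous_measurable_LOm: "continuous_on Omega f \<Longrightarrow> f \<in> borel_measurable LOm"
  by (rule continuous_imp_measurable_on_sets_lebesgue) (simp_all add: Omega_sets)

lemma Omega_subset_cbox: "Omega \<subseteq> cbox (0, 0) (1, 1)"
  by (simp add: Omega_box box_subset_cbox)

lemma L2_continuous:
  fixes f :: "R2 \<Rightarrow> real"
  assumes "continuous_on UNIV f" shows "L2 f"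
proof -
  have "bounded (f ` cbox (0, 0) (1, 1))"
    using assms by (intro compact_imp_bounded compact_continuous_image) (auto intro: continuous_on_subset)
  then obtain B where "\<And>x. x \<in> cbox (0, 0) (1, 1) \<Longrightarrow> \<bar>f x\<bar> \<le> B" by (auto simp: bounded_iff)
  then show ?thesis using Omega_subset_cbox assms
    by (intro L2_bounded[of _ B] continuous_measurable_LOm) (auto intro: continuous_on_subset)
qed

text \<open>The passage to the gauge integral over the closed square, where iterated integrals of
  continuous functions and the fundamental theorem of calculus apply.\<close>

lemma integral_LOm_cbox:
  fixes f :: "R2 \<Rightarrow> real"
  assumes "continuous_on UNIV f" shows "(\<integral>x. f x \<partial>LOm) = integral (cbox (0, 0) (1, 1)) f"
  using lebesgue_integral_eq_integral[OF L2_integrable[OF L2_continuous[OF assms]] Omega_sets(2)]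
  by (simp add: Omega_box integral_open_interval)

lemma smooth2_DERIV:
  assumes "smooth2 f"
  shows "((\<lambda>t. pd_iter js f (t, y)) has_real_derivative pd False (pd_iter js f) (x, y)) (at x)"
    "((\<lambda>t. pd_iter js f (x, t)) has_real_derivative pd True (pd_iter js f) (x, y)) (at y)"
proof -
  have *: "(\<lambda>t. pd_iter js f (t, y)) differentiable (at x)" "(\<lambda>t. pd_iter js f (x, t)) differentiable (at y)"
    using assms unfolding smooth2_def by (metis fst_conv snd_conv)+
  show "((\<lambda>t. pd_iter js f (t, y)) has_real_derivative pd False (pd_iter js f) (x, y)) (at x)"
    "((\<lambda>t. pd_iter js f (x, t)) has_real_derivative pd True (pd_iter js f) (x, y)) (at y)"
    using * by (simp_all add: pd_def flip: DERIV_deriv_iff_real_differentiable)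
qed

lemma smooth2_has_pd:
  assumes "smooth2 f"
  shows "((\<lambda>t. f (t, y)) has_real_derivative pd False f (x, y)) (at x)"
    "((\<lambda>t. f (x, t)) has_real_derivative pd True f (x, y)) (at y)"
  using smooth2_DERIV[OF assms, of "[]"] by simp_all

lemma smooth2_continuous:
  assumes "smooth2 f" shows "continuous_on UNIV f" "continuous_on UNIV (pd j f)"
  using assms[unfolded smooth2_def, THEN spec, of "[]"] assms[unfolded smooth2_def, THEN spec, of "[j]"] by simp_all

lemma pd_iter_lin:
  assumes "smooth2 f" "smooth2 g"
  shows "pd_iter js (\<lambda>x. a * f x + b * g x) = (\<lambda>x. a * pd_iter js f x + b * pd_iter js g x)"
proof (induction js)
  case (Cons j js)
  note d = smooth2_DERIV[OF assms(1), of js] smooth2_DERIV[OF assms(2), of js]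
  show ?case
  proof
    fix z :: R2
    obtain x y where z: "z = (x, y)" by (cases z)
    show "pd_iter (j # js) (\<lambda>x. a * f x + b * g x) z = a * pd_iter (j # js) f z + b * pd_iter (j # js) g z"
    proof (cases j)
      case True
      have "((\<lambda>t. a * pd_iter js f (x, t) + b * pd_iter js g (x, t)) has_real_derivative
          a * pd True (pd_iter js f) (x, y) + b * pd True (pd_iter js g) (x, y)) (at y)"
        by (intro DERIV_add DERIV_cmult d)
      from DERIV_imp_deriv[OF this] show ?thesis by (simp add: Cons True z pd_def)
    next
      case False
      have "((\<lambda>t. a * pd_iter js f (t, y) + b * pd_iter js g (t, y)) has_real_derivative
          a * pd False (pd_iter js f) (x, y) + b * pd False (pd_iter js g) (x, y)) (at x)"
        by (intro DERIV_add DERIV_cmult d)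
      from DERIV_imp_deriv[OF this] show ?thesis by (simp add: Cons False z pd_def)
    qed
  qed
qed simp

lemma pd_lin:
  assumes "smooth2 f" "smooth2 g"
  shows "pd j (\<lambda>x. a * f x + b * g x) = (\<lambda>x. a * pd j f x + b * pd j g x)"
  using pd_iter_lin[OF assms, of "[j]"] by simp

lemma smooth2_lin:
  assumes "smooth2 f" "smooth2 g" shows "smooth2 (\<lambda>x. a * f x + b * g x)"
  unfolding smooth2_def pd_iter_lin[OF assms]
proof (intro allI conjI)
  fix js and z :: R2
  show "continuous_on UNIV (\<lambda>x. a * pd_iter js f x + b * pd_iter js g x)"
    using assms unfolding smooth2_def by (intro continuous_intros) auto
  show "(\<lambda>t. a * pd_iter js f (t, snd z) + b * pd_iter js g (t, snd z)) differentiable at (fst z)"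
    "(\<lambda>t. a * pd_iter js f (fst z, t) + b * pd_iter js g (fst z, t)) differentiable at (snd z)"
    using assms unfolding smooth2_def by (auto intro!: differentiable_add differentiable_mult)
qed

lemma test_funI:
  assumes "smooth2 f" "\<And>x. f x \<noteq> 0 \<Longrightarrow> x \<in> K" "compact K" "K \<subseteq> Omega" shows "test_fun f"
proof -
  have "closure {x. f x \<noteq> 0} \<subseteq> K"
    using assms by (intro closure_minimal compact_imp_closed) auto
  then show ?thesis using assms(1,3,4) compact_Int_closed[OF assms(3) closed_closure, of "{x. f x \<noteq> 0}"]
    by (auto simp: test_fun_def Int_absorb1)
qed

lemma test_fun_lin:
  assumes "test_fun f" "test_fun g" shows "test_fun (\<lambda>x. a * f x + b * g x)"
proof (rule test_funI)
  show "smooth2 (\<lambda>x. a * f x + b * g x)" using assms by (auto simp: test_fun_def smooth2_lin)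
  let ?K = "closure {x. f x \<noteq> 0} \<union> closure {x. g x \<noteq> 0}"
  show "compact ?K" "?K \<subseteq> Omega" using assms by (auto simp: test_fun_def)
  show "x \<in> ?K" if "a * f x + b * g x \<noteq> 0" for x
    using that closure_subset[of "{x. f x \<noteq> 0}"] closure_subset[of "{x. g x \<noteq> 0}"]
    by (cases "f x = 0") auto
qed

lemma test_fun_smooth: "test_fun f \<Longrightarrow> smooth2 f"
  by (simp add: test_fun_def)

lemmas test_fun_continuous = test_fun_smooth[THEN smooth2_continuous(1)]
  test_fun_smooth[THEN smooth2_continuous(2)]

lemma test_fun_L2: "test_fun f \<Longrightarrow> L2 f" "test_fun f \<Longrightarrow> L2 (pd j f)"
  by (simp_all add: L2_continuous test_fun_continuous)

lemma test_fun_zero: "test_fun f \<Longrightarrow> x \<notin> closure {x. f x \<noteq> 0} \<Longrightarrow> f x = 0"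
  using closure_subset[of "{x. f x \<noteq> 0}"] by blast

lemma test_fun_zero_Omega: "test_fun f \<Longrightarrow> x \<notin> Omega \<Longrightarrow> f x = 0"
  by (auto simp: test_fun_def intro: test_fun_zero)

lemma integral_cbox_fst_deriv:
  fixes F G :: "R2 \<Rightarrow> real"
  assumes "continuous_on UNIV F" "\<And>x y. ((\<lambda>t. G (t, y)) has_real_derivative F (x, y)) (at x)"
  shows "integral (cbox (0, 0) (1, 1)) F = integral {0..1} (\<lambda>y. G (1, y) - G (0, y))"
proof -
  have "integral (cbox (0, 0) (1, 1)) F = integral (cbox 0 1) (\<lambda>x. integral (cbox 0 1) (\<lambda>y. F (x, y)))"
    by (intro integral_prod_continuous continuous_on_subset[OF assms(1)]) auto
  also have "\<dots> = integral (cbox 0 1) (\<lambda>y. integral (cbox 0 1) (\<lambda>x. F (x, y)))"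
    by (intro integral_swap_continuous)
       (auto simp: case_prod_unfold intro: continuous_on_subset[OF assms(1)])
  also have "\<dots> = integral {0..1} (\<lambda>y. G (1, y) - G (0, y))"
  proof -
    have "((\<lambda>x. F (x, y)) has_integral (G (1, y) - G (0, y))) {0..1}" for y
      using assms(2) by (intro fundamental_theorem_of_calculus)
        (auto simp: has_real_derivative_iff_has_vector_derivative intro: has_vector_derivative_at_within)
    note integral_unique[OF this]
    then show ?thesis by simp
  qed
  finally show ?thesis .
qed

lemma integral_cbox_snd_deriv:
  fixes F G :: "R2 \<Rightarrow> real"
  assumes "continuous_on UNIV F" "\<And>x y. ((\<lambda>t. G (x, t)) has_real_derivative F (x, y)) (at y)"
  shows "integral (cbox (0, 0) (1, 1)) F = integral {0..1} (\<lambda>x. G (x, 1) - G (x, 0))"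
proof -
  have "integral (cbox (0, 0) (1, 1)) F = integral (cbox 0 1) (\<lambda>x. integral (cbox 0 1) (\<lambda>y. F (x, y)))"
    by (intro integral_prod_continuous continuous_on_subset[OF assms(1)]) auto
  also have "\<dots> = integral {0..1} (\<lambda>x. G (x, 1) - G (x, 0))"
  proof -
    have "((\<lambda>y. F (x, y)) has_integral (G (x, 1) - G (x, 0))) {0..1}" for x
      using assms(2) by (intro fundamental_theorem_of_calculus)
        (auto simp: has_real_derivative_iff_has_vector_derivative intro: has_vector_derivative_at_within)
    note integral_unique[OF this]
    then show ?thesis by simp
  qed
  finally show ?thesis .
qed

text \<open>By the product rule the two integrands add up to a partial derivative of
  \<open>f x * g x\<close>, and this product vanishes on all four edges.\<close>

lemma test_fun_integration_by_parts:
  assumes "test_fun f" "test_fun g"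
  shows "(\<integral>x. f x * pd j g x \<partial>LOm) = - (\<integral>x. pd j f x * g x \<partial>LOm)"
proof -
  let ?F = "\<lambda>x. f x * pd j g x + pd j f x * g x" and ?G = "\<lambda>x. f x * g x"
  have c: "continuous_on UNIV ?F" using assms by (intro continuous_intros test_fun_continuous)
  have z: "?G (1, t) = 0" "?G (0, t) = 0" "?G (t, 1) = 0" "?G (t, 0) = 0" for t
    using assms by (auto simp: test_fun_zero_Omega Omega_def)
  note d = assms[THEN test_fun_smooth, THEN smooth2_has_pd(1)] assms[THEN test_fun_smooth, THEN smooth2_has_pd(2)]
  have "integral (cbox (0, 0) (1, 1)) ?F = 0"
  proof (cases j)
    case True
    have "((\<lambda>t. ?G (x, t)) has_real_derivative ?F (x, y)) (at y)" for x y
      by (rule derivative_eq_intros d refl)+ (simp add: True)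
    from integral_cbox_snd_deriv[OF c this] show ?thesis using z by simp
  next
    case False
    have "((\<lambda>t. ?G (t, y)) has_real_derivative ?F (x, y)) (at x)" for x y
      by (rule derivative_eq_intros d refl)+ (simp add: False)
    from integral_cbox_fst_deriv[OF c this] show ?thesis using z by simp
  qed
  then have "(\<integral>x. ?F x \<partial>LOm) = 0" using integral_LOm_cbox[OF c] by simp
  then show ?thesis using assms by (simp add: L2_integrable_mult test_fun_L2)
qed

subsection \<open>Bump functions\<close>

text \<open>For \<open>p = 1\<close> this is the classical flat function
  \<open>exp (- (1 / t))\<close> extended by 0. The polynomial in \<open>1 / t\<close> makes the
  family closed under differentiation.\<close>

definition bexp :: "real poly \<Rightarrow> real \<Rightarrow> real" where
  "bexp p t = (if t > 0 then poly p (1 / t) * exp (- (1 / t)) else 0)"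

lemma poly_exp_tendsto_0: "((\<lambda>y. poly p y * exp (- y)) \<longlongrightarrow> (0::real)) at_top"
proof -
  have "((\<lambda>y. \<Sum>i\<le>degree p. coeff p i * (y ^ i / exp y)) \<longlongrightarrow> (\<Sum>i\<le>degree p. coeff p i * 0)) at_top"
    by (intro tendsto_intros tendsto_power_div_exp_0)
  then show ?thesis by (simp add: poly_altdef sum_distrib_right exp_minus divide_inverse mult.assoc)
qed

lemma bexp_tendsto_0: "(bexp p \<longlongrightarrow> 0) (at_right 0)"
proof -
  have "((\<lambda>t. poly p (inverse t) * exp (- inverse t)) \<longlongrightarrow> 0) (at_right 0)"
    by (rule filterlim_compose[OF poly_exp_tendsto_0 filterlim_inverse_at_top_right])
  moreover have "\<forall>\<^sub>F t in at_right (0::real). poly p (inverse t) * exp (- inverse t) = bexp p t"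
    using eventually_at_right_less[of 0] by eventually_elim (simp add: bexp_def inverse_eq_divide)
  ultimately show ?thesis by (rule Lim_transform_eventually)
qed

text \<open>For positive \<open>t\<close> both factors contribute \<open>1 / t\<^sup>2\<close>, with
  opposite signs; hence the difference \<open>p - pderiv p\<close> and the monomial of degree
  two.\<close>

lemma bexp_has_derivative:
  "(bexp p has_real_derivative bexp ([:0, 0, 1:] * (p - pderiv p)) t) (at t)"
proof -
  consider "t > 0" | "t < 0" | "t = 0" by linarith
  then show ?thesis
  proof cases
    case 1
    have "((\<lambda>t. poly p (1 / t) * exp (- (1 / t))) has_real_derivative
        bexp ([:0, 0, 1:] * (p - pderiv p)) t) (at t)"
      using 1 by (auto intro!: derivative_eq_intros DERIV_chain2[OF poly_DERIV] simp: bexp_def divide_simps power2_eq_square)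
        (simp add: algebra_simps)
    then show ?thesis
      by (rule has_field_derivative_transform_within_open[of _ _ _ "{0<..}"]) (use 1 in \<open>auto simp: bexp_def\<close>)
  next
    case 2
    have "((\<lambda>t. 0) has_real_derivative bexp ([:0, 0, 1:] * (p - pderiv p)) t) (at t)"
      using 2 by (simp add: bexp_def)
    then show ?thesis
      by (rule has_field_derivative_transform_within_open[of _ _ _ "{..<0}"]) (use 2 in \<open>auto simp: bexp_def\<close>)
  next
    case 3
    have "((\<lambda>h. (bexp p (0 + h) - bexp p 0) / h) \<longlongrightarrow> 0) (at 0)"
    proof (rule filterlim_split_at)
      have "\<forall>\<^sub>F h in at_left (0::real). (bexp p (0 + h) - bexp p 0) / h = 0"
        by (rule eventually_at_leftI[of "-1"]) (auto simp: bexp_def)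
      then show "((\<lambda>h. (bexp p (0 + h) - bexp p 0) / h) \<longlongrightarrow> 0) (at_left 0)"
        by (rule tendsto_eventually)
      \<comment> \<open>Dividing by \<open>h\<close> raises the polynomial by one degree, so the
        difference quotient at 0 belongs to the same family and its limit is already known.\<close>
      have "\<forall>\<^sub>F h in at_right (0::real). bexp ([:0, 1:] * p) h = (bexp p (0 + h) - bexp p 0) / h"
        using eventually_at_right_less[of 0] by eventually_elim (simp add: bexp_def)
      then show "((\<lambda>h. (bexp p (0 + h) - bexp p 0) / h) \<longlongrightarrow> 0) (at_right 0)"
        by (rule Lim_transform_eventually[OF bexp_tendsto_0])
    qed
    then show ?thesis using 3 by (simp add: DERIV_def bexp_def)
  qed
qed

lemma bexp_continuous: "continuous_on S (bexp p)"
  using bexp_has_derivative by (auto intro!: continuous_at_imp_continuous_on DERIV_isCont)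

text \<open>Smoothness is obtained from a class of functions that is closed under both partial derivatives.\<close>

inductive flat_combination :: "(R2 \<Rightarrow> real) \<Rightarrow> bool" where
  base: "flat_combination (\<lambda>z. bexp p (a * fst z + b * snd z + c))"
| scale: "flat_combination f \<Longrightarrow> flat_combination (\<lambda>z. k * f z)"
| add: "flat_combination f \<Longrightarrow> flat_combination g \<Longrightarrow> flat_combination (\<lambda>z. f z + g z)"
| mult: "flat_combination f \<Longrightarrow> flat_combination g \<Longrightarrow> flat_combination (\<lambda>z. f z * g z)"

lemma flat_combination_continuous: "flat_combination f \<Longrightarrow> continuous_on UNIV f"
  by (induction rule: flat_combination.induct)
     (auto intro!: continuous_intros continuous_on_compose2[OF bexp_continuous[of UNIV]])

lemma flat_combination_fst_deriv:
  "flat_combination f \<Longrightarrow> \<exists>g. flat_combination g \<and> (\<forall>x y. ((\<lambda>t. f (t, y)) has_real_derivative g (x, y)) (at x))"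
proof (induction rule: flat_combination.induct)
  case (base p a b c)
  let ?q = "[:0, 0, 1:] * (p - pderiv p)"
  have "((\<lambda>t. bexp p (a * t + b * y + c)) has_real_derivative a * bexp ?q (a * x + b * y + c)) (at x)" for x y
    by (rule DERIV_cong[OF DERIV_chain2[OF bexp_has_derivative]]) (auto intro!: derivative_eq_intros)
  then show ?case
    by (intro exI[of _ "\<lambda>z. a * bexp ?q (a * fst z + b * snd z + c)"] conjI flat_combination.intros) auto
next
  case (scale f k)
  then obtain f' where "flat_combination f'" "\<And>x y. ((\<lambda>t. f (t, y)) has_real_derivative f' (x, y)) (at x)" by blast
  then show ?case
    by (intro exI[of _ "\<lambda>z. k * f' z"] conjI flat_combination.intros) (auto intro!: derivative_eq_intros)
next
  case (add f g)
  then obtain f' g' where "flat_combination f'" "\<And>x y. ((\<lambda>t. f (t, y)) has_real_derivative f' (x, y)) (at x)"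
    "flat_combination g'" "\<And>x y. ((\<lambda>t. g (t, y)) has_real_derivative g' (x, y)) (at x)" by blast
  then show ?case
    by (intro exI[of _ "\<lambda>z. f' z + g' z"] conjI flat_combination.intros) (auto intro!: derivative_eq_intros)
next
  case (mult f g)
  then obtain f' g' where "flat_combination f'" "\<And>x y. ((\<lambda>t. f (t, y)) has_real_derivative f' (x, y)) (at x)"
    "flat_combination g'" "\<And>x y. ((\<lambda>t. g (t, y)) has_real_derivative g' (x, y)) (at x)" by blast
  with mult(1,2) show ?case
    by (intro exI[of _ "\<lambda>z. f' z * g z + g' z * f z"] conjI flat_combination.intros) (auto intro!: derivative_eq_intros)
qed

text \<open>Exchanging the coordinates reduces derivatives in the second variable to those in the
  first.\<close>

lemma flat_combination_swap: "flat_combination f \<Longrightarrow> flat_combination (\<lambda>z. f (prod.swap z))"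
proof (induction rule: flat_combination.induct)
  case (base p a b c)
  show ?case using flat_combination.base[of p b a c] by (simp add: add.commute)
qed (auto intro: flat_combination.intros)

lemma flat_combination_snd_deriv:
  assumes "flat_combination f"
  shows "\<exists>g. flat_combination g \<and> (\<forall>x y. ((\<lambda>t. f (x, t)) has_real_derivative g (x, y)) (at y))"
proof -
  obtain g where "flat_combination g" and g: "\<And>x y. ((\<lambda>t. f (prod.swap (t, y))) has_real_derivative g (x, y)) (at x)"
    using flat_combination_fst_deriv[OF flat_combination_swap[OF assms]] by blast
  then show ?thesis
    by (intro exI[of _ "\<lambda>z. g (prod.swap z)"] conjI flat_combination_swap) (auto simp: g[simplified])
qed

lemma flat_combination_pd: assumes "flat_combination f" shows "flat_combination (pd j f)"
proof (cases j)
  case True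
  obtain g where g: "flat_combination g" "\<And>x y. ((\<lambda>t. f (x, t)) has_real_derivative g (x, y)) (at y)"
    using flat_combination_snd_deriv[OF assms] by blast
  have "pd j f = g" using True DERIV_imp_deriv[OF g(2)] by (auto simp: pd_def)
  then show ?thesis using g by simp
next
  case False
  obtain g where g: "flat_combination g" "\<And>x y. ((\<lambda>t. f (t, y)) has_real_derivative g (x, y)) (at x)"
    using flat_combination_fst_deriv[OF assms] by blast
  have "pd j f = g" using False DERIV_imp_deriv[OF g(2)] by (auto simp: pd_def)
  then show ?thesis using g by simp
qed

lemma flat_combination_smooth2: assumes "flat_combination f" shows "smooth2 f"
proof -
  have "flat_combination (pd_iter js f)" for js by (induction js) (auto simp: assms flat_combination_pd)
  then show ?thesis
    unfolding smooth2_def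
    using flat_combination_continuous flat_combination_fst_deriv flat_combination_snd_deriv
    by (metis prod.collapse real_differentiable_def)
qed

text \<open>Positive exactly on a rectangle of width \<open>1/4\<close> with left edge
  \<open>a\<close>. The copies at \<open>1/8\<close> and \<open>5/8\<close> have disjoint supports
  inside the square and provide two independent members of the form domain.\<close>

definition bump :: "real \<Rightarrow> R2 \<Rightarrow> real" where
  "bump a z = bexp 1 (fst z - a) * bexp 1 (a + 1/4 - fst z) * (bexp 1 (snd z - 1/4) * bexp 1 (3/4 - snd z))"

lemma bump_nonzero_iff: "bump a z \<noteq> 0 \<longleftrightarrow> z \<in> {a<..<a+1/4} \<times> {1/4<..<3/4}"
  by (auto simp: bump_def bexp_def mem_Times_iff)

lemma test_fun_bump: assumes "0 < a" "a < 3/4" shows "test_fun (bump a)"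
proof (rule test_funI)
  have "flat_combination (\<lambda>z. bexp 1 (1 * fst z + 0 * snd z + - a) * bexp 1 ((-1) * fst z + 0 * snd z + (a + 1/4)) *
     (bexp 1 (0 * fst z + 1 * snd z + - (1/4)) * bexp 1 (0 * fst z + (-1) * snd z + 3/4)))"
    by (intro flat_combination.intros)
  also have "(\<lambda>z. bexp 1 (1 * fst z + 0 * snd z + - a) * bexp 1 ((-1) * fst z + 0 * snd z + (a + 1/4)) *
     (bexp 1 (0 * fst z + 1 * snd z + - (1/4)) * bexp 1 (0 * fst z + (-1) * snd z + 3/4))) = bump a"
    by (rule ext) (simp add: bump_def algebra_simps)
  finally show "smooth2 (bump a)" by (rule flat_combination_smooth2)
  show "compact ({a..a+1/4} \<times> {1/4..3/4::real})" by (intro compact_Times) auto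
  show "{a..a+1/4} \<times> {1/4..3/4} \<subseteq> Omega" using assms by (auto simp: Omega_def)
  show "x \<in> {a..a+1/4} \<times> {1/4..3/4}" if "bump a x \<noteq> 0" for x using that by (auto simp: bump_nonzero_iff)
qed

lemma bump_not_AE_zero: assumes "0 < a" "a < 3/4" shows "\<not> (AE x in LOm. bump a x = 0)"
proof
  assume "AE x in LOm. bump a x = 0"
  then have "negligible {x \<in> Omega. bump a x \<noteq> 0}"
    using Omega_sets(2) by (simp add: AE_restrict_space_iff eventually_ae_filter_negligible) (auto intro: negligible_subset)
  moreover have "{x \<in> Omega. bump a x \<noteq> 0} = {a<..<a+1/4} \<times> {1/4<..<3/4}"
    using assms by (auto simp: bump_nonzero_iff Omega_def)
  moreover have "open ({a<..<a+1/4} \<times> {1/4<..<3/4::real})" by (intro open_Times) auto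
  ultimately show False
    using open_not_negligible[of "{a<..<a+1/4} \<times> {1/4<..<3/4::real}"] by (auto simp: greaterThanLessThan_empty_iff2)
qed

lemma bumps_independent:
  assumes "a *\<^sub>R abs_l2 (bump (1/8)) + b *\<^sub>R abs_l2 (bump (5/8)) = 0" shows "a = 0 \<and> b = 0"
proof -
  let ?f = "bump (1/8)" and ?g = "bump (5/8)"
  have L: "L2 ?f" "L2 ?g" by (simp_all add: test_fun_L2 test_fun_bump)
  have "?f x * ?g x = 0" for x using bump_nonzero_iff[of "1/8" x] bump_nonzero_iff[of "5/8" x] by (auto simp: mem_Times_iff)
  then have o: "inner (abs_l2 ?f) (abs_l2 ?g) = 0" unfolding abs_l2_inner[OF L] by (simp only: integral_zero)
  have nz: "abs_l2 ?f \<noteq> 0" "abs_l2 ?g \<noteq> 0"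
    using L bump_not_AE_zero[of "1/8"] bump_not_AE_zero[of "5/8"] by (auto simp: zero_l2_abs abs_l2_eq_iff L2_zero)
  have "inner (a *\<^sub>R abs_l2 ?f + b *\<^sub>R abs_l2 ?g) (abs_l2 ?f) = 0"
    "inner (a *\<^sub>R abs_l2 ?f + b *\<^sub>R abs_l2 ?g) (abs_l2 ?g) = 0" using assms by simp_all
  then show ?thesis using o nz by (simp add: inner_simps inner_commute)
qed

subsection \<open>Approximation by averages over small squares\<close>

text \<open>Cauchy-Schwarz for the fundamental theorem of calculus. The form with a larger interval
  \<open>{a..b}\<close> gives one bound for all pairs of points in it.\<close>

lemma increment_sq_le:
  fixes f f' :: "real \<Rightarrow> real"
  assumes c: "continuous_on UNIV f'" and d: "\<And>t. (f has_real_derivative f' t) (at t)"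
    and xy: "x \<in> {a..b}" "y \<in> {a..b}"
  shows "(f y - f x)\<^sup>2 \<le> (b - a) * integral {a..b} (\<lambda>t. (f' t)\<^sup>2)"
proof -
  have int: "g integrable_on {x..y}" if "continuous_on UNIV g" for g :: "real \<Rightarrow> real" and x y
    using that by (intro integrable_continuous_real continuous_on_subset[OF that]) auto
  have cs: "(f y - f x)\<^sup>2 \<le> (b - a) * integral {a..b} (\<lambda>t. (f' t)\<^sup>2)"
    if xy: "a \<le> x" "x < y" "y \<le> b" for x y
  proof -
    \<comment> \<open>The mean slope: expanding the nonnegative integral of the square of
      \<open>f' r - t\<close> with this \<open>t\<close> is Cauchy-Schwarz.\<close>
    define t where "t = (f y - f x) / (y - x)"
    let ?I = "integral {x..y} (\<lambda>t. (f' t)\<^sup>2)"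
    have ftc: "(f' has_integral (f y - f x)) {x..y}"
      using d xy by (intro fundamental_theorem_of_calculus)
        (auto simp: has_real_derivative_iff_has_vector_derivative intro: has_vector_derivative_at_within)
    have "((\<lambda>r. (f' r)\<^sup>2 + t\<^sup>2 - 2 * t * f' r) has_integral (?I + (y - x) * t\<^sup>2 - 2 * t * (f y - f x))) {x..y}"
      using has_integral_const_real[of "t\<^sup>2" x y] xy
      by (intro has_integral_diff has_integral_add has_integral_mult_right ftc integrable_integral int continuous_intros c) auto
    then have "0 \<le> ?I + (y - x) * t\<^sup>2 - 2 * t * (f y - f x)"
      by (rule has_integral_nonneg) (use sum_squares_bound in \<open>auto simp: algebra_simps\<close>)
    also have "\<dots> = ?I - (f y - f x)\<^sup>2 / (y - x)"
      using xy by (simp add: t_def power2_eq_square divide_simps)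
    finally have "(f y - f x)\<^sup>2 \<le> (y - x) * ?I" using xy by (simp add: field_simps)
    also have "\<dots> \<le> (b - a) * integral {a..b} (\<lambda>t. (f' t)\<^sup>2)"
      using xy by (intro mult_mono integral_subset_le integral_nonneg int continuous_intros c) auto
    finally show ?thesis .
  qed
  consider "x < y" | "y < x" | "x = y" by linarith
  then show ?thesis
  proof cases
    case 1 with cs[of x y] xy show ?thesis by auto
  next
    case 2 with cs[of y x] xy show ?thesis by (auto simp: power2_commute)
  next
    case 3
    with xy show ?thesis by (auto intro!: mult_nonneg_nonneg integral_nonneg int continuous_intros c)
  qed
qed

text \<open>The deviation is quadratic in \<open>z\<close> with its vertex at the mean and exceeds
  the minimum by \<open>k * (z - I / k)\<^sup>2\<close>. Hence any convenient value may replace the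
  mean in an upper bound.\<close>

lemma mean_minimizes_deviation:
  fixes u :: "'a::euclidean_space \<Rightarrow> real"
  assumes u: "continuous_on (cbox a b) u" and A: "measure lborel (cbox a b) > 0"
  shows "integral (cbox a b) (\<lambda>x. (u x - integral (cbox a b) u / measure lborel (cbox a b))\<^sup>2)
    \<le> integral (cbox a b) (\<lambda>x. (u x - z)\<^sup>2)"
proof -
  let ?Q = "cbox a b"
  define k where "k = measure lborel ?Q"
  define I where "I = integral ?Q u"
  have k: "k > 0" using A by (simp add: k_def)
  have *: "integral ?Q (\<lambda>x. (u x - z)\<^sup>2) = integral ?Q (\<lambda>x. (u x)\<^sup>2) + k * z\<^sup>2 - 2 * z * I" for z
  proof (rule integral_unique)
    have "((\<lambda>x. (u x)\<^sup>2 + z\<^sup>2 - 2 * z * u x) has_integral (integral ?Q (\<lambda>x. (u x)\<^sup>2) + k * z\<^sup>2 - 2 * z * I)) ?Q"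
      using has_integral_const[of "z\<^sup>2" a b] unfolding I_def k_def
      by (intro has_integral_diff has_integral_add has_integral_mult_right integrable_integral
          integrable_continuous continuous_intros u) auto
    then show "((\<lambda>x. (u x - z)\<^sup>2) has_integral (integral ?Q (\<lambda>x. (u x)\<^sup>2) + k * z\<^sup>2 - 2 * z * I)) ?Q"
      by (simp add: power2_diff algebra_simps)
  qed
  have "k * z\<^sup>2 - 2 * z * I - (k * (I / k)\<^sup>2 - 2 * (I / k) * I) = k * (z - I / k)\<^sup>2"
    using k by (simp add: power2_eq_square divide_simps) (simp add: algebra_simps)
  moreover have "\<dots> \<ge> 0" using k by simp
  ultimately show ?thesis unfolding I_def[symmetric] k_def[symmetric] using *[of z] *[of "I / k"] by linarith
qed

lemma content_square: "0 \<le> s \<Longrightarrow> measure lborel (cbox (a, b) (a + s, b + s :: real)) = s\<^sup>2"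
  by (simp add: content_Pair power2_eq_square)

lemma continuous_slice:
  fixes D :: "R2 \<Rightarrow> real"
  assumes "continuous_on UNIV D"
  shows "continuous_on S (\<lambda>t. D (t, y))" "continuous_on S (\<lambda>t. D (x, t))"
  by (auto intro!: continuous_intros continuous_on_compose2[OF assms])

lemma continuous_slice_integral:
  fixes D :: "R2 \<Rightarrow> real"
  assumes "continuous_on UNIV D"
  shows "continuous_on S (\<lambda>y. integral {a..b} (\<lambda>t. D (t, y)))" "continuous_on S (\<lambda>x. integral {a..b} (\<lambda>t. D (x, t)))"
proof -
  have "continuous_on (S \<times> cbox a b) (\<lambda>(y, t). D (t, y))" "continuous_on (S \<times> cbox a b) (\<lambda>(x, t). D (x, t))"
    unfolding case_prod_unfold by (auto intro!: continuous_intros continuous_on_compose2[OF assms])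
  from this[THEN integral_continuous_on_param] show "continuous_on S (\<lambda>y. integral {a..b} (\<lambda>t. D (t, y)))"
    "continuous_on S (\<lambda>x. integral {a..b} (\<lambda>t. D (x, t)))" by simp_all
qed

lemma integral_rect:
  fixes D :: "R2 \<Rightarrow> real"
  assumes "continuous_on UNIV D"
  shows "integral (cbox (a, b) (a', b')) D = integral {a..a'} (\<lambda>x. integral {b..b'} (\<lambda>y. D (x, y)))"
    "integral (cbox (a, b) (a', b')) D = integral {b..b'} (\<lambda>y. integral {a..a'} (\<lambda>x. D (x, y)))"
proof -
  show *: "integral (cbox (a, b) (a', b')) D = integral {a..a'} (\<lambda>x. integral {b..b'} (\<lambda>y. D (x, y)))"
    using integral_prod_continuous[OF continuous_on_subset[OF assms], of a b a' b'] by simp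
  have "integral (cbox a a') (\<lambda>x. integral (cbox b b') (\<lambda>y. D (x, y)))
      = integral (cbox b b') (\<lambda>y. integral (cbox a a') (\<lambda>x. D (x, y)))"
    by (intro integral_swap_continuous) (auto simp: case_prod_unfold intro: continuous_on_subset[OF assms])
  then show "integral (cbox (a, b) (a', b')) D = integral {b..b'} (\<lambda>y. integral {a..a'} (\<lambda>x. D (x, y)))"
    using * by simp
qed

text \<open>The mean is compared with the value of \<open>u\<close> at a point whose abscissa minimises the vertical
  energy of the slice.\<close>

lemma poincare_square:
  fixes u D1 D2 :: "R2 \<Rightarrow> real"
  assumes c: "continuous_on UNIV u" "continuous_on UNIV D1" "continuous_on UNIV D2"
    and d1: "\<And>x y. ((\<lambda>t. u (t, y)) has_real_derivative D1 (x, y)) (at x)"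
    and d2: "\<And>x y. ((\<lambda>t. u (x, t)) has_real_derivative D2 (x, y)) (at y)"
    and s: "0 < s" and Q: "Q = cbox (a, b) (a + s, b + s)"
  shows "integral Q (\<lambda>x. (u x - integral Q u / s\<^sup>2)\<^sup>2)
    \<le> 2 * s\<^sup>2 * integral Q (\<lambda>x. (D1 x)\<^sup>2 + (D2 x)\<^sup>2)"
proof -
  have c': "continuous_on UNIV (\<lambda>x. (D1 x)\<^sup>2)" "continuous_on UNIV (\<lambda>x. (D2 x)\<^sup>2)"
    by (intro continuous_intros c)+
  define F where "F y = integral {a..a+s} (\<lambda>t. (D1 (t, y))\<^sup>2)" for y
  define G where "G x = integral {b..b+s} (\<lambda>t. (D2 (x, t))\<^sup>2)" for x
  have Fc: "continuous_on S F" and Gc: "continuous_on S G" for S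
    unfolding F_def G_def using continuous_slice_integral[OF c'(1)] continuous_slice_integral[OF c'(2)] by auto
  obtain x0 where x0: "x0 \<in> {a..a+s}" "\<And>x. x \<in> {a..a+s} \<Longrightarrow> G x0 \<le> G x"
    using continuous_attains_inf[of "{a..a+s}" G] s Gc by auto
  have "integral {a..a+s} (\<lambda>x. G x0) \<le> integral {a..a+s} G"
    by (intro integral_le integrable_continuous_real continuous_intros Gc x0)
  then have G0: "s * G x0 \<le> integral {a..a+s} G" using s by simp
  \<comment> \<open>The path from \<open>(x, y)\<close> to \<open>(x0, b)\<close> first runs along
    the row \<open>y\<close> and then down the column \<open>x0\<close>, where \<open>G0\<close>
    bounds the vertical energy by its average over all columns.\<close>
  have pt: "(u (x, y) - u (x0, b))\<^sup>2 \<le> 2 * s * F y + 2 * integral {a..a+s} G"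
    if "x \<in> {a..a+s}" "y \<in> {b..b+s}" for x y
  proof -
    have "(u (x, y) - u (x0, y))\<^sup>2 \<le> (a + s - a) * F y"
      unfolding F_def using that x0(1) by (intro increment_sq_le[where f = "\<lambda>t. u (t, y)"] continuous_slice c d1)
    moreover have "(u (x0, y) - u (x0, b))\<^sup>2 \<le> (b + s - b) * G x0"
      unfolding G_def using that s by (intro increment_sq_le[where f = "\<lambda>t. u (x0, t)"] continuous_slice c d2) auto
    moreover have "(p + q)\<^sup>2 \<le> 2 * p\<^sup>2 + 2 * q\<^sup>2" for p q :: real
      using sum_squares_bound[of p q] by (simp add: power2_sum)
    from this[of "u (x, y) - u (x0, y)" "u (x0, y) - u (x0, b)"]
    have "(u (x, y) - u (x0, b))\<^sup>2 \<le> 2 * (u (x, y) - u (x0, y))\<^sup>2 + 2 * (u (x0, y) - u (x0, b))\<^sup>2" by simp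
    ultimately show ?thesis using G0 by simp
  qed
  have "integral Q (\<lambda>x. (u x - integral Q u / s\<^sup>2)\<^sup>2) \<le> integral Q (\<lambda>x. (u x - u (x0, b))\<^sup>2)"
    using mean_minimizes_deviation[OF continuous_on_subset[OF c(1)], of "(a, b)" "(a + s, b + s)" "u (x0, b)"] s
    by (simp add: Q content_square)
  also have "\<dots> \<le> integral Q (\<lambda>x. 2 * s * F (snd x) + 2 * integral {a..a+s} G)"
    unfolding Q by (intro integral_le integrable_continuous continuous_intros continuous_on_compose2[OF Fc[of UNIV]] continuous_on_subset[OF c(1)])
      (auto simp: pt)
  also have "\<dots> = 2 * s\<^sup>2 * integral {b..b+s} F + 2 * s\<^sup>2 * integral {a..a+s} G"
  proof -
    have "integral Q (\<lambda>x. 2 * s * F (snd x) + 2 * integral {a..a+s} G)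
      = integral {a..a+s} (\<lambda>x. integral {b..b+s} (\<lambda>y. 2 * s * F y + 2 * integral {a..a+s} G))"
      unfolding Q by (subst integral_rect(1)) (auto intro!: continuous_intros continuous_on_compose2[OF Fc[of UNIV]])
    also have "integral {b..b+s} (\<lambda>y. 2 * s * F y + 2 * integral {a..a+s} G)
      = 2 * s * integral {b..b+s} F + s * (2 * integral {a..a+s} G)"
      using s by (subst integral_add) (auto intro!: integrable_continuous_real continuous_intros Fc)
    finally show ?thesis using s by (simp add: power2_eq_square algebra_simps)
  qed
  also have "\<dots> = 2 * s\<^sup>2 * (integral Q (\<lambda>x. (D1 x)\<^sup>2) + integral Q (\<lambda>x. (D2 x)\<^sup>2))"
    unfolding Q F_def G_def by (simp add: integral_rect(2)[OF c'(1)] integral_rect(1)[OF c'(2)] distrib_left)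
  also have "integral Q (\<lambda>x. (D1 x)\<^sup>2) + integral Q (\<lambda>x. (D2 x)\<^sup>2) = integral Q (\<lambda>x. (D1 x)\<^sup>2 + (D2 x)\<^sup>2)"
    unfolding Q by (intro integral_add[symmetric] integrable_continuous continuous_on_subset[OF c'(1)] continuous_on_subset[OF c'(2)]) auto
  finally show ?thesis .
qed

text \<open>Each row starts from the value 0 on the left edge, so only the unweighted derivative is
  used, which stays controlled where the weight degenerates. One factor \<open>\<delta>\<close>
  comes from the increment bound, the other from the width of the strip.\<close>

lemma strip_estimate:
  fixes u D1 :: "R2 \<Rightarrow> real"
  assumes c: "continuous_on UNIV u" "continuous_on UNIV D1"
    and d1: "\<And>x y. ((\<lambda>t. u (t, y)) has_real_derivative D1 (x, y)) (at x)"
    and \<delta>: "0 \<le> \<delta>" "\<delta> \<le> 1" and z: "\<And>y. u (0, y) = 0"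
  shows "integral (cbox (0, 0) (\<delta>, 1)) (\<lambda>x. (u x)\<^sup>2) \<le> \<delta>\<^sup>2 * integral (cbox (0, 0) (1, 1)) (\<lambda>x. (D1 x)\<^sup>2)"
proof -
  have c': "continuous_on UNIV (\<lambda>x. (D1 x)\<^sup>2)" "continuous_on UNIV (\<lambda>x. (u x)\<^sup>2)"
    by (intro continuous_intros c)+
  define F where "F y = integral {0..\<delta>} (\<lambda>t. (D1 (t, y))\<^sup>2)" for y
  have Fc: "continuous_on S F" for S
    unfolding F_def using continuous_slice_integral[OF c'(1)] by auto
  have pt: "(u (x, y))\<^sup>2 \<le> \<delta> * F y" if "x \<in> {0..\<delta>}" for x y
    using increment_sq_le[OF continuous_slice(1)[OF c(2)] d1, of 0 0 \<delta> x y] that z \<delta> by (simp add: F_def)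
  have "integral (cbox (0, 0) (\<delta>, 1)) (\<lambda>x. (u x)\<^sup>2) \<le> integral (cbox (0, 0) (\<delta>, 1)) (\<lambda>x. \<delta> * F (snd x))"
    by (intro integral_le integrable_continuous continuous_intros continuous_on_compose2[OF Fc[of UNIV]] continuous_on_subset[OF c(1)])
       (auto simp: pt)
  also have "\<dots> = integral {0..\<delta>} (\<lambda>x. integral {0..1} (\<lambda>y. \<delta> * F y))"
    by (subst integral_rect(1)) (auto intro!: continuous_intros continuous_on_compose2[OF Fc[of UNIV]])
  also have "\<dots> = \<delta>\<^sup>2 * integral {0..1} F" using \<delta> by (simp add: power2_eq_square)
  also have "integral {0..1} F = integral (cbox (0, 0) (\<delta>, 1)) (\<lambda>x. (D1 x)\<^sup>2)"
    unfolding F_def by (simp add: integral_rect(2)[OF c'(1)])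
  also have "\<dots> \<le> integral (cbox (0, 0) (1, 1)) (\<lambda>x. (D1 x)\<^sup>2)"
    using \<delta> by (intro integral_subset_le integrable_continuous continuous_on_subset[OF c'(1)]) (auto simp: cbox_Pair_eq)
  finally show ?thesis by (simp add: mult_left_mono)
qed

text \<open>\<open>A\<close> and the closed box differ only within the negligible boundary of the
  box. Half-open cells can therefore partition the square while the integrals are taken over closed
  boxes.\<close>

lemma LOm_indicator_integral:
  fixes f :: "R2 \<Rightarrow> real"
  assumes f: "continuous_on UNIV f" and A: "A \<in> sets borel" "box a b \<subseteq> A" "A \<subseteq> cbox a b" "box a b \<subseteq> Omega"
  shows "integrable LOm (\<lambda>x. indicator A x * f x)"
    "(\<integral>x. indicator A x * f x \<partial>LOm) = integral (cbox a b) f"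
proof -
  have [measurable]: "indicator A \<in> borel_measurable LOm"
    using A(1) by (intro measurable_restrict_space1 borel_measurable_indicator) simp
  have "L2 (\<lambda>x. indicator A x * f x)"
    using L2_mult_bounded[OF L2_continuous[OF f], of "indicator A" 1] by (auto simp: indicator_def)
  then show int: "integrable LOm (\<lambda>x. indicator A x * f x)" by (rule L2_integrable)
  have "(\<integral>x. indicator A x * f x \<partial>LOm) = integral Omega (\<lambda>x. indicator A x * f x)"
    by (rule lebesgue_integral_eq_integral[OF int Omega_sets(2)])
  also have "\<dots> = integral UNIV (\<lambda>x. if x \<in> Omega then indicator A x * f x else 0)"
    by (rule Henstock_Kurzweil_Integration.integral_restrict_UNIV[symmetric])
  also have "\<dots> = integral UNIV (\<lambda>x. if x \<in> cbox a b then f x else 0)"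
  proof (rule integral_spike[OF negligible_frontier_interval[of a b]])
    fix x assume "x \<in> UNIV - (cbox a b - box a b)"
    then show "(if x \<in> cbox a b then f x else 0) = (if x \<in> Omega then indicator A x * f x else 0)"
      using A by (auto simp: indicator_def)
  qed
  also have "\<dots> = integral (cbox a b) f" by (rule Henstock_Kurzweil_Integration.integral_restrict_UNIV)
  finally show "(\<integral>x. indicator A x * f x \<partial>LOm) = integral (cbox a b) f" .
qed

section \<open>Grid cells and averaging over them\<close>

definition cell_index :: "nat \<Rightarrow> R2 \<Rightarrow> int \<times> int" where
  "cell_index N x = (\<lfloor>real N * fst x\<rfloor>, \<lfloor>real N * snd x\<rfloor>)"

text \<open>Fibres of the index map, hence disjoint by construction; for positive \<open>N\<close>
  they are half-open squares of side \<open>1 / N\<close>.\<close>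

definition cell :: "nat \<Rightarrow> int \<times> int \<Rightarrow> R2 set" where
  "cell N p = {x. cell_index N x = p}"

definition ccell :: "nat \<Rightarrow> int \<times> int \<Rightarrow> R2 set" where
  "ccell N p = cbox (real_of_int (fst p) / real N, real_of_int (snd p) / real N) (real_of_int (fst p) / real N + 1 / N, real_of_int (snd p) / real N + 1 / N)"

text \<open>A cell of the grid has area \<open>1 / N\<^sup>2\<close>, so the factor \<open>N\<close>
  makes this a unit vector, and the rank-one operator that it generates replaces a function by its
  mean over the cell.\<close>

definition cell_weight :: "nat \<Rightarrow> int \<times> int \<Rightarrow> R2 \<Rightarrow> real" where
  "cell_weight N p x = indicat_real (cell N p) x * real N"

lemma cell_eq: "0 < N \<Longrightarrow> cell N p = {real_of_int (fst p) / real N..<real_of_int (fst p) / real N + 1 / N} \<times> {real_of_int (snd p) / real N..<real_of_int (snd p) / real N + 1 / N}"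
  by (cases p) (auto simp: cell_def cell_index_def floor_eq_iff field_simps)

lemma cell_sandwich:
  assumes N: "0 < N" and p: "p \<in> {0..<int N} \<times> {0..<int N}"
  shows "cell N p \<in> sets borel"
    "box (real_of_int (fst p) / real N, real_of_int (snd p) / real N) (real_of_int (fst p) / real N + 1 / N, real_of_int (snd p) / real N + 1 / N) \<subseteq> cell N p"
    "cell N p \<subseteq> cbox (real_of_int (fst p) / real N, real_of_int (snd p) / real N) (real_of_int (fst p) / real N + 1 / N, real_of_int (snd p) / real N + 1 / N)"
    "box (real_of_int (fst p) / real N, real_of_int (snd p) / real N) (real_of_int (fst p) / real N + 1 / N, real_of_int (snd p) / real N + 1 / N) \<subseteq> Omega"
proof -
  show "cell N p \<in> sets borel" unfolding cell_eq[OF N] by (intro borel_Times) auto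
  show "box (real_of_int (fst p) / real N, real_of_int (snd p) / real N) (real_of_int (fst p) / real N + 1 / N, real_of_int (snd p) / real N + 1 / N) \<subseteq> cell N p"
    "cell N p \<subseteq> cbox (real_of_int (fst p) / real N, real_of_int (snd p) / real N) (real_of_int (fst p) / real N + 1 / N, real_of_int (snd p) / real N + 1 / N)"
    unfolding cell_eq[OF N] by (auto simp: box_prod cbox_Pair_eq)
  obtain i j where ij: "p = (i, j)" by (cases p)
  have "real_of_int k + 1 \<le> real N" if "k < int N" for k using that by linarith
  then have "real_of_int i / N + 1 / N \<le> 1" "real_of_int j / N + 1 / N \<le> 1" "0 \<le> real_of_int i / N" "0 \<le> real_of_int j / N"
    using N p ij by (auto simp: field_simps)
  then show "box (real_of_int (fst p) / real N, real_of_int (snd p) / real N) (real_of_int (fst p) / real N + 1 / N, real_of_int (snd p) / real N + 1 / N) \<subseteq> Omega"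
    unfolding Omega_def by (auto simp: box_prod ij)
qed

lemma cell_integral:
  fixes f :: "R2 \<Rightarrow> real"
  assumes "0 < N" "p \<in> {0..<int N} \<times> {0..<int N}" "continuous_on UNIV f"
  shows "integrable LOm (\<lambda>x. indicator (cell N p) x * f x)"
    "(\<integral>x. indicator (cell N p) x * f x \<partial>LOm) = integral (ccell N p) f"
  using LOm_indicator_integral[OF assms(3) cell_sandwich[OF assms(1,2)]] by (simp_all add: ccell_def)

lemma L2_cell_weight:
  assumes "0 < N" "p \<in> {0..<int N} \<times> {0..<int N}" shows "L2 (cell_weight N p)"
proof (rule L2_bounded)
  have "integrable LOm (\<lambda>x. indicat_real (cell N p) x * real N)"
    by (rule cell_integral(1)[OF assms]) auto
  then show "cell_weight N p \<in> borel_measurable LOm" unfolding cell_weight_def by auto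
  show "\<bar>cell_weight N p x\<bar> \<le> N" for x by (auto simp: cell_weight_def indicator_def)
qed

lemma sum_cells:
  fixes g :: "int \<times> int \<Rightarrow> real"
  assumes "finite I" shows "(\<Sum>p\<in>I. indicator (cell N p) x * g p) = (if cell_index N x \<in> I then g (cell_index N x) else 0)"
proof -
  have "(\<Sum>p\<in>I. indicator (cell N p) x * g p) = (\<Sum>p\<in>I. if cell_index N x = p then g p else 0)"
    by (intro sum.cong) (auto simp: cell_def indicator_def)
  then show ?thesis using assms by (simp add: sum.delta)
qed

lemma abs_l2_sum:
  assumes "finite I" "\<And>p. p \<in> I \<Longrightarrow> L2 (f p)"
  shows "L2 (\<lambda>x. \<Sum>p\<in>I. f p x)" "(\<Sum>p\<in>I. abs_l2 (f p)) = abs_l2 (\<lambda>x. \<Sum>p\<in>I. f p x)"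
proof -
  have "L2 (\<lambda>x. \<Sum>p\<in>I. f p x) \<and> (\<Sum>p\<in>I. abs_l2 (f p)) = abs_l2 (\<lambda>x. \<Sum>p\<in>I. f p x)"
    using assms by (induction I rule: finite_induct) (simp_all add: L2_zero L2_add abs_l2_add flip: zero_l2_abs)
  then show "L2 (\<lambda>x. \<Sum>p\<in>I. f p x)" "(\<Sum>p\<in>I. abs_l2 (f p)) = abs_l2 (\<lambda>x. \<Sum>p\<in>I. f p x)" by auto
qed

text \<open>The index set \<open>I\<close> omits the first \<open>n\<close> columns of cells, where
  no uniform lower bound for the weight is available. The approximation is 0 there, with error
  bounded by the strip estimate; on the other cells it is the mean, with error bounded by the
  Poincare inequality for side \<open>1 / N\<close>.\<close>

lemma finite_rank_estimate:
  fixes u D1 D2 :: "R2 \<Rightarrow> real"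
  assumes c: "continuous_on UNIV u" "continuous_on UNIV D1" "continuous_on UNIV D2"
    and d1: "\<And>x y. ((\<lambda>t. u (t, y)) has_real_derivative D1 (x, y)) (at x)"
    and d2: "\<And>x y. ((\<lambda>t. u (x, t)) has_real_derivative D2 (x, y)) (at y)"
    and z: "\<And>y. u (0, y) = 0" and N: "0 < n" "n < N" and I: "I = {int n..<int N} \<times> {0..<int N}"
  shows "(norm (abs_l2 u - (\<Sum>p\<in>I. inner (abs_l2 u) (abs_l2 (cell_weight N p)) *\<^sub>R abs_l2 (cell_weight N p))))\<^sup>2
     \<le> (n / N)\<^sup>2 * (\<integral>x. (D1 x)\<^sup>2 \<partial>LOm) +
       2 / (real N)\<^sup>2 * (\<integral>x. indicator {x. n / N \<le> fst x} x * ((D1 x)\<^sup>2 + (D2 x)\<^sup>2) \<partial>LOm)"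
proof -
  have N0: "0 < N" using N by simp
  have I0: "p \<in> {0..<int N} \<times> {0..<int N}" if "p \<in> I" for p using that by (auto simp: I)
  have fI: "finite I" by (simp add: I)
  define m where "m p = integral (ccell N p) u / (1 / N)\<^sup>2" for p
  have Lu: "L2 u" by (rule L2_continuous[OF c(1)])
  have Lw: "L2 (cell_weight N p)" if "p \<in> I" for p by (rule L2_cell_weight[OF N0 I0[OF that]])
  have proj: "inner (abs_l2 u) (abs_l2 (cell_weight N p)) *\<^sub>R abs_l2 (cell_weight N p)
      = abs_l2 (\<lambda>x. indicator (cell N p) x * m p)" if p: "p \<in> I" for p
  proof -
    have "inner (abs_l2 u) (abs_l2 (cell_weight N p)) = (\<integral>x. indicator (cell N p) x * u x * real N \<partial>LOm)"
      unfolding abs_l2_inner[OF Lu Lw[OF p]] by (simp add: cell_weight_def mult_ac)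
    also have "\<dots> = integral (ccell N p) u * N" using cell_integral(2)[OF N0 I0[OF p] c(1)] by simp
    finally have "inner (abs_l2 u) (abs_l2 (cell_weight N p)) *\<^sub>R abs_l2 (cell_weight N p)
      = abs_l2 (\<lambda>x. integral (ccell N p) u * N * cell_weight N p x)" by (simp add: abs_l2_scale Lw[OF p])
    also have "(\<lambda>x. integral (ccell N p) u * N * cell_weight N p x) = (\<lambda>x. indicator (cell N p) x * m p)"
      by (auto simp: cell_weight_def m_def power2_eq_square)
    finally show ?thesis .
  qed
  have Lm: "L2 (\<lambda>x. indicator (cell N p) x * m p)" if "p \<in> I" for p
    using L2_scale[OF Lw[OF that], of "m p / N"] N0 by (simp add: cell_weight_def mult_ac)
  define P where "P x = (\<Sum>p\<in>I. indicator (cell N p) x * m p)" for x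
  have LP: "L2 P" and PP: "(\<Sum>p\<in>I. inner (abs_l2 u) (abs_l2 (cell_weight N p)) *\<^sub>R abs_l2 (cell_weight N p)) = abs_l2 P"
    using abs_l2_sum[OF fI Lm] proj unfolding P_def by simp_all
  define E where "E x = indicator {x. fst x < n / N \<and> x \<in> Omega} x * (u x)\<^sup>2 + (\<Sum>p\<in>I. indicator (cell N p) x * (u x - m p)\<^sup>2)" for x
  \<comment> \<open>\<open>n / N\<close> is a grid line, so a point of the square lies in an omitted
    cell exactly when it lies in the left strip.\<close>
  have idx: "if cell_index N x \<in> I then n / N \<le> fst x else fst x < n / N" if x: "x \<in> Omega" for x
  proof -
    have b: "0 < real N * fst x" "real N * fst x < N" "0 < real N * snd x" "real N * snd x < N"
      using x N0 by (auto simp: Omega_def)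
    have "cell_index N x \<in> I \<longleftrightarrow> int n \<le> \<lfloor>real N * fst x\<rfloor>"
      using b by (auto simp: I cell_index_def le_floor_iff floor_less_iff)
    also have "\<dots> \<longleftrightarrow> n / N \<le> fst x" using N0 by (simp add: le_floor_iff field_simps)
    finally show ?thesis by auto
  qed
  have pt: "(u x - P x)\<^sup>2 = E x" if x: "x \<in> Omega" for x
    using idx[OF x] x by (cases "cell_index N x \<in> I") (auto simp: P_def E_def sum_cells[OF fI])
  define \<delta> where "\<delta> = real n / real N"
  have \<delta>: "0 < \<delta>" "\<delta> < 1" using N N0 by (simp_all add: \<delta>_def)
  have strip: "{x. fst x < n / N \<and> x \<in> Omega} = {0<..<\<delta>} \<times> {0<..<1}"
    unfolding \<delta>_def[symmetric] using \<delta> by (auto simp: Omega_def)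
  have st: "integrable LOm (\<lambda>x. indicator {x. fst x < n / N \<and> x \<in> Omega} x * (u x)\<^sup>2)"
    "(\<integral>x. indicator {x. fst x < n / N \<and> x \<in> Omega} x * (u x)\<^sup>2 \<partial>LOm) = integral (cbox (0, 0) (n / N, 1)) (\<lambda>x. (u x)\<^sup>2)"
    unfolding strip unfolding \<delta>_def[symmetric] using \<delta>
    by (intro LOm_indicator_integral[of _ _ "(0, 0)" "(\<delta>, 1)"] continuous_intros c borel_Times;
        auto simp: box_prod cbox_Pair_eq Omega_def)+
  have ce: "integrable LOm (\<lambda>x. indicator (cell N p) x * (u x - m p)\<^sup>2)"
    "(\<integral>x. indicator (cell N p) x * (u x - m p)\<^sup>2 \<partial>LOm) = integral (ccell N p) (\<lambda>x. (u x - m p)\<^sup>2)" if "p \<in> I" for p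
    by (intro cell_integral[OF N0 I0[OF that]] continuous_intros c)+
  let ?g = "\<lambda>x. (D1 x)\<^sup>2 + (D2 x)\<^sup>2"
  have gc: "continuous_on UNIV ?g" by (intro continuous_intros c)
  have "(norm (abs_l2 u - abs_l2 P))\<^sup>2 = (\<integral>x. (u x - P x)\<^sup>2 \<partial>LOm)"
    by (simp add: abs_l2_diff Lu LP abs_l2_norm_sq L2_diff)
  also have "\<dots> = (\<integral>x. E x \<partial>LOm)"
    by (rule Bochner_Integration.integral_cong) (auto simp: pt space_restrict_space)
  also have "\<dots> = integral (cbox (0, 0) (n / N, 1)) (\<lambda>x. (u x)\<^sup>2) + (\<Sum>p\<in>I. integral (ccell N p) (\<lambda>x. (u x - m p)\<^sup>2))"
    unfolding E_def using st ce by (subst Bochner_Integration.integral_add) (auto simp: Bochner_Integration.integral_sum)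
  also have "\<dots> \<le> (n / N)\<^sup>2 * integral (cbox (0, 0) (1, 1)) (\<lambda>x. (D1 x)\<^sup>2)
      + (\<Sum>p\<in>I. 2 * (1 / real N)\<^sup>2 * integral (ccell N p) ?g)"
  proof (intro add_mono sum_mono)
    show "integral (cbox (0, 0) (n / N, 1)) (\<lambda>x. (u x)\<^sup>2) \<le> (n / N)\<^sup>2 * integral (cbox (0, 0) (1, 1)) (\<lambda>x. (D1 x)\<^sup>2)"
      using N by (intro strip_estimate c d1 z) auto
    show "integral (ccell N p) (\<lambda>x. (u x - m p)\<^sup>2) \<le> 2 * (1 / real N)\<^sup>2 * integral (ccell N p) ?g" for p
      unfolding m_def using N0 by (intro poincare_square[OF c d1 d2 _ ccell_def]) auto
  qed
  also have "(\<Sum>p\<in>I. 2 * (1 / real N)\<^sup>2 * integral (ccell N p) ?g) = 2 / (real N)\<^sup>2 * (\<Sum>p\<in>I. integral (ccell N p) ?g)"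
    by (simp add: sum_distrib_left power_divide)
  also have "(\<Sum>p\<in>I. integral (ccell N p) ?g) = (\<integral>x. (\<Sum>p\<in>I. indicator (cell N p) x * ?g x) \<partial>LOm)"
    using cell_integral[OF N0 I0 gc] by (subst Bochner_Integration.integral_sum) auto
  also have "\<dots> = (\<integral>x. indicator {x. n / N \<le> fst x} x * ?g x \<partial>LOm)"
  proof (rule Bochner_Integration.integral_cong)
    fix x assume "x \<in> space LOm"
    then have "x \<in> Omega" by (simp add: space_restrict_space)
    from idx[OF this] show "(\<Sum>p\<in>I. indicator (cell N p) x * ?g x) = indicator {x. n / N \<le> fst x} x * ?g x"
      by (cases "cell_index N x \<in> I") (auto simp: sum_cells[OF fI])
  qed simp
  finally show ?thesis
    unfolding PP using integral_LOm_cbox[of "\<lambda>x. (D1 x)\<^sup>2"] c by (simp add: continuous_on_power)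
qed

subsection \<open>The weighted Sobolev space as a closed subspace\<close>

lemma L2_cong: "L2 f \<Longrightarrow> (\<And>x. x \<in> Omega \<Longrightarrow> f x = g x) \<Longrightarrow> L2 g"
  unfolding L2_def
  using measurable_cong[of LOm f g borel] Bochner_Integration.integrable_cong[of LOm LOm "\<lambda>x. (f x)\<^sup>2" "\<lambda>x. (g x)\<^sup>2"]
  by (simp add: space_restrict_space)

lemma abs_l2_cong: "L2 f \<Longrightarrow> (\<And>x. x \<in> Omega \<Longrightarrow> f x = g x) \<Longrightarrow> abs_l2 f = abs_l2 g"
  by (subst abs_l2_eq_iff) (auto intro: L2_cong AE_I2 simp: space_restrict_space)

lemma integrable_LOm_subset:
  fixes f :: "R2 \<Rightarrow> real"
  assumes "integrable LOm f" "K \<in> sets lebesgue" "K \<subseteq> Omega"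
  shows "integrable (lebesgue_on K) f"
proof -
  have "set_integrable lebesgue Omega f" "set_integrable lebesgue K f = integrable (lebesgue_on K) f"
    using assms Omega_sets by (simp_all add: set_integrable_def integrable_restrict_space)
  then show ?thesis using set_integrable_subset assms by blast
qed

definition cell_weights :: "l2 set" where
  "cell_weights = {abs_l2 (cell_weight N p) |N p. 0 < N \<and> p \<in> {0..<int N} \<times> {0..<int N}}"

lemma countable_cell_weights: "countable cell_weights"
proof -
  have "cell_weights \<subseteq> range (\<lambda>(N, p). abs_l2 (cell_weight N p))" by (auto simp: cell_weights_def)
  then show ?thesis by (rule countable_subset) simp
qed

text \<open>Distinct cells give orthogonal unit vectors. Injectivity is what allows the sum over a
  set of vectors in \<open>finite_rank_approx\<close> to be read as a sum over cells.\<close>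

lemma cell_weight_inj:
  assumes N: "0 < N" and I: "I \<subseteq> {0..<int N} \<times> {0..<int N}"
  shows "inj_on (\<lambda>p. abs_l2 (cell_weight N p)) I"
proof (rule inj_onI, rule ccontr)
  fix p q assume p: "p \<in> I" and q: "q \<in> I" and eq: "abs_l2 (cell_weight N p) = abs_l2 (cell_weight N q)" and "p \<noteq> q"
  have L: "L2 (cell_weight N p)" "L2 (cell_weight N q)" using p q I by (auto intro!: L2_cell_weight[OF N])
  have "cell_weight N p x * cell_weight N q x = 0" for x
    using \<open>p \<noteq> q\<close> by (auto simp: cell_weight_def cell_def indicator_def)
  then have "inner (abs_l2 (cell_weight N p)) (abs_l2 (cell_weight N q)) = 0"
    unfolding abs_l2_inner[OF L] by (simp only: integral_zero)
  moreover have "inner (abs_l2 (cell_weight N p)) (abs_l2 (cell_weight N p)) = 1"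
  proof -
    have "inner (abs_l2 (cell_weight N p)) (abs_l2 (cell_weight N p)) = (\<integral>x. indicator (cell N p) x * (real N)\<^sup>2 \<partial>LOm)"
      unfolding abs_l2_inner[OF L(1) L(1)]
      by (intro Bochner_Integration.integral_cong) (auto simp: cell_weight_def indicator_def power2_eq_square)
    also have "\<dots> = integral (ccell N p) (\<lambda>x. (real N)\<^sup>2)"
      using p I by (intro cell_integral(2)[OF N]) auto
    also have "\<dots> = 1" using N by (simp add: ccell_def content_square power2_eq_square)
    finally show ?thesis .
  qed
  ultimately show False using eq by simp
qed

locale weight =
  fixes h :: "real \<Rightarrow> real"
  assumes h_pos: "\<And>t. t \<in> {0<..1} \<Longrightarrow> 0 < h t" and h_cont: "continuous_on {0<..1} h"
    and h_bounded: "bounded (h ` {0..1})"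
begin

definition sqh :: "R2 \<Rightarrow> real" where "sqh x = sqrt (h (fst x))"

lemma sqh_pos: "x \<in> Omega \<Longrightarrow> 0 < sqh x"
  using h_pos by (auto simp: sqh_def Omega_def)

lemma sqh_sq: "x \<in> Omega \<Longrightarrow> sqh x * sqh x = h (fst x)"
  using h_pos by (auto simp: sqh_def Omega_def less_imp_le)

lemma sqh_continuous: "continuous_on Omega sqh"
  unfolding sqh_def
  by (intro continuous_intros continuous_on_compose2[OF h_cont]) (auto simp: Omega_def)

lemma sqh_measurable [measurable]: "sqh \<in> borel_measurable LOm"
  by (rule continuous_measurable_LOm[OF sqh_continuous])

lemma sqh_bounded: obtains B where "\<And>x. x \<in> Omega \<Longrightarrow> \<bar>sqh x\<bar> \<le> B"
proof -
  obtain B where B: "\<forall>t\<in>{0..1}. \<bar>h t\<bar> \<le> B" using h_bounded by (auto simp: bounded_iff)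
  have "\<bar>sqh x\<bar> \<le> sqrt B" if "x \<in> Omega" for x
    using bspec[OF B, of "fst x"] sqh_pos[OF that] that by (auto simp: sqh_def Omega_def)
  then show ?thesis using that by blast
qed

lemma L2_sqh: assumes "L2 f" shows "L2 (\<lambda>x. sqh x * f x)"
proof -
  obtain B where "\<And>x. x \<in> Omega \<Longrightarrow> \<bar>sqh x\<bar> \<le> B" using sqh_bounded by blast
  then show ?thesis by (rule L2_mult_bounded[OF assms sqh_measurable])
qed

text \<open>Compact subsets of the open square stay away from the degenerate edge. This permits
  division by \<open>sqh\<close> when the unweighted derivative is recovered from the weighted
  one.\<close>

lemma inverse_sqh_bounded_on_compact:
  assumes K: "compact K" "K \<subseteq> Omega"
  obtains B where "0 \<le> B" "\<And>x. x \<in> K \<Longrightarrow> \<bar>1 / sqh x\<bar> \<le> B"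
proof -
  have "continuous_on K (\<lambda>x. 1 / sqh x)"
    using K sqh_pos by (intro continuous_intros continuous_on_subset[OF sqh_continuous]) fastforce+
  then have "bounded ((\<lambda>x. 1 / sqh x) ` K)" using K(1) by (intro compact_imp_bounded compact_continuous_image)
  then obtain B where "\<And>x. x \<in> K \<Longrightarrow> \<bar>1 / sqh x\<bar> \<le> B" by (auto simp: bounded_iff)
  then show ?thesis using that[of "max B 0"] by fastforce
qed

text \<open>With the root of the weight in the last component, the product norm is the weighted
  Sobolev norm. No information is lost, as \<open>sqh\<close> is positive on
  \<open>Omega\<close>.\<close>

definition triple :: "(R2 \<Rightarrow> real) \<Rightarrow> (R2 \<Rightarrow> real) \<Rightarrow> (R2 \<Rightarrow> real) \<Rightarrow> l2 \<times> l2 \<times> l2" where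
  "triple u g1 g2 = (abs_l2 u, abs_l2 g1, abs_l2 (\<lambda>x. sqh x * g2 x))"

definition test_triples :: "(l2 \<times> l2 \<times> l2) set" where
  "test_triples = (\<lambda>\<phi>. triple \<phi> (pd False \<phi>) (pd True \<phi>)) ` Collect test_fun"

definition D :: "(l2 \<times> l2 \<times> l2) set" where "D = closure test_triples"

lemma L2_sqh_pd: "test_fun \<phi> \<Longrightarrow> L2 (\<lambda>x. sqh x * pd j \<phi> x)"
  by (intro L2_sqh test_fun_L2)

lemma test_triples_lin:
  assumes "U \<in> test_triples" "W \<in> test_triples" shows "a *\<^sub>R U + b *\<^sub>R W \<in> test_triples"
proof -
  obtain f g where fg: "test_fun f" "test_fun g"
    and UW: "U = triple f (pd False f) (pd True f)" "W = triple g (pd False g) (pd True g)"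
    using assms by (auto simp: test_triples_def)
  note sm = fg[THEN test_fun_smooth]
  note L = fg[THEN test_fun_L2(1)] fg[THEN test_fun_L2(2)] fg[THEN L2_sqh_pd]
  have "a *\<^sub>R U + b *\<^sub>R W = triple (\<lambda>x. a * f x + b * g x) (pd False (\<lambda>x. a * f x + b * g x)) (pd True (\<lambda>x. a * f x + b * g x))"
    unfolding UW triple_def pd_lin[OF sm]
    by (simp add: abs_l2_scale abs_l2_add L L2_scale) (simp add: algebra_simps)
  then show ?thesis using test_fun_lin[OF fg] by (auto simp: test_triples_def)
qed

lemma zero_in_test_triples: "0 \<in> test_triples"
proof -
  have U: "triple (bump (1/8)) (pd False (bump (1/8))) (pd True (bump (1/8))) \<in> test_triples"
    unfolding test_triples_def by (rule imageI) (simp add: test_fun_bump)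
  from test_triples_lin[OF U U, of 0 0] show ?thesis by simp
qed

lemma subspace_D: "subspace D"
proof -
  have lin: "a *\<^sub>R U + b *\<^sub>R W \<in> D" if UW: "U \<in> D" "W \<in> D" for U W a b
  proof -
    obtain f g where f: "\<And>n. f n \<in> test_triples" "f \<longlonglongrightarrow> U" and g: "\<And>n. g n \<in> test_triples" "g \<longlonglongrightarrow> W"
      using UW unfolding D_def closure_sequential by blast
    have "(\<lambda>n. a *\<^sub>R f n + b *\<^sub>R g n) \<longlonglongrightarrow> a *\<^sub>R U + b *\<^sub>R W" by (intro tendsto_intros f g)
    then show ?thesis unfolding D_def closure_sequential
      by (intro exI[of _ "\<lambda>n. a *\<^sub>R f n + b *\<^sub>R g n"] conjI allI test_triples_lin f g)
  qed
  have "0 \<in> D" unfolding D_def using zero_in_test_triples closure_subset by blast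
  then show ?thesis using lin[of _ _ 1 1] lin[of _ _ _ 0] by (simp add: subspace_def)
qed

lemma h_lower_bound:
  assumes "0 < \<delta>" obtains c where "0 < c" "\<And>x. x \<in> Omega \<Longrightarrow> \<delta> \<le> fst x \<Longrightarrow> c \<le> h (fst x)"
proof (cases "\<delta> \<le> 1")
  case True
  have "\<exists>t\<in>{\<delta>..1}. \<forall>s\<in>{\<delta>..1}. h t \<le> h s"
    using assms True by (intro continuous_attains_inf continuous_on_subset[OF h_cont]) auto
  then obtain t where "t \<in> {\<delta>..1}" "\<And>s. s \<in> {\<delta>..1} \<Longrightarrow> h t \<le> h s" by blast
  then show ?thesis using that[of "h t"] h_pos[of t] assms by (auto simp: Omega_def)
next
  case False
  then show ?thesis using that[of 1] by (auto simp: Omega_def)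
qed

text \<open>The inequality is proved for test functions, whose derivatives are classical, and passes
  to the closure because both sides are continuous in \<open>U\<close> for the fixed finite set
  \<open>W\<close>.\<close>

lemma finite_rank_approx_D:
  assumes \<epsilon>: "0 < \<epsilon>"
  shows "\<exists>W\<subseteq>cell_weights. finite W \<and> (\<forall>U\<in>D. norm (fst U - (\<Sum>w\<in>W. inner (fst U) w *\<^sub>R w)) \<le> \<epsilon> * norm U)"
proof -
  obtain m :: nat where m: "2 < real m" "2 / \<epsilon> < real m"
    using reals_Archimedean2[of "max 2 (2 / \<epsilon>)"] by auto
  define \<delta> where "\<delta> = 1 / real m"
  have \<delta>: "0 < \<delta>" "\<delta> < 1" "\<delta>\<^sup>2 \<le> \<epsilon>\<^sup>2 / 4"
  proof -
    have "\<delta> \<le> \<epsilon> / 2" using m \<epsilon> by (simp add: \<delta>_def field_simps)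
    then have "\<delta>\<^sup>2 \<le> (\<epsilon> / 2)\<^sup>2" using m by (intro power_mono) (auto simp: \<delta>_def)
    then show "\<delta>\<^sup>2 \<le> \<epsilon>\<^sup>2 / 4" by (simp add: power_divide)
  qed (use m in \<open>auto simp: \<delta>_def\<close>)
  obtain c where c: "0 < c" "\<And>x. x \<in> Omega \<Longrightarrow> \<delta> \<le> fst x \<Longrightarrow> c \<le> h (fst x)"
    using h_lower_bound[OF \<delta>(1)] by blast
  \<comment> \<open>The order of choices matters: the strip width \<open>\<delta> = 1 / m\<close> is
    fixed by \<open>\<epsilon>\<close> alone, it determines the lower bound \<open>c\<close> of the
    weight beyond the strip, and only then is the mesh refined relative to \<open>c\<close>. With
    \<open>N = m * n\<close> the ratio \<open>n / N\<close> is exactly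
    \<open>\<delta>\<close>.\<close>
  obtain n :: nat where n: "max (8 / \<epsilon>\<^sup>2) (2 / (c * \<epsilon>\<^sup>2)) < real n" using reals_Archimedean2 by blast
  have n0: "0 < n" using n \<epsilon> by (intro gr0I) (auto simp: field_simps)
  define N where "N = m * n"
  have N: "0 < n" "n < N" "real n / real N = \<delta>" "0 < N" using n0 m by (auto simp: N_def \<delta>_def)
  have N1: "2 / (real N)\<^sup>2 \<le> \<epsilon>\<^sup>2 / 4" "2 / (real N)\<^sup>2 / c \<le> \<epsilon>\<^sup>2"
  proof -
    have "real n \<le> real N" using N(2) by simp
    also have "real N \<le> (real N)\<^sup>2" using N(4) by (simp add: power2_eq_square)
    finally have nN: "real n \<le> (real N)\<^sup>2" .
    then have "2 / (real N)\<^sup>2 \<le> 2 / real n" using n0 N(4) by (intro divide_left_mono mult_pos_pos) auto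
    moreover have "2 / real n \<le> \<epsilon>\<^sup>2 / 4" "2 / real n \<le> \<epsilon>\<^sup>2 * c"
      using n n0 \<epsilon> c(1) by (auto simp: field_simps)
    ultimately have "2 / (real N)\<^sup>2 \<le> \<epsilon>\<^sup>2 / 4" "2 / (real N)\<^sup>2 \<le> \<epsilon>\<^sup>2 * c" by linarith+
    then show "2 / (real N)\<^sup>2 \<le> \<epsilon>\<^sup>2 / 4" "2 / (real N)\<^sup>2 / c \<le> \<epsilon>\<^sup>2"
      using c(1) unfolding pos_divide_le_eq[OF c(1)] by blast+
  qed
  define I where "I = {int n..<int N} \<times> {0..<int N}"
  define W where "W = (\<lambda>p. abs_l2 (cell_weight N p)) ` I"
  have I: "I \<subseteq> {0..<int N} \<times> {0..<int N}" by (auto simp: I_def)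
  have W: "W \<subseteq> cell_weights" unfolding W_def cell_weights_def using N(4) I by blast
  have fin: "finite W" by (simp add: W_def I_def)
  have sumW: "(\<Sum>w\<in>W. inner x w *\<^sub>R w) = (\<Sum>p\<in>I. inner x (abs_l2 (cell_weight N p)) *\<^sub>R abs_l2 (cell_weight N p))" for x
    unfolding W_def by (subst sum.reindex[OF cell_weight_inj[OF N(4) I]]) simp
  have test: "norm (fst U - (\<Sum>w\<in>W. inner (fst U) w *\<^sub>R w)) \<le> \<epsilon> * norm U" if UT: "U \<in> test_triples" for U
  proof -
    obtain f where f: "test_fun f" and U: "U = triple f (pd False f) (pd True f)"
      using UT unfolding test_triples_def by blast
    note sm = test_fun_smooth[OF f]
    let ?A = "\<integral>x. (pd False f x)\<^sup>2 \<partial>LOm" and ?B = "\<integral>x. (sqh x * pd True f x)\<^sup>2 \<partial>LOm"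
    have A: "integrable LOm (\<lambda>x. (pd False f x)\<^sup>2)" and B: "integrable LOm (\<lambda>x. (sqh x * pd True f x)\<^sup>2)"
      using test_fun_L2(2)[OF f] L2_sqh_pd[OF f] by (auto simp: L2_def)
    have "f (0, y) = 0" for y using f by (auto simp: Omega_def intro: test_fun_zero_Omega)
    from finite_rank_estimate[OF smooth2_continuous(1)[OF sm] smooth2_continuous(2)[OF sm] smooth2_continuous(2)[OF sm]
        smooth2_has_pd[OF sm] this N(1,2) I_def]
    have "(norm (fst U - (\<Sum>w\<in>W. inner (fst U) w *\<^sub>R w)))\<^sup>2 \<le> \<delta>\<^sup>2 * ?A
       + 2 / (real N)\<^sup>2 * (\<integral>x. indicator {x. \<delta> \<le> fst x} x * ((pd False f x)\<^sup>2 + (pd True f x)\<^sup>2) \<partial>LOm)"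
      unfolding sumW N(3) by (simp add: U triple_def)
    \<comment> \<open>Beyond the strip the weight is at least \<open>c\<close>, so the plain
      vertical derivative is traded for the weighted one at the cost of the factor
      \<open>1 / c\<close>.\<close>
    also have "\<dots> \<le> \<delta>\<^sup>2 * ?A + 2 / (real N)\<^sup>2 * (\<integral>x. (pd False f x)\<^sup>2 + (sqh x * pd True f x)\<^sup>2 / c \<partial>LOm)"
    proof (intro add_left_mono mult_left_mono integral_mono')
      show "integrable LOm (\<lambda>x. (pd False f x)\<^sup>2 + (sqh x * pd True f x)\<^sup>2 / c)" using A B by auto
      fix x assume "x \<in> space LOm"
      then have x: "x \<in> Omega" by (simp add: space_restrict_space)
      show "0 \<le> (pd False f x)\<^sup>2 + (sqh x * pd True f x)\<^sup>2 / c" using c by auto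
      show "indicator {x. \<delta> \<le> fst x} x * ((pd False f x)\<^sup>2 + (pd True f x)\<^sup>2) \<le> (pd False f x)\<^sup>2 + (sqh x * pd True f x)\<^sup>2 / c"
      proof (cases "\<delta> \<le> fst x")
        case True
        have "c * (pd True f x)\<^sup>2 \<le> h (fst x) * (pd True f x)\<^sup>2" using c(2)[OF x True] by (intro mult_right_mono) auto
        also have "\<dots> = (sqh x * pd True f x)\<^sup>2" unfolding sqh_sq[OF x, symmetric] by (simp add: power2_eq_square mult_ac)
        finally show ?thesis using True c(1) by (simp add: field_simps)
      qed (use c in auto)
    qed auto
    also have "\<dots> = (\<delta>\<^sup>2 + 2 / (real N)\<^sup>2) * ?A + 2 / (real N)\<^sup>2 / c * ?B"
      using A B by (simp add: algebra_simps)
    also have "\<dots> \<le> \<epsilon>\<^sup>2 * ?A + \<epsilon>\<^sup>2 * ?B"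
    proof -
      have "\<delta>\<^sup>2 + 2 / (real N)\<^sup>2 \<le> \<epsilon>\<^sup>2" using N1(1) \<delta>(3) zero_le_power2[of \<epsilon>] by linarith
      then show ?thesis using N1(2) by (intro add_mono mult_right_mono) simp_all
    qed
    also have "\<dots> \<le> (\<epsilon> * norm U)\<^sup>2"
    proof -
      have "?A + ?B \<le> (norm U)\<^sup>2"
        unfolding U triple_def norm_prod_sq fst_conv snd_conv
        using f by (simp add: abs_l2_norm_sq test_fun_L2 L2_sqh_pd)
      then show ?thesis by (simp add: power_mult_distrib distrib_left[symmetric] mult_left_mono)
    qed
    finally show ?thesis by (rule power2_le_imp_le) (use \<epsilon> in auto)
  qed
  have "closed {U :: l2 \<times> l2 \<times> l2. norm (fst U - (\<Sum>w\<in>W. inner (fst U) w *\<^sub>R w)) \<le> \<epsilon> * norm U}"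
    by (intro closed_Collect_le continuous_intros)
  then have "D \<subseteq> {U. norm (fst U - (\<Sum>w\<in>W. inner (fst U) w *\<^sub>R w)) \<le> \<epsilon> * norm U}"
    unfolding D_def using test by (intro closure_minimal) auto
  then show ?thesis using W fin by blast
qed

sublocale compact_form_domain D cell_weights
  by unfold_locales
     (use subspace_D finite_rank_approx_D countable_cell_weights in \<open>auto simp: D_def\<close>)

section \<open>The closed subspace as the space of functions with weak derivatives\<close>

lemma dist_triple_sq:
  assumes "L2 u" "L2 g1" "L2 (\<lambda>x. sqh x * g2 x)" "L2 v" "L2 w1" "L2 (\<lambda>x. sqh x * w2 x)"
  shows "(dist (triple u g1 g2) (triple v w1 w2))\<^sup>2 = Hh_dist2 h u g1 g2 v w1 w2"
proof -
  have "(\<integral>x. (sqh x * g2 x - sqh x * w2 x)\<^sup>2 \<partial>LOm) = (\<integral>x. h (fst x) * (g2 x - w2 x)\<^sup>2 \<partial>LOm)"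
  proof (rule Bochner_Integration.integral_cong)
    fix x assume "x \<in> space LOm"
    then have "x \<in> Omega" by (simp add: space_restrict_space)
    then show "(sqh x * g2 x - sqh x * w2 x)\<^sup>2 = h (fst x) * (g2 x - w2 x)\<^sup>2"
      by (simp add: sqh_sq[symmetric] power2_eq_square algebra_simps)
  qed simp
  moreover have "(dist (a, b, c) (a', b', c'))\<^sup>2 = (dist a a')\<^sup>2 + (dist b b')\<^sup>2 + (dist c c')\<^sup>2" for a b c a' b' c' :: l2
    by (simp add: dist_prod_def)
  ultimately show ?thesis using assms unfolding triple_def Hh_dist2_def by (simp add: abs_l2_dist_sq)
qed

lemma Hh_L2: "Hh0 h u g1 g2 \<Longrightarrow> L2 u" "Hh0 h u g1 g2 \<Longrightarrow> L2 g1" "Hh0 h u g1 g2 \<Longrightarrow> L2 (\<lambda>x. sqh x * g2 x)"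
  by (auto simp: Hh0_def Hh_def sqh_def)

lemma Hh0_triple_in_D: assumes "Hh0 h u g1 g2" shows "triple u g1 g2 \<in> D"
proof -
  obtain \<phi> where \<phi>: "\<And>n. test_fun (\<phi> n)" and
    lim: "(\<lambda>n. Hh_dist2 h u g1 g2 (\<phi> n) (pd False (\<phi> n)) (pd True (\<phi> n))) \<longlonglongrightarrow> 0"
    using assms by (auto simp: Hh0_def)
  let ?T = "\<lambda>n. triple (\<phi> n) (pd False (\<phi> n)) (pd True (\<phi> n))"
  have "(\<lambda>n. (dist (triple u g1 g2) (?T n))\<^sup>2) \<longlonglongrightarrow> 0"
    using lim by (simp add: dist_triple_sq Hh_L2[OF assms] test_fun_L2[OF \<phi>] L2_sqh_pd[OF \<phi>])
  from tendsto_real_sqrt[OF this] have "(\<lambda>n. dist (triple u g1 g2) (?T n)) \<longlonglongrightarrow> 0" by simp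
  then have "?T \<longlonglongrightarrow> triple u g1 g2" by (subst tendsto_dist_iff) (simp add: dist_commute)
  moreover have "?T n \<in> test_triples" for n unfolding test_triples_def using \<phi> by (intro imageI) simp
  ultimately show ?thesis unfolding D_def closure_sequential by (intro exI[of _ ?T] conjI allI)
qed

text \<open>Integration by parts holds for the approximating test functions, and each side is an
  inner product with a fixed function, so it survives the limit. The second weak derivative is the
  last component divided by \<open>sqh\<close>.\<close>

lemma D_E_Hh0:
  assumes "U \<in> D" obtains u g1 g2 where "Hh0 h u g1 g2" "U = triple u g1 g2"
proof -
  obtain T where T: "\<And>n. T n \<in> test_triples" "T \<longlonglongrightarrow> U" using assms unfolding D_def closure_sequential by blast
  have "\<exists>\<phi>. test_fun \<phi> \<and> T n = triple \<phi> (pd False \<phi>) (pd True \<phi>)" for n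
    using T(1)[of n] unfolding test_triples_def by blast
  then obtain \<phi> where \<phi>: "\<And>n. test_fun (\<phi> n)" and T_eq: "\<And>n. T n = triple (\<phi> n) (pd False (\<phi> n)) (pd True (\<phi> n))"
    by metis
  define u where "u = rep_l2 (fst U)"
  define g1 where "g1 = rep_l2 (fst (snd U))"
  define G where "G = rep_l2 (snd (snd U))"
  define g2 where "g2 x = G x / sqh x" for x
  have L: "L2 u" "L2 g1" "L2 G" by (simp_all add: u_def g1_def G_def L2_rep)
  have GG: "sqh x * g2 x = G x" if "x \<in> Omega" for x using sqh_pos[OF that] by (simp add: g2_def)
  have Lg2: "L2 (\<lambda>x. sqh x * g2 x)" by (rule L2_cong[OF L(3)]) (simp add: GG)
  have U_eq: "U = triple u g1 g2"
  proof -
    have "abs_l2 (\<lambda>x. sqh x * g2 x) = abs_l2 G" by (rule abs_l2_cong[OF L(3), symmetric]) (simp add: GG)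
    then show ?thesis by (simp add: triple_def u_def g1_def G_def abs_rep_l2)
  qed
  have meas: "u \<in> borel_measurable LOm" "g1 \<in> borel_measurable LOm" "g2 \<in> borel_measurable LOm"
    using L unfolding g2_def by (auto simp: L2_def)
  have lim1: "(\<lambda>n. abs_l2 (\<phi> n)) \<longlonglongrightarrow> abs_l2 u"
    and lim2: "(\<lambda>n. abs_l2 (pd False (\<phi> n))) \<longlonglongrightarrow> abs_l2 g1"
    and lim3: "(\<lambda>n. abs_l2 (\<lambda>x. sqh x * pd True (\<phi> n) x)) \<longlonglongrightarrow> abs_l2 G"
    using tendsto_fst[OF T(2)] tendsto_fst[OF tendsto_snd[OF T(2)]] tendsto_snd[OF tendsto_snd[OF T(2)]]
    by (simp_all add: T_eq triple_def u_def g1_def G_def abs_rep_l2)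
  have intK: "integrable (lebesgue_on K) u" "integrable (lebesgue_on K) g1" "integrable (lebesgue_on K) g2"
    if K: "compact K" "K \<subseteq> Omega" for K
  proof -
    have Km: "K \<in> sets lebesgue" using K(1) by (simp add: borel_compact)
    show "integrable (lebesgue_on K) u" "integrable (lebesgue_on K) g1"
      by (rule integrable_LOm_subset[OF L2_integrable[OF L(1)] Km K(2)], rule integrable_LOm_subset[OF L2_integrable[OF L(2)] Km K(2)])
    obtain B where B: "0 \<le> B" "\<And>x. x \<in> K \<Longrightarrow> \<bar>1 / sqh x\<bar> \<le> B" using inverse_sqh_bounded_on_compact[OF K] by blast
    have "L2 (\<lambda>x. (indicator K x / sqh x) * G x)"
    proof (rule L2_mult_bounded[OF L(3)])
      have "indicat_real K \<in> borel_measurable LOm"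
        using Km by (intro measurable_restrict_space1 borel_measurable_indicator)
      then show "(\<lambda>x. indicator K x / sqh x) \<in> borel_measurable LOm" by auto
      show "\<bar>indicator K x / sqh x\<bar> \<le> B" for x using B by (cases "x \<in> K") auto
    qed
    then have "integrable (lebesgue_on K) (\<lambda>x. (indicator K x / sqh x) * G x)"
      by (rule integrable_LOm_subset[OF L2_integrable Km K(2)])
    moreover have "integrable (lebesgue_on K) (\<lambda>x. (indicator K x / sqh x) * G x) = integrable (lebesgue_on K) g2"
      by (rule Bochner_Integration.integrable_cong) (auto simp: g2_def space_restrict_space)
    ultimately show "integrable (lebesgue_on K) g2" by simp
  qed
  have w1: "(\<integral>x. u x * pd False \<psi> x \<partial>LOm) = - (\<integral>x. g1 x * \<psi> x \<partial>LOm)" if \<psi>: "test_fun \<psi>" for \<psi>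
  proof -
    note L\<psi> = test_fun_L2[OF \<psi>]
    have "inner (abs_l2 (\<phi> n)) (abs_l2 (pd False \<psi>)) = - inner (abs_l2 (pd False (\<phi> n))) (abs_l2 \<psi>)" for n
      using test_fun_integration_by_parts[OF \<phi> \<psi>] by (simp add: abs_l2_inner test_fun_L2[OF \<phi>] L\<psi>)
    moreover have "(\<lambda>n. inner (abs_l2 (\<phi> n)) (abs_l2 (pd False \<psi>))) \<longlonglongrightarrow> inner (abs_l2 u) (abs_l2 (pd False \<psi>))"
      by (intro tendsto_intros lim1)
    moreover have "(\<lambda>n. - inner (abs_l2 (pd False (\<phi> n))) (abs_l2 \<psi>)) \<longlonglongrightarrow> - inner (abs_l2 g1) (abs_l2 \<psi>)"
      by (intro tendsto_intros lim2)
    ultimately have "inner (abs_l2 u) (abs_l2 (pd False \<psi>)) = - inner (abs_l2 g1) (abs_l2 \<psi>)"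
      using LIMSEQ_unique by simp
    then show ?thesis by (simp add: abs_l2_inner L L\<psi>)
  qed
  have w2: "(\<integral>x. u x * pd True \<psi> x \<partial>LOm) = - (\<integral>x. g2 x * \<psi> x \<partial>LOm)" if \<psi>: "test_fun \<psi>" for \<psi>
  proof -
    note L\<psi> = test_fun_L2[OF \<psi>]
    \<comment> \<open>Only the weighted derivatives converge, so the weight is shifted onto the test
      function. \<open>\<psi>\<close> has compact support in \<open>Omega\<close>, where
      \<open>1 / sqh\<close> is bounded, hence \<open>\<eta>\<close> is square integrable.\<close>
    define \<eta> where "\<eta> x = \<psi> x / sqh x" for x
    have L\<eta>: "L2 \<eta>"
    proof -
      let ?K = "closure {x. \<psi> x \<noteq> 0}"
      have K: "compact ?K" "?K \<subseteq> Omega" using \<psi> by (auto simp: test_fun_def)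
      obtain B where B: "0 \<le> B" "\<And>x. x \<in> ?K \<Longrightarrow> \<bar>1 / sqh x\<bar> \<le> B" using inverse_sqh_bounded_on_compact[OF K] by blast
      have "L2 (\<lambda>x. (indicator ?K x / sqh x) * \<psi> x)"
      proof (rule L2_mult_bounded[OF L\<psi>(1)])
        have "?K \<in> sets lebesgue" by simp
        then have "indicat_real ?K \<in> borel_measurable LOm"
          by (intro measurable_restrict_space1 borel_measurable_indicator)
        then show "(\<lambda>x. indicator ?K x / sqh x) \<in> borel_measurable LOm" by auto
        show "\<bar>indicator ?K x / sqh x\<bar> \<le> B" for x using B by (cases "x \<in> ?K") auto
      qed
      then show ?thesis
      proof (rule L2_cong)
        show "(indicator ?K x / sqh x) * \<psi> x = \<eta> x" for x
          using test_fun_zero[OF \<psi>, of x] by (cases "x \<in> ?K") (simp_all add: \<eta>_def)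
      qed
    qed
    have "inner (abs_l2 (\<phi> n)) (abs_l2 (pd True \<psi>)) = - inner (abs_l2 (\<lambda>x. sqh x * pd True (\<phi> n) x)) (abs_l2 \<eta>)" for n
    proof -
      have "(\<integral>x. (sqh x * pd True (\<phi> n) x) * \<eta> x \<partial>LOm) = (\<integral>x. pd True (\<phi> n) x * \<psi> x \<partial>LOm)"
      proof (rule Bochner_Integration.integral_cong)
        fix x assume "x \<in> space LOm"
        then have "sqh x \<noteq> 0" using sqh_pos[of x] by (simp add: space_restrict_space)
        then show "(sqh x * pd True (\<phi> n) x) * \<eta> x = pd True (\<phi> n) x * \<psi> x" by (simp add: \<eta>_def)
      qed simp
      then show ?thesis
        using test_fun_integration_by_parts[OF \<phi> \<psi>, of n True]
        by (simp add: abs_l2_inner test_fun_L2[OF \<phi>] L2_sqh_pd[OF \<phi>] L\<psi> L\<eta>)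
    qed
    moreover have "(\<lambda>n. inner (abs_l2 (\<phi> n)) (abs_l2 (pd True \<psi>))) \<longlonglongrightarrow> inner (abs_l2 u) (abs_l2 (pd True \<psi>))"
      by (intro tendsto_intros lim1)
    moreover have "(\<lambda>n. - inner (abs_l2 (\<lambda>x. sqh x * pd True (\<phi> n) x)) (abs_l2 \<eta>)) \<longlonglongrightarrow> - inner (abs_l2 G) (abs_l2 \<eta>)"
      by (intro tendsto_intros lim3)
    ultimately have "inner (abs_l2 u) (abs_l2 (pd True \<psi>)) = - inner (abs_l2 G) (abs_l2 \<eta>)"
      using LIMSEQ_unique by simp
    moreover have "(\<lambda>x. G x * \<eta> x) = (\<lambda>x. g2 x * \<psi> x)" by (simp add: \<eta>_def g2_def)
    ultimately show ?thesis by (simp add: abs_l2_inner L L\<psi> L\<eta>)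
  qed
  have "Hh h u g1 g2"
    unfolding Hh_def weak_pd_def using L Lg2 meas intK w1 w2 by (auto simp: sqh_def)
  moreover have "(\<lambda>n. (dist (T n) U)\<^sup>2) \<longlonglongrightarrow> 0\<^sup>2"
    using T(2) by (intro tendsto_power) (simp add: tendsto_dist_iff[symmetric])
  then have "(\<lambda>n. Hh_dist2 h u g1 g2 (\<phi> n) (pd False (\<phi> n)) (pd True (\<phi> n))) \<longlonglongrightarrow> 0"
    unfolding U_eq T_eq
    by (simp add: dist_commute dist_triple_sq L Lg2 test_fun_L2[OF \<phi>] L2_sqh_pd[OF \<phi>])
  ultimately have "Hh0 h u g1 g2" unfolding Hh0_def using \<phi> by blast
  then show ?thesis using that U_eq by blast
qed

end

subsection \<open>Potentials\<close>

text \<open>An arbitrary \<open>V\<close> need not preserve square integrability, so the operator is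
  defined through a chosen representative; for admissible \<open>V\<close> the result does not
  depend on that choice.\<close>

definition multiply :: "(R2 \<Rightarrow> real) \<Rightarrow> l2 \<Rightarrow> l2" where
  "multiply V X = abs_l2 (\<lambda>x. V x * rep_l2 X x)"

definition potential_form :: "(R2 \<Rightarrow> real) \<Rightarrow> l2 \<Rightarrow> l2 \<Rightarrow> real" where
  "potential_form V X Y = inner (multiply V X) Y"

lemma Sadm_AE_bounded: "0 \<le> m \<Longrightarrow> V \<in> Sadm m M \<Longrightarrow> AE x in LOm. \<bar>V x\<bar> \<le> M"
  unfolding Sadm_def mem_Collect_eq by (elim conjE eventually_mono) simp

lemma L2_Sadm_mult:
  assumes "0 \<le> m" "V \<in> Sadm m M" "L2 f" shows "L2 (\<lambda>x. V x * f x)"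
  using L2_mult_AE_bounded(1)[OF assms(3) _ Sadm_AE_bounded[OF assms(1,2)]] assms(2) by (simp add: Sadm_def)

lemma multiply_abs:
  assumes "0 \<le> m" "V \<in> Sadm m M" "L2 f"
  shows "multiply V (abs_l2 f) = abs_l2 (\<lambda>x. V x * f x)"
proof -
  have "AE x in LOm. V x * rep_l2 (abs_l2 f) x = V x * f x"
    using rep_abs_l2[OF assms(3)] by eventually_elim simp
  then show ?thesis
    unfolding multiply_def by (subst abs_l2_eq_iff) (auto intro: L2_Sadm_mult[OF assms(1,2)] L2_rep assms(3))
qed

lemma potential_form_abs:
  assumes "0 \<le> m" "V \<in> Sadm m M" "L2 f" "L2 g"
  shows "potential_form V (abs_l2 f) (abs_l2 g) = (\<integral>x. V x * f x * g x \<partial>LOm)"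
  unfolding potential_form_def
  by (simp add: multiply_abs[OF assms(1-3)] abs_l2_inner L2_Sadm_mult[OF assms(1-3)] assms(4))

lemma norm_multiply_le:
  assumes "0 \<le> m" "m \<le> M" "V \<in> Sadm m M" shows "norm (multiply V X) \<le> M * norm X"
proof -
  obtain f where f: "L2 f" "X = abs_l2 f" by (rule l2_cases)
  have "(norm (multiply V X))\<^sup>2 \<le> (M * norm X)\<^sup>2"
    using L2_mult_AE_bounded(2)[OF f(1) _ Sadm_AE_bounded[OF assms(1,3)]] assms(3) f
    by (simp add: multiply_abs[OF assms(1,3)] abs_l2_norm_sq L2_Sadm_mult[OF assms(1,3)] power_mult_distrib Sadm_def)
  then show ?thesis by (rule power2_le_imp_le) (use assms in auto)
qed

lemma potential_potential_form:
  assumes m: "0 \<le> m" "m \<le> M" and V: "V \<in> Sadm m M"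
  shows "potential M (potential_form V)"
proof -
  have mult_lin: "multiply V (X + Y) = multiply V X + multiply V Y" "multiply V (c *\<^sub>R X) = c *\<^sub>R multiply V X" for X Y c
  proof -
    obtain f where f: "L2 f" "X = abs_l2 f" by (rule l2_cases)
    obtain g where g: "L2 g" "Y = abs_l2 g" by (rule l2_cases)
    note [simp] = abs_l2_add abs_l2_scale L2_add L2_scale L2_Sadm_mult[OF m(1) V] multiply_abs[OF m(1) V] f(1) g(1)
    show "multiply V (X + Y) = multiply V X + multiply V Y" "multiply V (c *\<^sub>R X) = c *\<^sub>R multiply V X"
      unfolding f(2) g(2) by (simp_all add: distrib_left mult.left_commute)
  qed
  have bd: "\<bar>potential_form V X Y\<bar> \<le> M * (norm X * norm Y)" for X Y
  proof -
    have "\<bar>potential_form V X Y\<bar> \<le> norm (multiply V X) * norm Y"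
      unfolding potential_form_def by (rule Cauchy_Schwarz_ineq2)
    also have "\<dots> \<le> M * norm X * norm Y" by (intro mult_right_mono norm_multiply_le[OF m V]) auto
    finally show ?thesis by (simp add: mult.assoc)
  qed
  have "bounded_bilinear (potential_form V)"
  proof
    show "\<exists>K. \<forall>a b. norm (potential_form V a b) \<le> norm a * norm b * K"
      using bd by (intro exI[of _ M]) (simp add: mult_ac)
  qed (simp_all add: potential_form_def mult_lin inner_simps)
  moreover have "potential_form V X Y = potential_form V Y X" for X Y
  proof -
    obtain f where f: "L2 f" "X = abs_l2 f" by (rule l2_cases)
    obtain g where g: "L2 g" "Y = abs_l2 g" by (rule l2_cases)
    show ?thesis unfolding f(2) g(2) by (simp add: potential_form_abs[OF m(1) V] f(1) g(1) mult_ac)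
  qed
  moreover have "0 \<le> potential_form V X X" for X
  proof -
    obtain f where f: "L2 f" "X = abs_l2 f" by (rule l2_cases)
    have "AE x in LOm. 0 \<le> V x * f x * f x"
      using V m(1) unfolding Sadm_def by (auto elim!: eventually_mono simp: mult.assoc)
    then show ?thesis unfolding f(2) by (simp add: potential_form_abs[OF m(1) V] f(1) integral_nonneg_AE)
  qed
  ultimately show ?thesis using bd by (simp add: potential_def)
qed

lemma L2_Sadm: assumes "0 \<le> m" "V \<in> Sadm m M" shows "L2 V"
proof -
  interpret finite_measure LOm by (rule finite_measure_LOm)
  have "L2 (\<lambda>x. 1)" by (simp add: L2_def)
  from L2_Sadm_mult[OF assms this] show ?thesis by simp
qed

lemma norm_Sadm_le: assumes "0 \<le> m" "m \<le> M" "V \<in> Sadm m M" shows "norm (abs_l2 V) \<le> M * norm (abs_l2 (\<lambda>x. 1))"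
proof -
  interpret finite_measure LOm by (rule finite_measure_LOm)
  have "L2 (\<lambda>x. 1)" by (simp add: L2_def)
  with norm_multiply_le[OF assms, of "abs_l2 (\<lambda>x. 1)"] show ?thesis by (simp add: multiply_abs[OF assms(1,3)])
qed

text \<open>Truncating to \<open>[m, M]\<close> does not increase the distance to an admissible potential.\<close>

lemma closed_Sadm:
  assumes m: "0 \<le> m" "m \<le> M" shows "closed (abs_l2 ` Sadm m M)"
  unfolding closed_sequential_limits
proof (intro allI impI)
  fix X l assume X: "(\<forall>n. X n \<in> abs_l2 ` Sadm m M) \<and> X \<longlonglongrightarrow> l"
  obtain f where f: "L2 f" "l = abs_l2 f" by (rule l2_cases)
  define g where "g x = max m (min M (f x))" for x
  have [measurable]: "f \<in> borel_measurable LOm" using f by (simp add: L2_def)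
  have gS: "g \<in> Sadm m M" unfolding Sadm_def g_def using m by auto
  then have Lg: "L2 g" by (rule L2_Sadm[OF m(1)])
  have le: "dist l (abs_l2 g) \<le> dist l (X n)" for n
  proof -
    obtain V where V: "V \<in> Sadm m M" "X n = abs_l2 V" using X by blast
    note LV = L2_Sadm[OF m(1) V(1)]
    have "(dist l (abs_l2 g))\<^sup>2 \<le> (dist l (X n))\<^sup>2"
      unfolding f(2) V(2) abs_l2_dist_sq[OF f(1) Lg] abs_l2_dist_sq[OF f(1) LV]
    proof (rule integral_mono_AE)
      have "AE x in LOm. m \<le> V x \<and> V x \<le> M" using V(1) by (simp add: Sadm_def)
      then show "AE x in LOm. (f x - g x)\<^sup>2 \<le> (f x - V x)\<^sup>2"
      proof eventually_elim
        case (elim x)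
        then have "\<bar>f x - g x\<bar> \<le> \<bar>f x - V x\<bar>" by (auto simp: g_def)
        then show ?case by (simp add: abs_le_square_iff)
      qed
    qed (use L2_diff[OF f(1) Lg] L2_diff[OF f(1) LV] in \<open>auto simp: L2_def\<close>)
    then show ?thesis by (rule power2_le_imp_le) simp
  qed
  have "(\<lambda>n. dist l (X n)) \<longlonglongrightarrow> dist l l" using X by (intro tendsto_intros) auto
  then have "dist l (abs_l2 g) \<le> dist l l" by (rule LIMSEQ_le_const) (use le in auto)
  then show "l \<in> abs_l2 ` Sadm m M" using gS by auto
qed

lemma convex_Sadm:
  assumes m: "0 \<le> m" shows "convex (abs_l2 ` Sadm m M)"
proof (rule convexI)
  fix X Y and a b :: real assume XY: "X \<in> abs_l2 ` Sadm m M" "Y \<in> abs_l2 ` Sadm m M" and ab: "0 \<le> a" "0 \<le> b" "a + b = 1"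
  obtain V W where VW: "V \<in> Sadm m M" "X = abs_l2 V" "W \<in> Sadm m M" "Y = abs_l2 W" using XY by blast
  have "AE x in LOm. m \<le> V x \<and> V x \<le> M" "AE x in LOm. m \<le> W x \<and> W x \<le> M"
    using VW by (simp_all add: Sadm_def)
  then have "AE x in LOm. m \<le> a * V x + b * W x \<and> a * V x + b * W x \<le> M"
  proof eventually_elim
    case (elim x)
    have "a * m + b * m \<le> a * V x + b * W x" "a * V x + b * W x \<le> a * M + b * M"
      using elim ab by (auto intro!: add_mono mult_left_mono)
    then show ?case using ab(3) by (simp flip: distrib_right)
  qed
  then have "(\<lambda>x. a * V x + b * W x) \<in> Sadm m M" using VW by (auto simp: Sadm_def)
  moreover have "a *\<^sub>R X + b *\<^sub>R Y = abs_l2 (\<lambda>x. a * V x + b * W x)"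
    using VW by (simp add: abs_l2_scale abs_l2_add L2_scale L2_Sadm[OF m])
  ultimately show "a *\<^sub>R X + b *\<^sub>R Y \<in> abs_l2 ` Sadm m M" by blast
qed

text \<open>The matrix element of \<open>V\<close> between two cell weights is the inner product of
  \<open>V\<close> with their product. This countable family is therefore all that weak convergence
  of potentials must be tested against.\<close>

definition cell_products :: "l2 set" where
  "cell_products = range (\<lambda>(N, p, N', p'). abs_l2 (\<lambda>x. cell_weight N p x * cell_weight N' p' x))"

lemma potential_form_cell_weights:
  assumes m: "0 \<le> m" and w: "w \<in> cell_weights" "w' \<in> cell_weights"
  obtains y where "y \<in> cell_products" "\<And>V. V \<in> Sadm m M \<Longrightarrow> potential_form V w w' = inner (abs_l2 V) y"
proof -
  obtain N p N' p' where N: "0 < N" "p \<in> {0..<int N} \<times> {0..<int N}" "w = abs_l2 (cell_weight N p)"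
    and N': "0 < N'" "p' \<in> {0..<int N'} \<times> {0..<int N'}" "w' = abs_l2 (cell_weight N' p')"
    using w unfolding cell_weights_def by blast
  note L = L2_cell_weight[OF N(1,2)] L2_cell_weight[OF N'(1,2)]
  have LL: "L2 (\<lambda>x. cell_weight N p x * cell_weight N' p' x)"
    by (rule L2_mult_bounded[OF L(2) L2_measurable[OF L(1)], of N]) (auto simp: cell_weight_def indicator_def)
  show ?thesis
  proof (rule that)
    show "abs_l2 (\<lambda>x. cell_weight N p x * cell_weight N' p' x) \<in> cell_products"
      unfolding cell_products_def by (rule image_eqI[of _ _ "(N, p, N', p')"]) auto
    show "potential_form V w w' = inner (abs_l2 V) (abs_l2 (\<lambda>x. cell_weight N p x * cell_weight N' p' x))"
      if "V \<in> Sadm m M" for V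
      unfolding N(3) N'(3) potential_form_abs[OF m that L] abs_l2_inner[OF L2_Sadm[OF m that] LL]
      by (simp add: mult.assoc)
  qed
qed

subsection \<open>The first two eigenvalues\<close>

context weight
begin

lemma energy_triple:
  assumes m: "0 \<le> m" "V \<in> Sadm m M" and u: "Hh0 h u g1 g2" and v: "Hh0 h v w1 w2"
  shows "energy (potential_form V) (triple u g1 g2) (triple v w1 w2)
    = (\<integral>x. g1 x * w1 x + h (fst x) * g2 x * w2 x + V x * u x * v x \<partial>LOm)"
proof -
  note Lu = Hh_L2[OF u] and Lv = Hh_L2[OF v]
  note int = L2_integrable_mult[OF Lu(2) Lv(2)] L2_integrable_mult[OF Lu(3) Lv(3)]
    L2_integrable_mult[OF L2_Sadm_mult[OF m Lu(1)] Lv(1)]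
  have "energy (potential_form V) (triple u g1 g2) (triple v w1 w2)
    = (\<integral>x. g1 x * w1 x \<partial>LOm) + (\<integral>x. (sqh x * g2 x) * (sqh x * w2 x) \<partial>LOm) + (\<integral>x. V x * u x * v x \<partial>LOm)"
    by (simp add: energy_def triple_def abs_l2_inner Lu Lv potential_form_abs[OF m Lu(1) Lv(1)])
  also have "\<dots> = (\<integral>x. g1 x * w1 x + (sqh x * g2 x) * (sqh x * w2 x) + V x * u x * v x \<partial>LOm)"
    using int by simp
  also have "\<dots> = (\<integral>x. g1 x * w1 x + h (fst x) * g2 x * w2 x + V x * u x * v x \<partial>LOm)"
  proof (rule Bochner_Integration.integral_cong)
    fix x assume "x \<in> space LOm"
    then have "x \<in> Omega" by (simp add: space_restrict_space)
    then show "g1 x * w1 x + (sqh x * g2 x) * (sqh x * w2 x) + V x * u x * v x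
      = g1 x * w1 x + h (fst x) * g2 x * w2 x + V x * u x * v x"
      by (simp add: sqh_sq[symmetric] mult_ac)
  qed simp
  finally show ?thesis .
qed

text \<open>Every member of \<open>D\<close> is the triple of some function with weak derivatives,
  so the weak equation for functions becomes an equation tested against all of
  \<open>D\<close>.\<close>

lemma eigenpairD:
  assumes m: "0 \<le> m" "V \<in> Sadm m M" and e: "eigenpair h V l u"
  obtains U where "L2 u" "U \<in> D" "fst U = abs_l2 u" "abs_l2 u \<noteq> 0"
    "\<And>W. W \<in> D \<Longrightarrow> energy (potential_form V) U W = l * inner (fst U) (fst W)"
proof -
  obtain g1 g2 where u: "Hh0 h u g1 g2" and nz: "\<not> (AE x in LOm. u x = 0)"
    and eq: "\<And>v w1 w2. Hh0 h v w1 w2 \<Longrightarrow>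
          (\<integral>x. g1 x * w1 x + h (fst x) * g2 x * w2 x + V x * u x * v x \<partial>LOm) = l * (\<integral>x. u x * v x \<partial>LOm)"
    using e unfolding eigenpair_def by blast
  note Lu = Hh_L2[OF u]
  show ?thesis
  proof (rule that[OF Lu(1) Hh0_triple_in_D[OF u]])
    show "fst (triple u g1 g2) = abs_l2 u" by (simp add: triple_def)
    show "abs_l2 u \<noteq> 0" using nz by (simp add: zero_l2_abs abs_l2_eq_iff Lu L2_zero)
    fix W assume "W \<in> D"
    then obtain v w1 w2 where v: "Hh0 h v w1 w2" "W = triple v w1 w2" by (rule D_E_Hh0)
    show "energy (potential_form V) (triple u g1 g2) W = l * inner (fst (triple u g1 g2)) (fst W)"
      unfolding v(2) energy_triple[OF m u v(1)] eq[OF v(1)]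
      by (simp add: triple_def abs_l2_inner Lu Hh_L2[OF v(1)])
  qed
qed

lemma eigenpairI:
  assumes m: "0 \<le> m" "V \<in> Sadm m M" and U: "U \<in> D" "fst U \<noteq> 0"
    and eq: "\<And>W. W \<in> D \<Longrightarrow> energy (potential_form V) U W = l * inner (fst U) (fst W)"
  obtains u where "L2 u" "fst U = abs_l2 u" "eigenpair h V l u"
proof -
  obtain u g1 g2 where u: "Hh0 h u g1 g2" "U = triple u g1 g2" using U(1) by (rule D_E_Hh0)
  note Lu = Hh_L2[OF u(1)]
  have fU: "fst U = abs_l2 u" by (simp add: u triple_def)
  have "\<not> (AE x in LOm. u x = 0)" using U(2) by (simp add: fU zero_l2_abs abs_l2_eq_iff Lu L2_zero)
  moreover have "(\<integral>x. g1 x * w1 x + h (fst x) * g2 x * w2 x + V x * u x * v x \<partial>LOm) = l * (\<integral>x. u x * v x \<partial>LOm)"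
    if v: "Hh0 h v w1 w2" for v w1 w2
    using eq[OF Hh0_triple_in_D[OF v]] energy_triple[OF m u(1) v]
    by (simp add: u(2) triple_def abs_l2_inner Lu Hh_L2[OF v])
  ultimately have "eigenpair h V l u" unfolding eigenpair_def using u(1) by blast
  then show ?thesis using that Lu(1) fU by blast
qed

lemma eigenvalue_ge:
  assumes es: "eigensystem D q E1 l1 E2 l2" and U: "U \<in> D" "fst U \<noteq> 0"
    and eq: "\<And>W. W \<in> D \<Longrightarrow> energy q U W = l * inner (fst U) (fst W)"
  shows "l1 \<le> l"
proof -
  have "l1 * (norm (fst U))\<^sup>2 \<le> energy q U U" using es U(1) unfolding eigensystem_def by blast
  then have "l1 * (norm (fst U))\<^sup>2 \<le> l * (norm (fst U))\<^sup>2" using eq[OF U(1)] by (simp add: power2_norm_eq_inner)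
  then show ?thesis using U(2) by (simp add: mult_le_cancel_right)
qed

text \<open>Two independent eigenvectors span a plane on which the energy is at most
  \<open>\<mu>\<close> times the squared norm, and the min-max bound applies. The vectors need not
  be orthogonal, so the cross term requires an argument.\<close>

lemma second_eigenvalue_le_eigenvalues:
  assumes q: "potential M q" and es: "eigensystem D q E1 l1 E2 l2" and U: "U \<in> D" and W: "W \<in> D"
    and indep: "\<And>a b. a *\<^sub>R fst U + b *\<^sub>R fst W = 0 \<Longrightarrow> a = 0 \<and> b = 0"
    and eU: "\<And>Z. Z \<in> D \<Longrightarrow> energy q U Z = l * inner (fst U) (fst Z)"
    and eW: "\<And>Z. Z \<in> D \<Longrightarrow> energy q W Z = l' * inner (fst W) (fst Z)"
    and le: "l \<le> \<mu>" "l' \<le> \<mu>"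
  shows "l2 \<le> \<mu>"
proof (rule second_eigenvalue_le[OF es U W indep])
  fix a b :: real
  let ?Z = "a *\<^sub>R U + b *\<^sub>R W" and ?i = "inner (fst U) (fst W)"
  \<comment> \<open>Symmetry of the energy: either the two eigenvalues agree, and the whole plane
    consists of solutions for that value, or the first components are orthogonal and the cross term
    vanishes.\<close>
  have "l * ?i = l' * ?i"
    using eU[OF W] eW[OF U] energy_commute[OF q, of U W] by (simp only: inner_commute)
  then have "l = l' \<or> ?i = 0" by auto
  have en: "energy q ?Z ?Z = a\<^sup>2 * (l * (norm (fst U))\<^sup>2) + b\<^sup>2 * (l' * (norm (fst W))\<^sup>2) + 2 * a * b * (l * ?i)"
    using eU[OF W] eU[OF U] eW[OF W] energy_commute[OF q, of U W]
    by (simp add: energy_lin[OF q] power2_norm_eq_inner) (simp add: power2_eq_square algebra_simps)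
  have nm: "(norm (fst ?Z))\<^sup>2 = a\<^sup>2 * (norm (fst U))\<^sup>2 + b\<^sup>2 * (norm (fst W))\<^sup>2 + 2 * a * b * ?i"
    unfolding power2_norm_eq_inner by (simp add: inner_simps inner_commute power2_eq_square algebra_simps)
  show "energy q ?Z ?Z \<le> \<mu> * (norm (fst ?Z))\<^sup>2"
    using \<open>l = l' \<or> ?i = 0\<close>
  proof
    assume "l = l'"
    then have "energy q ?Z ?Z = l * (norm (fst ?Z))\<^sup>2" unfolding en nm by (simp add: algebra_simps)
    also have "\<dots> \<le> \<mu> * (norm (fst ?Z))\<^sup>2" using le by (intro mult_right_mono) auto
    finally show ?thesis .
  next
    assume i: "?i = 0"
    have "energy q ?Z ?Z = l * (a\<^sup>2 * (norm (fst U))\<^sup>2) + l' * (b\<^sup>2 * (norm (fst W))\<^sup>2)"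
      unfolding en by (simp add: i)
    also have "\<dots> \<le> \<mu> * (a\<^sup>2 * (norm (fst U))\<^sup>2) + \<mu> * (b\<^sup>2 * (norm (fst W))\<^sup>2)"
      using le by (intro add_mono mult_right_mono) auto
    also have "\<dots> = \<mu> * (norm (fst ?Z))\<^sup>2" unfolding nm by (simp add: i distrib_left)
    finally show ?thesis .
  qed
qed

text \<open>In both cases the set whose infimum defines \<open>eig\<close> has a least element: the
  eigenvectors of the system witness membership, and the variational characterisation bounds every
  other member from below.\<close>

lemma eig_eq_eigensystem:
  assumes m: "0 \<le> m" "m \<le> M" and V: "V \<in> Sadm m M" and es: "eigensystem D (potential_form V) E1 l1 E2 l2"
  shows "eig h V 1 = l1" "eig h V 2 = l2"
proof -
  note q = potential_potential_form[OF m V]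
  note sp = eigensystem_span[OF q es subspace_H]
  have E: "E1 \<in> D" "E2 \<in> D" "fst E1 \<noteq> 0" "fst E2 \<noteq> 0"
    and EL: "\<And>W. W \<in> D \<Longrightarrow> energy (potential_form V) E1 W = l1 * inner (fst E1) (fst W)"
      "\<And>W. W \<in> D \<Longrightarrow> energy (potential_form V) E2 W = l2 * inner (fst E2) (fst W)"
    using es unfolding eigensystem_def by auto
  obtain e1 where e1: "L2 e1" "fst E1 = abs_l2 e1" "eigenpair h V l1 e1"
    using eigenpairI[OF m(1) V E(1,3) EL(1)] by blast
  obtain e2 where e2: "L2 e2" "fst E2 = abs_l2 e2" "eigenpair h V l2 e2"
    using eigenpairI[OF m(1) V E(2,4) EL(2)] by blast
  have indep_iff: "(AE x in LOm. a * f x + b * g x = 0) \<longleftrightarrow> a *\<^sub>R abs_l2 f + b *\<^sub>R abs_l2 g = 0"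
    if "L2 f" "L2 g" for f g a b
    using that by (simp add: abs_l2_scale abs_l2_add L2_scale L2_add zero_l2_abs abs_l2_eq_iff L2_zero)
  show "eig h V 1 = l1"
    unfolding eig_def
  proof (rule cInf_eq_minimum)
    let ?S = "{mu. \<exists>(u :: nat \<Rightarrow> R2 \<Rightarrow> real) (l :: nat \<Rightarrow> real).
       (\<forall>i<1. l i \<le> mu \<and> eigenpair h V (l i) (u i)) \<and> lin_indep_ae 1 u}"
    have "lin_indep_ae 1 (\<lambda>_. e1)"
      unfolding lin_indep_ae_def
    proof (intro allI impI)
      fix c :: "nat \<Rightarrow> real" and i :: nat assume "AE x in LOm. (\<Sum>i<1. c i * e1 x) = 0" and i: "i < 1"
      then have "AE x in LOm. c 0 * e1 x + 0 * e1 x = 0" by simp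
      then have "c 0 *\<^sub>R fst E1 = 0" using indep_iff[OF e1(1) e1(1), of "c 0" 0] e1(2) by simp
      then show "c i = 0" using i E(3) by simp
    qed
    then show "l1 \<in> ?S" using e1(3) by (intro CollectI exI[of _ "\<lambda>_. e1"] exI[of _ "\<lambda>_. l1"]) auto
    fix mu assume "mu \<in> ?S"
    then obtain u l where ul: "l \<le> mu" "eigenpair h V l u" by auto
    obtain U where U: "U \<in> D" "fst U = abs_l2 u" "abs_l2 u \<noteq> 0"
      "\<And>W. W \<in> D \<Longrightarrow> energy (potential_form V) U W = l * inner (fst U) (fst W)"
      using eigenpairD[OF m(1) V ul(2)] by metis
    have "l1 \<le> l" using U by (intro eigenvalue_ge[OF es]) auto
    then show "l1 \<le> mu" using ul by simp
  qed
  show "eig h V 2 = l2"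
    unfolding eig_def
  proof (rule cInf_eq_minimum)
    let ?S = "{mu. \<exists>(u :: nat \<Rightarrow> R2 \<Rightarrow> real) (l :: nat \<Rightarrow> real).
       (\<forall>i<2. l i \<le> mu \<and> eigenpair h V (l i) (u i)) \<and> lin_indep_ae 2 u}"
    let ?u = "\<lambda>i :: nat. if i = 0 then e1 else e2" and ?l = "\<lambda>i :: nat. if i = 0 then l1 else l2"
    have two: "{..<2 :: nat} = {0, 1}" by auto
    have "lin_indep_ae 2 ?u"
      unfolding lin_indep_ae_def
    proof (intro allI impI)
      fix c :: "nat \<Rightarrow> real" and i :: nat assume a: "AE x in LOm. (\<Sum>i<2. c i * ?u i x) = 0" and i: "i < 2"
      have "AE x in LOm. c 0 * e1 x + c 1 * e2 x = 0" using a by (simp add: two)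
      then have "c 0 *\<^sub>R fst E1 + c 1 *\<^sub>R fst E2 = 0" using indep_iff[OF e1(1) e2(1)] e1(2) e2(2) by simp
      then have "c 0 = 0 \<and> c 1 = 0" by (rule sp(4))
      then show "c i = 0" using i by (auto simp: less_2_cases_iff)
    qed
    then show "l2 \<in> ?S"
      using e1(3) e2(3) sp(5) by (intro CollectI exI[of _ ?u] exI[of _ ?l]) auto
    fix mu assume "mu \<in> ?S"
    then obtain u l where ul: "\<And>i :: nat. i < 2 \<Longrightarrow> l i \<le> mu" "\<And>i. i < 2 \<Longrightarrow> eigenpair h V (l i) (u i)"
      and li: "lin_indep_ae 2 u" by blast
    obtain U where U: "L2 (u 0)" "U \<in> D" "fst U = abs_l2 (u 0)"
      "\<And>W. W \<in> D \<Longrightarrow> energy (potential_form V) U W = l 0 * inner (fst U) (fst W)"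
      using eigenpairD[OF m(1) V ul(2)[of 0]] by (metis zero_less_numeral)
    obtain W where W: "L2 (u 1)" "W \<in> D" "fst W = abs_l2 (u 1)"
      "\<And>Z. Z \<in> D \<Longrightarrow> energy (potential_form V) W Z = l 1 * inner (fst W) (fst Z)"
      using eigenpairD[OF m(1) V ul(2)[of 1]] by (metis one_less_numeral_iff semiring_norm(76))
    show "l2 \<le> mu"
    proof (rule second_eigenvalue_le_eigenvalues[OF q es U(2) W(2) _ U(4) W(4)])
      fix a b assume "a *\<^sub>R fst U + b *\<^sub>R fst W = 0"
      then have ae: "AE x in LOm. a * u 0 x + b * u 1 x = 0" using indep_iff[OF U(1) W(1)] by (simp add: U(3) W(3))
      define c where "c i = (if i = 0 then a else b)" for i :: nat
      have "AE x in LOm. (\<Sum>i<2. c i * u i x) = 0" using ae by (simp add: two c_def)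
      then have "\<forall>i<2. c i = 0" using li unfolding lin_indep_ae_def by blast
      then show "a = 0 \<and> b = 0" by (auto simp: c_def dest: spec[of _ 0] spec[of _ 1])
    qed (use ul(1) in auto)
  qed
qed

lemma eigensystem_D_exists:
  assumes m: "0 \<le> m" "m \<le> M" and V: "V \<in> Sadm m M"
  obtains E1 l1 E2 l2 where "eigensystem D (potential_form V) E1 l1 E2 l2"
proof -
  let ?T = "\<lambda>a. triple (bump a) (pd False (bump a)) (pd True (bump a))"
  have T: "?T a \<in> D" if "0 < a" "a < 3/4" for a
    unfolding D_def test_triples_def using test_fun_bump[OF that]
    by (intro closure_subset[THEN subsetD] imageI) simp
  have "?T (1/8) \<in> D" "?T (5/8) \<in> D" by (rule T; simp)+
  from eigensystem_exists[OF potential_potential_form[OF m V] this] bumps_independent that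
  show ?thesis by (simp add: triple_def) metis
qed

lemma minimal_gap_attained:
  assumes m: "0 \<le> m" "m \<le> M"
  shows "\<exists>Vs\<in>Sadm m M. Gap h Vs = (INF V\<in>Sadm m M. Gap h V)"
proof -
  have "\<forall>V. \<exists>E1 l1 E2 l2. V \<in> Sadm m M \<longrightarrow> eigensystem D (potential_form V) E1 l1 E2 l2"
    using eigensystem_D_exists[OF m] by metis
  then obtain E1 l1 E2 l2 where
    es: "\<And>V. V \<in> Sadm m M \<Longrightarrow> eigensystem D (potential_form V) (E1 V) (l1 V) (E2 V) (l2 V)" by metis
  have gap: "Gap h V = l2 V - l1 V" if "V \<in> Sadm m M" for V
    unfolding Gap_def using eig_eq_eigensystem[OF m that es[OF that]] by simp
  have gap0: "0 \<le> Gap h V" if "V \<in> Sadm m M" for V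
    using eigensystem_span(5)[OF potential_potential_form[OF m that] es[OF that] subspace_H] gap[OF that] by simp
  have ne: "Sadm m M \<noteq> {}"
  proof -
    have "(\<lambda>x. m) \<in> Sadm m M" using m by (simp add: Sadm_def)
    then show ?thesis by blast
  qed
  let ?I = "INF V\<in>Sadm m M. Gap h V"
  \<comment> \<open>Nonnegativity of the gap, that is \<open>l1 \<le> l2\<close>, bounds the values
    from below, so \<open>?I\<close> is a genuine infimum with a minimising sequence.\<close>
  have bdd: "bdd_below (Gap h ` Sadm m M)" using gap0 by (intro bdd_belowI[of _ 0]) auto
  have "\<exists>V\<in>Sadm m M. Gap h V < ?I + 1 / Suc n" for n
    using cINF_less_iff[OF ne bdd, of "?I + 1 / Suc n"] by simp
  then obtain V where V: "\<And>n. V n \<in> Sadm m M" "\<And>n. Gap h (V n) < ?I + 1 / Suc n" by metis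
  have "countable cell_products" unfolding cell_products_def by simp
  then obtain r y where r: "strict_mono (r :: nat \<Rightarrow> nat)" "y \<in> abs_l2 ` Sadm m M"
    "\<And>z. z \<in> cell_products \<Longrightarrow> (\<lambda>n. inner (abs_l2 (V (r n))) z) \<longlonglongrightarrow> inner y z"
    using weakly_convergent_subsequence[OF closed_Sadm[OF m] convex_Sadm[OF m(1)], of "\<lambda>n. abs_l2 (V n)"]
      norm_Sadm_le[OF m V(1)] V(1) by (metis imageI)
  then obtain Vs where Vs: "Vs \<in> Sadm m M" "y = abs_l2 Vs" by blast
  have lim: "(\<lambda>n. potential_form (V (r n)) w w') \<longlonglongrightarrow> potential_form Vs w w'"
    if w: "w \<in> cell_weights" "w' \<in> cell_weights" for w w'
  proof -
    obtain z where z: "z \<in> cell_products" "\<And>V. V \<in> Sadm m M \<Longrightarrow> potential_form V w w' = inner (abs_l2 V) z"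
      using potential_form_cell_weights[OF m(1) w] by blast
    then show ?thesis using r(3)[OF z(1)] Vs V(1) by simp
  qed
  note conv = eigenvalues_converge[OF potential_potential_form[OF m Vs(1)] potential_potential_form[OF m V(1)]
      lim es[OF Vs(1)] es[OF V(1)]]
  have "(\<lambda>n. l2 (V (r n)) - l1 (V (r n))) \<longlonglongrightarrow> l2 Vs - l1 Vs" by (intro tendsto_diff conv)
  then have "(\<lambda>n. Gap h (V (r n))) \<longlonglongrightarrow> Gap h Vs" using gap V(1) Vs(1) by simp
  moreover have "(\<lambda>n. ?I + 1 / Suc n) \<longlonglongrightarrow> ?I"
    using tendsto_add[OF tendsto_const LIMSEQ_Suc[OF lim_1_over_n], of ?I] by simp
  moreover have "Gap h (V (r n)) \<le> ?I + 1 / Suc n" for n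
  proof -
    \<comment> \<open>A subsequence index satisfies \<open>n \<le> r n\<close>, so the bound of the
      minimising sequence holds along the subsequence with \<open>n\<close> in place of
      \<open>r n\<close>.\<close>
    have "1 / real (Suc (r n)) \<le> 1 / Suc n" using seq_suble[OF r(1), of n] by (intro divide_left_mono) auto
    then show ?thesis using V(2)[of "r n"] by linarith
  qed
  ultimately have "Gap h Vs \<le> ?I" by (intro LIMSEQ_le) auto
  moreover have "?I \<le> Gap h Vs" by (rule cINF_lower[OF bdd Vs(1)])
  ultimately show ?thesis using Vs(1) by (intro bexI[of _ Vs]) auto
qed

end

theorem theorem5p4:
  fixes h :: "real \<Rightarrow> real" and C \<theta> m M :: real
  assumes h_bdd: "bounded (h ` {0..1})"
    and h0: "h 0 = 0"
    and hpos: "\<forall>t\<in>{0<..1}. h t > 0"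
    and hC1: "\<exists>h'. continuous_on {0<..1} h' \<and>
                  (\<forall>t\<in>{0<..1}. (h has_real_derivative h' t) (at t within {0<..1}))"
    and C_pos: "C > 0" and \<theta>: "0 < \<theta>" "\<theta> < 1"
    and cond: "\<forall>x\<in>Omega. \<forall>r. 0 < r \<and> r \<le> diameter Omega \<longrightarrow>
                 (\<integral>\<^sup>+ y. ennreal (1 / h (fst y)) \<partial>lebesgue_on (ball x r \<inter> Omega))
                   \<le> ennreal (C * (measure lebesgue (ball x r \<inter> Omega)) powr \<theta>)"
    and mM: "0 \<le> m" "m \<le> M"
  shows "\<exists>Vs\<in>Sadm m M. Gap h Vs = (INF V\<in>Sadm m M. Gap h V)"
proof -
  have "continuous_on {0<..1} h" using hC1 by (blast intro: DERIV_continuous_on)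
  then interpret weight h using hpos h_bdd by unfold_locales auto
  show ?thesis by (rule minimal_gap_attained[OF mM])
qed

end
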